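(* Let $W$ be a finite Coxeter group with longest element $w_0$ and let $c$ be a Coxeter element of $W$. The map $w\mapsto ww_0$ maps the congruence $\Theta_c$ to the congruence $\Theta_{c^{-1}}$; that is, for all $x,y\in W$, $x\equiv y$ modulo $\Theta_c$ if and only if $xw_0\equiv yw_0$ modulo $\Theta_{c^{-1}}$. In particular, the weak order on $c$-sortable elements is anti-isomorphic to the weak order on $c^{-1}$-sortable elements.
   Context: A Coxeter group $W$ comes with a fixed finite set $S$ of simple generators and presentation $(st)^{m(s,t)}=1$ for $s,t\in S$, where $m(s,s)=1$ and $m(s,t)\ge 2$ for $s\ne t$. $l(w)$ is the length of $w$ with respect to $S$; a word in $S$ of length $l(w)$ representing $w$ is reduced. $T=\{wsw^{-1}:w\in W,s\in S\}$ is the set of reflections and $I(w)=\{t\in T:l(tw)<l(w)\}$ is the inversion set. The weak order is the right weak order: $v\le w$ iff $I(v)\subseteq I(w)$; equivalently its cover relations are $w\lessdot ws$ for $s\in S$ with $l(w)<l(ws)$. For $W$ finite it is a lattice with maximal element $w_0$, and $w\mapsto ww_0$ is an antiautomorphism of it. A Coxeter element $c$ of $W$ is an element represented by a word $a_1a_2\cdots a_n$ with $S=\{a_1,\ldots,a_n\}$ and $n=|S|$. Fix such a word for $c$ and form the half-infinite word $c^\infty=a_1\cdots a_n|a_1\cdots a_n|a_1\cdots a_n|\cdots$, where the dividers "$|$" are ignored when subwords are interpreted as elements of $W$. The $c$-sorting word for $w\in W$ is the lexicographically first (as a sequence of positions in $c^\infty$) subword of $c^\infty$ that is a reduced word for $w$.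 It defines a sequence of subsets of $S$: the sets of letters of the $c$-sorting word occurring between adjacent dividers. The element $w$ is $c$-sortable if this sequence is weakly decreasing under inclusion; this does not depend on the choice of reduced word for $c$. The weak order on $c$-sortable elements means the subposet of the weak order on $W$ induced by the $c$-sortable elements. For each $w\in W$ there is a unique maximal $c$-sortable element weakly below $w$, denoted $\pi_\downarrow^c(w)$. $\Theta_c$ is the lattice congruence of the weak order on $W$ defined by $x\equiv y$ iff $\pi_\downarrow^c(x)=\pi_\downarrow^c(y)$; the bottom (minimal) elements of its congruence classes are exactly the $c$-sortable elements. $\Theta_{c^{-1}}$ is the same construction for the Coxeter element $c^{-1}$. *)

theory Defs
  imports "HOL-Algebra.Algebra" "HOL-Library.Extended_Nat"
begin

section \<open>Group presentations and Coxeter systems\<close>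

text \<open>A letter \<open>(s, True)\<close> stands for the generator \<open>s\<close>, and \<open>(s, False)\<close> for its formal inverse.\<close>

type_synonym 'a signed_word = "('a \<times> bool) list"

definition signed_word_value :: "('a, 'b) monoid_scheme \<Rightarrow> 'a signed_word \<Rightarrow> 'a" where
  "signed_word_value G u = foldr (\<lambda>(s, e) x. (if e then s else inv\<^bsub>G\<^esub> s) \<otimes>\<^bsub>G\<^esub> x) u \<one>\<^bsub>G\<^esub>"

inductive presentation_step :: "'a set \<Rightarrow> 'a signed_word set \<Rightarrow> 'a signed_word \<Rightarrow> 'a signed_word \<Rightarrow> bool"
  for S :: "'a set" and R :: "'a signed_word set" where
  cancel: "s \<in> S \<Longrightarrow> presentation_step S R (u @ [(s, e), (s, \<not> e)] @ v) (u @ v)"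
| relator: "r \<in> R \<Longrightarrow> presentation_step S R (u @ r @ v) (u @ v)"

text \<open>
  The group with generators \<open>S\<close> and relators \<open>R\<close> consists of the signed words over \<open>S\<close> modulo
  the equivalence generated by \<open>presentation_step\<close>; the second part of the following definition
  says that evaluation of words identifies that quotient with the group \<open>G\<close>.
\<close>

definition group_presentation :: "('a, 'b) monoid_scheme \<Rightarrow> 'a set \<Rightarrow> 'a signed_word set \<Rightarrow> bool" where
  "group_presentation G S R \<longleftrightarrow>
     group G \<and> S \<subseteq> carrier G \<and> R \<subseteq> lists (S \<times> UNIV) \<and>
     generate G S = carrier G \<and>
     (\<forall>u \<in> lists (S \<times> UNIV). \<forall>v \<in> lists (S \<times> UNIV).
        signed_word_value G u = signed_word_value G v \<longleftrightarrow> equivclp (presentation_step S R) u v)"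

definition coxeter_matrix :: "'a set \<Rightarrow> ('a \<Rightarrow> 'a \<Rightarrow> enat) \<Rightarrow> bool" where
  "coxeter_matrix S m \<longleftrightarrow>
     (\<forall>s\<in>S. m s s = 1) \<and> (\<forall>s\<in>S. \<forall>t\<in>S. m s t = m t s) \<and> (\<forall>s\<in>S. \<forall>t\<in>S. s \<noteq> t \<longrightarrow> m s t \<ge> 2)"

text \<open>The value \<open>m s t = \<infinity>\<close> imposes no relation on \<open>s\<close> and \<open>t\<close>.\<close>

definition coxeter_relators :: "'a set \<Rightarrow> ('a \<Rightarrow> 'a \<Rightarrow> enat) \<Rightarrow> 'a signed_word set" where
  "coxeter_relators S m =
     {concat (replicate k [(s, True), (t, True)]) | s t k. s \<in> S \<and> t \<in> S \<and> m s t = enat k}"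

definition coxeter_system ::
    "('a, 'b) monoid_scheme \<Rightarrow> 'a set \<Rightarrow> ('a \<Rightarrow> 'a \<Rightarrow> enat) \<Rightarrow> bool" where
  "coxeter_system G S m \<longleftrightarrow>
     finite S \<and> coxeter_matrix S m \<and> group_presentation G S (coxeter_relators S m)"


section \<open>Length and weak order\<close>

definition word_value :: "('a, 'b) monoid_scheme \<Rightarrow> 'a list \<Rightarrow> 'a" where
  "word_value G u = foldr (\<otimes>\<^bsub>G\<^esub>) u \<one>\<^bsub>G\<^esub>"

definition cox_length :: "('a, 'b) monoid_scheme \<Rightarrow> 'a set \<Rightarrow> 'a \<Rightarrow> nat" where
  "cox_length G S w = (LEAST k. \<exists>u \<in> lists S. word_value G u = w \<and> length u = k)"

definition reduced_word :: "('a, 'b) monoid_scheme \<Rightarrow> 'a set \<Rightarrow> 'a \<Rightarrow> 'a list \<Rightarrow> bool" where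
  "reduced_word G S w u \<longleftrightarrow> u \<in> lists S \<and> word_value G u = w \<and> length u = cox_length G S w"

definition reflections :: "('a, 'b) monoid_scheme \<Rightarrow> 'a set \<Rightarrow> 'a set" where
  "reflections G S = {w \<otimes>\<^bsub>G\<^esub> s \<otimes>\<^bsub>G\<^esub> inv\<^bsub>G\<^esub> w | w s. w \<in> carrier G \<and> s \<in> S}"

definition inversions :: "('a, 'b) monoid_scheme \<Rightarrow> 'a set \<Rightarrow> 'a \<Rightarrow> 'a set" where
  "inversions G S w = {t \<in> reflections G S. cox_length G S (t \<otimes>\<^bsub>G\<^esub> w) < cox_length G S w}"

definition weak_le :: "('a, 'b) monoid_scheme \<Rightarrow> 'a set \<Rightarrow> 'a \<Rightarrow> 'a \<Rightarrow> bool" where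
  "weak_le G S v w \<longleftrightarrow> inversions G S v \<subseteq> inversions G S w"

definition longest_element :: "('a, 'b) monoid_scheme \<Rightarrow> 'a set \<Rightarrow> 'a \<Rightarrow> bool" where
  "longest_element G S w\<^sub>0 \<longleftrightarrow>
     w\<^sub>0 \<in> carrier G \<and> (\<forall>w \<in> carrier G. cox_length G S w \<le> cox_length G S w\<^sub>0)"


section \<open>Sorting words, sortable elements and the Cambrian congruence\<close>

definition coxeter_word :: "('a, 'b) monoid_scheme \<Rightarrow> 'a set \<Rightarrow> 'a \<Rightarrow> 'a list \<Rightarrow> bool" where
  "coxeter_word G S c a \<longleftrightarrow> set a = S \<and> length a = card S \<and> word_value G a = c"

text \<open>
  In what follows a Coxeter element is given by one of its words \<open>a\<close>. Positions in the
  half-infinite word \<open>a|a|a|\<dots>\<close> are counted from \<open>0\<close>, so that position \<open>p\<close> lies in block number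
  \<open>p div length a\<close>. A subword is a strictly increasing list of positions.
\<close>

definition letter_at :: "'a list \<Rightarrow> nat \<Rightarrow> 'a" where
  "letter_at a p = a ! (p mod length a)"

definition reduced_subword ::
    "('a, 'b) monoid_scheme \<Rightarrow> 'a set \<Rightarrow> 'a list \<Rightarrow> 'a \<Rightarrow> nat list \<Rightarrow> bool" where
  "reduced_subword G S a w ps \<longleftrightarrow>
     sorted_wrt (<) ps \<and> reduced_word G S w (map (letter_at a) ps)"

definition sorting_word ::
    "('a, 'b) monoid_scheme \<Rightarrow> 'a set \<Rightarrow> 'a list \<Rightarrow> 'a \<Rightarrow> nat list" where
  "sorting_word G S a w =
     (THE ps. reduced_subword G S a w ps \<and>
        (\<forall>qs. reduced_subword G S a w qs \<longrightarrow> qs = ps \<or> (ps, qs) \<in> lexord less_than))"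

definition sorting_block ::
    "('a, 'b) monoid_scheme \<Rightarrow> 'a set \<Rightarrow> 'a list \<Rightarrow> 'a \<Rightarrow> nat \<Rightarrow> 'a set" where
  "sorting_block G S a w k =
     letter_at a ` {p \<in> set (sorting_word G S a w). p div length a = k}"

definition sortable_elements ::
    "('a, 'b) monoid_scheme \<Rightarrow> 'a set \<Rightarrow> 'a list \<Rightarrow> 'a set" where
  "sortable_elements G S a =
     {w \<in> carrier G. \<forall>k. sorting_block G S a w (Suc k) \<subseteq> sorting_block G S a w k}"

definition maximal_sortable_below ::
    "('a, 'b) monoid_scheme \<Rightarrow> 'a set \<Rightarrow> 'a list \<Rightarrow> 'a \<Rightarrow> 'a \<Rightarrow> bool" where
  "maximal_sortable_below G S a w v \<longleftrightarrow>
     v \<in> sortable_elements G S a \<and> weak_le G S v w \<and>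
     (\<forall>u \<in> sortable_elements G S a. weak_le G S u w \<and> weak_le G S v u \<longrightarrow> u = v)"

definition pi_down :: "('a, 'b) monoid_scheme \<Rightarrow> 'a set \<Rightarrow> 'a list \<Rightarrow> 'a \<Rightarrow> 'a" where
  "pi_down G S a w = (THE v. maximal_sortable_below G S a w v)"

definition cambrian_congruence ::
    "('a, 'b) monoid_scheme \<Rightarrow> 'a set \<Rightarrow> 'a list \<Rightarrow> ('a \<times> 'a) set" where
  "cambrian_congruence G S a =
     {(x, y). x \<in> carrier G \<and> y \<in> carrier G \<and> pi_down G S a x = pi_down G S a y}"

definition anti_isomorphic ::
    "'a set \<Rightarrow> ('a \<Rightarrow> 'a \<Rightarrow> bool) \<Rightarrow> 'b set \<Rightarrow> ('b \<Rightarrow> 'b \<Rightarrow> bool) \<Rightarrow> bool" where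
  "anti_isomorphic A r B r' \<longleftrightarrow>
     (\<exists>f. bij_betw f A B \<and> (\<forall>x\<in>A. \<forall>y\<in>A. r x y \<longleftrightarrow> r' (f y) (f x)))"

end

theory Submission
  imports Defs Complex_Main
begin

text \<open>
  A congruence class of \<open>\<Theta>\<^sub>c\<close> is known once the greatest sortable element below its members is
  known, so the proof is about one recursion for that element. Let \<open>r\<close> be the first letter of the
  Coxeter word \<open>a = r # a'\<close>. If \<open>r\<close> is a left descent of \<open>x\<close>, take it off \<open>x\<close> and move it to the
  end of the word; otherwise delete it from the word. This defines \<open>proj a x\<close> for words \<open>a\<close> in any
  subset of \<open>S\<close> and all \<open>x\<close> in the whole group: only left descents that are letters of \<open>a\<close> are
  tested, so that parabolic subgroups need not be mentioned.

  That \<open>proj a y\<close> lies above every sortable \<open>z \<le> y\<close> (\<open>proj_greatest\<close>) is clear by induction unless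
  \<open>r\<close> is a left descent of \<open>y\<close> but not of \<open>z\<close>. In that case a chain of covers from \<open>z\<close> to \<open>y\<close>
  contains a cover \<open>x < r x\<close>. By induction \<open>z \<le> v\<close> for \<open>v = proj (a' @ [r]) x\<close>, and \<open>r v\<close> is a
  sortable element below \<open>y\<close>; so it suffices that \<open>v \<le> r v\<close>, that is, that left multiplication by
  \<open>r\<close> is a cover at the projection \<open>v\<close> because it is one at \<open>x\<close> (\<open>proj_last_cover\<close>).

  This is where roots are used. Following the same recursion, \<open>a\<close> and \<open>x\<close> determine a basis of
  roots, the walls, which \<open>inv x\<close> makes positive, and its dual basis, the rays, with respect to the
  Euler form of \<open>a\<close>. The Euler form is a bilinear form whose symmetrization is the invariant form
  and which is compatible with moving the first letter to the end. The rays form a cluster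
  (\<open>ray_cluster\<close>): each is a positive root or the negative of an inversion of the Coxeter element,
  and the positive ones have nonnegative products for the Euler form. As a consequence, if the last letter
  \<open>r\<close> is not a left descent of \<open>x\<close>, then \<open>alpha r\<close> is a nonnegative combination of walls. If
  moreover \<open>inv x\<close> makes \<open>alpha r\<close> a simple root, then \<open>alpha r\<close> must be one of the walls. A second
  induction (\<open>wall_simple_or_inversion\<close>) shows that \<open>inv v\<close> makes a wall \<open>\<beta>\<close> simple, unless \<open>v\<close>
  has an inversion \<open>\<delta>\<close> that is orthogonal to \<open>\<beta>\<close> for the Euler form and has a negative product with
  it for the invariant form; for \<open>\<beta> = alpha r\<close> this would give \<open>\<delta>\<close> a negative coordinate.

  Since the projection is greatest, the symmetry under \<open>x \<mapsto> x w\<^sub>0\<close> follows by looking at the last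
  letter \<open>p\<close> of \<open>a = b @ [p]\<close>, which is the first letter of \<open>rev a\<close> (\<open>proj_mult_longest\<close>). Let \<open>x\<close>
  and \<open>y\<close> have the same projection for \<open>a\<close>. Then \<open>p\<close> is a left descent of both or of neither,
  because \<open>p\<close> itself is sortable. If of both, then it is no left descent of \<open>x w\<^sub>0\<close> and \<open>y w\<^sub>0\<close>, so that
  both projections delete it, and the projection for \<open>b\<close> is determined by that for \<open>a\<close>. If of
  neither, then \<open>p x\<close> and \<open>p y\<close> have the same projection for \<open>p # b\<close>, and they are longer than \<open>x\<close>
  and \<open>y\<close>. The converse implication is the same statement for \<open>rev a\<close>.

  What remains is to compare the recursion with sorting words, which are greedy, and to see that
  two words for the same Coxeter element differ by exchanges of commuting letters, so that \<open>rev a\<close>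
  may replace any word for \<open>inv c\<close>. The antiisomorphism sends \<open>u\<close> to the projection of \<open>u w\<^sub>0\<close>.
\<close>

locale coxeter_group =
  fixes G :: "('a, 'b) monoid_scheme" (structure)
    and S :: "'a set" and m :: "'a \<Rightarrow> 'a \<Rightarrow> enat"
  assumes coxeter_system: "coxeter_system G S m"

sublocale coxeter_group \<subseteq> group G
  using coxeter_system by (simp add: coxeter_system_def group_presentation_def)

context coxeter_group
begin

lemma finite_S: "finite S"
  using coxeter_system by (simp add: coxeter_system_def)

lemma S_carrier: "s \<in> S \<Longrightarrow> s \<in> carrier G"
  using coxeter_system by (auto simp add: coxeter_system_def group_presentation_def)

lemma m_diag: "s \<in> S \<Longrightarrow> m s s = 1"
  and m_sym: "s \<in> S \<Longrightarrow> t \<in> S \<Longrightarrow> m s t = m t s"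
  and m_ge_2: "s \<in> S \<Longrightarrow> t \<in> S \<Longrightarrow> s \<noteq> t \<Longrightarrow> 2 \<le> m s t"
  using coxeter_system by (auto simp add: coxeter_system_def coxeter_matrix_def)

lemma presentation:
  assumes "u \<in> lists (S \<times> UNIV)" "v \<in> lists (S \<times> UNIV)"
  shows "signed_word_value G u = signed_word_value G v \<longleftrightarrow>
         equivclp (presentation_step S (coxeter_relators S m)) u v"
  using coxeter_system assms by (simp add: coxeter_system_def group_presentation_def)

lemma generate_S: "generate G S = carrier G"
  using coxeter_system by (simp add: coxeter_system_def group_presentation_def)


section \<open>Words and length\<close>

abbreviation val :: "'a list \<Rightarrow> 'a" where "val \<equiv> word_value G"

abbreviation len :: "'a \<Rightarrow> nat" where "len \<equiv> cox_length G S"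

lemma val_Nil [simp]: "val [] = \<one>"
  and val_Cons [simp]: "val (s # u) = s \<otimes> val u"
  by (simp_all add: word_value_def)

lemma val_carrier [simp]: "u \<in> lists S \<Longrightarrow> val u \<in> carrier G"
  by (induction u) (auto simp: S_carrier)

lemma val_append: "u \<in> lists S \<Longrightarrow> v \<in> lists S \<Longrightarrow> val (u @ v) = val u \<otimes> val v"
  by (induction u) (auto simp: S_carrier m_assoc)

lemma signed_word_value_positive:
  "signed_word_value G (map (\<lambda>s. (s, True)) u) = val u"
  by (induction u) (auto simp: signed_word_value_def word_value_def)

lemma relator_value:
  assumes "r \<in> coxeter_relators S m"
  shows "signed_word_value G r = \<one>"
proof -
  have "concat (replicate k [(s, True), (t, True)]) \<in> lists (S \<times> UNIV)"
    if "s \<in> S" "t \<in> S" for s t :: 'a and k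
    using that by (induction k) auto
  then have "r \<in> lists (S \<times> UNIV)"
    using assms unfolding coxeter_relators_def by blast
  moreover have "presentation_step S (coxeter_relators S m) ([] @ r @ []) ([] @ [])"
    using assms by (rule presentation_step.relator)
  ultimately have "signed_word_value G r = signed_word_value G []"
    by (subst presentation) (auto intro: r_into_equivclp)
  then show ?thesis by (simp add: signed_word_value_def)
qed

lemma val_replicate: "s \<in> S \<Longrightarrow> t \<in> S \<Longrightarrow>
    val (concat (replicate k [s, t])) = (s \<otimes> t) [^] k"
proof (induction k)
  case (Suc k)
  have "val (concat (replicate (Suc k) [s, t])) = (s \<otimes> t) \<otimes> (s \<otimes> t) [^] k"
    using Suc by (simp add: S_carrier m_assoc)
  then show ?case
    using Suc.prems by (metis S_carrier m_closed nat_pow_Suc2)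
qed simp

lemma braid_relation:
  assumes "s \<in> S" "t \<in> S" "m s t = enat k"
  shows "(s \<otimes> t) [^] k = \<one>"
proof -
  have "concat (replicate k [(s, True), (t, True)]) \<in> coxeter_relators S m"
    using assms by (auto simp: coxeter_relators_def)
  then have "signed_word_value G (concat (replicate k [(s, True), (t, True)])) = \<one>"
    by (rule relator_value)
  moreover have "concat (replicate k [(s, True), (t, True)]) =
      map (\<lambda>s. (s, True)) (concat (replicate k [s, t]))"
    by (induction k) auto
  ultimately show ?thesis
    using assms by (simp add: signed_word_value_positive val_replicate)
qed

lemma S_square: "s \<in> S \<Longrightarrow> s \<otimes> s = \<one>"
  using braid_relation[of s s 1] by (simp add: m_diag one_enat_def S_carrier)

lemma S_inv: "s \<in> S \<Longrightarrow> inv s = s"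
  by (simp add: S_square S_carrier inv_equality)

lemma S_cancel_left [simp]: "s \<in> S \<Longrightarrow> w \<in> carrier G \<Longrightarrow> s \<otimes> (s \<otimes> w) = w"
  by (simp add: S_square S_carrier m_assoc[symmetric])

lemma S_cancel_right [simp]: "s \<in> S \<Longrightarrow> w \<in> carrier G \<Longrightarrow> w \<otimes> s \<otimes> s = w"
  by (simp add: S_square S_carrier m_assoc)

lemma val_rev: "u \<in> lists S \<Longrightarrow> val (rev u) = inv (val u)"
proof (induction u)
  case (Cons s u)
  then have "val (rev (s # u)) = val (rev u) \<otimes> val [s]"
    by (simp only: rev.simps, intro val_append) auto
  then show ?case
    using Cons by (auto simp: S_carrier S_inv inv_mult_group)
qed simp

lemma obtain_word:
  assumes "w \<in> carrier G"
  obtains u where "u \<in> lists S" "val u = w"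
proof -
  have "w \<in> generate G S"
    using assms generate_S by simp
  then have "\<exists>u \<in> lists S. val u = w"
  proof induction
    case one
    then show ?case by (intro bexI[of _ "[]"]) auto
  next
    case (incl h)
    then show ?case by (intro bexI[of _ "[h]"]) (auto simp: S_carrier)
  next
    case (inv h)
    then show ?case by (intro bexI[of _ "[h]"]) (auto simp: S_carrier S_inv)
  next
    case (eng h1 h2)
    then show ?case by (metis append_in_lists_conv val_append)
  qed
  then show ?thesis using that by blast
qed

lemma obtain_reduced_word:
  assumes "w \<in> carrier G"
  obtains u where "u \<in> lists S" "val u = w" "length u = len w"
proof -
  have "\<exists>k. \<exists>u\<in>lists S. val u = w \<and> length u = k"
    using obtain_word[OF assms] by metis
  then have "\<exists>u\<in>lists S. val u = w \<and> length u = len w"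
    unfolding cox_length_def by (rule LeastI_ex)
  then show ?thesis using that by blast
qed

lemma len_le: "u \<in> lists S \<Longrightarrow> len (val u) \<le> length u"
  unfolding cox_length_def by (rule Least_le) auto

lemma len_one [simp]: "len \<one> = 0"
  using len_le[of "[]"] by simp

lemma len_0_iff: "w \<in> carrier G \<Longrightarrow> len w = 0 \<longleftrightarrow> w = \<one>"
  by (metis len_one length_0_conv obtain_reduced_word val_Nil)

lemma len_mult_le:
  assumes "v \<in> carrier G" "w \<in> carrier G"
  shows "len (v \<otimes> w) \<le> len v + len w"
proof -
  obtain a where a: "a \<in> lists S" "val a = v" "length a = len v"
    using assms(1) by (rule obtain_reduced_word)
  obtain b where b: "b \<in> lists S" "val b = w" "length b = len w"
    using assms(2) by (rule obtain_reduced_word)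
  show ?thesis
    using len_le[of "a @ b"] a b by (auto simp: val_append)
qed

lemma len_inv [simp]:
  assumes "w \<in> carrier G"
  shows "len (inv w) = len w"
proof -
  have *: "len (inv w) \<le> len w" if w: "w \<in> carrier G" for w
  proof -
    obtain a where a: "a \<in> lists S" "val a = w" "length a = len w"
      using w by (rule obtain_reduced_word)
    then show ?thesis
      using len_le[of "rev a"] by (metis in_lists_conv_set length_rev set_rev val_rev)
  qed
  show ?thesis
    using *[of w] *[of "inv w"] assms by simp
qed

lemma len_S_mult_ge: "s \<in> S \<Longrightarrow> w \<in> carrier G \<Longrightarrow> len w \<le> Suc (len (s \<otimes> w))"
  using len_mult_le[of s "s \<otimes> w"] len_le[of "[s]"] by (simp add: S_carrier)

lemma len_S_mult_le: "s \<in> S \<Longrightarrow> w \<in> carrier G \<Longrightarrow> len (s \<otimes> w) \<le> Suc (len w)"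
  using len_mult_le[of s w] len_le[of "[s]"] by (simp add: S_carrier)

text \<open>The relators have even length, so the parity of a word depends only on its value.\<close>

lemma presentation_step_parity:
  "equivclp (presentation_step S (coxeter_relators S m)) u v \<Longrightarrow> even (length u) = even (length v)"
proof (induction rule: equivclp_induct)
  case (step y z)
  have *: "even (length u) = even (length v)"
    if "presentation_step S (coxeter_relators S m) u v" for u v
    using that
  proof induction
    case (relator r u v)
    have "even (length (concat (replicate k [(s, True), (t, True)])))" for k and s t :: 'a
      by (induction k) auto
    then have "even (length r)"
      using relator unfolding coxeter_relators_def by blast
    then show ?case by simp
  qed auto
  from step * show ?case by metis
qed simp

lemma val_parity:
  assumes "u \<in> lists S" "v \<in> lists S" "val u = val v"
  shows "even (length u) = even (length v)"
proof -
  have "equivclp (presentation_step S (coxeter_relators S m))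
      (map (\<lambda>s. (s, True)) u) (map (\<lambda>s. (s, True)) v)"
    using assms by (subst presentation[symmetric]) (auto simp: signed_word_value_positive)
  then show ?thesis
    using presentation_step_parity by fastforce
qed

lemma len_S_mult_neq:
  assumes "s \<in> S" "w \<in> carrier G"
  shows "len (s \<otimes> w) \<noteq> len w"
proof -
  obtain a where a: "a \<in> lists S" "val a = w" "length a = len w"
    using assms(2) by (rule obtain_reduced_word)
  obtain b where b: "b \<in> lists S" "val b = s \<otimes> w" "length b = len (s \<otimes> w)"
    using assms S_carrier by (metis m_closed obtain_reduced_word)
  have "even (length (s # a)) = even (length b)"
    using a b assms by (intro val_parity) auto
  then show ?thesis using a b by auto
qed

definition left_desc :: "'a \<Rightarrow> 'a \<Rightarrow> bool" where
  "left_desc s w \<longleftrightarrow> len (s \<otimes> w) < len w"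

lemma len_desc: "s \<in> S \<Longrightarrow> w \<in> carrier G \<Longrightarrow> left_desc s w \<Longrightarrow> len w = Suc (len (s \<otimes> w))"
  using len_S_mult_ge[of s w] by (simp add: left_desc_def)

lemma len_not_desc: "s \<in> S \<Longrightarrow> w \<in> carrier G \<Longrightarrow> \<not> left_desc s w \<Longrightarrow> len (s \<otimes> w) = Suc (len w)"
  using len_S_mult_le[of s w] len_S_mult_neq[of s w] by (simp add: left_desc_def)

lemma desc_mult: "s \<in> S \<Longrightarrow> w \<in> carrier G \<Longrightarrow> left_desc s (s \<otimes> w) \<longleftrightarrow> \<not> left_desc s w"
  using len_S_mult_neq[of s w] by (auto simp add: left_desc_def)

lemma obtain_desc:
  assumes "w \<in> carrier G" "w \<noteq> \<one>"
  obtains s where "s \<in> S" "left_desc s w"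
proof -
  obtain a where a: "a \<in> lists S" "val a = w" "length a = len w"
    using assms(1) by (rule obtain_reduced_word)
  then obtain s b where "a = s # b"
    using assms(2) by (cases a) auto
  then show ?thesis
    using a that[of s] len_le[of b] by (auto simp: left_desc_def in_lists_conv_set)
qed


section \<open>The geometric representation\<close>

text \<open>
  Vectors are functions that give the coordinates with respect to the simple roots. With the entries
  \<open>cartan s t\<close>, twice the values of the usual bilinear form, a simple reflection only changes the
  coordinate of its own simple root.
\<close>

definition cartan :: "'a \<Rightarrow> 'a \<Rightarrow> real" where
  "cartan s t = (case m s t of enat k \<Rightarrow> - 2 * cos (pi / k) | \<infinity> \<Rightarrow> - 2)"

definition pair :: "'a \<Rightarrow> ('a \<Rightarrow> real) \<Rightarrow> real" where
  "pair s v = (\<Sum>t\<in>S. cartan s t * v t)"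

definition srefl :: "'a \<Rightarrow> ('a \<Rightarrow> real) \<Rightarrow> 'a \<Rightarrow> real" where
  "srefl s v = v(s := v s - pair s v)"

definition alpha :: "'a \<Rightarrow> 'a \<Rightarrow> real" where
  "alpha s t = (if t = s then 1 else 0)"

lemma cartan_diag [simp]: "s \<in> S \<Longrightarrow> cartan s s = 2"
  by (simp add: cartan_def m_diag one_enat_def)

lemma cartan_sym: "s \<in> S \<Longrightarrow> t \<in> S \<Longrightarrow> cartan s t = cartan t s"
  by (simp add: cartan_def m_sym)

lemma cartan_nonpos:
  assumes "s \<in> S" "t \<in> S" "s \<noteq> t"
  shows "cartan s t \<le> 0"
proof (cases "m s t")
  case (enat k)
  then have "2 \<le> k"
    using m_ge_2[OF assms] by (simp add: numeral_eq_enat)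
  then have "pi / real k \<le> pi / 2" by (intro divide_left_mono) auto
  then have "0 \<le> cos (pi / k)" by (intro cos_ge_zero) (auto intro: order_trans[of _ 0])
  then show ?thesis by (simp add: cartan_def enat)
qed (simp add: cartan_def)

lemma pair_upd: "t \<in> S \<Longrightarrow> pair s (v(t := x)) = pair s v + cartan s t * (x - v t)"
  using finite_S by (simp add: pair_def sum.remove[of S t] algebra_simps)

lemma pair_alpha: "t \<in> S \<Longrightarrow> pair s (alpha t) = cartan s t"
  using finite_S by (simp add: pair_def alpha_def if_distrib cong: if_cong)

lemma pair_linear: "pair s (\<lambda>t. a * x t + b * y t) = a * pair s x + b * pair s y"
  by (simp add: pair_def sum.distrib sum_distrib_left algebra_simps)

lemma srefl_other [simp]: "t \<noteq> s \<Longrightarrow> srefl s v t = v t"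
  by (simp add: srefl_def)

lemma srefl_invol [simp]: "s \<in> S \<Longrightarrow> srefl s (srefl s v) = v"
  by (auto simp: srefl_def pair_upd)

lemma srefl_linear: "srefl s (\<lambda>t. a * x t + b * y t) = (\<lambda>t. a * srefl s x t + b * srefl s y t)"
  by (auto simp: srefl_def pair_linear algebra_simps)

lemma srefl_alpha [simp]: "s \<in> S \<Longrightarrow> srefl s (alpha s) = (\<lambda>t. - alpha s t)"
  by (auto simp: srefl_def pair_alpha) (auto simp: alpha_def)

text \<open>
  The relators act trivially. In the plane of two simple roots, the coordinates that two
  alternating reflections produce one after another form a sequence \<open>z\<close> with \<open>z (j + 1) = 2 cos \<theta> * z j - z (j - 1)\<close>,
  which has period \<open>2 * k\<close> if \<open>\<theta> = pi / k\<close>. Coordinates outside the plane only displace the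
  fixed point \<open>(fx, fy)\<close>.
\<close>

lemma srefl_braid:
  assumes st: "s \<in> S" "t \<in> S" and k: "m s t = enat k"
  shows "((srefl s \<circ> srefl t) ^^ k) v = v"
proof (cases "s = t")
  case True
  then have "k = Suc 0" using st k by (simp add: m_diag one_enat_def)
  then show ?thesis using st True by auto
next
  case False
  define \<theta> where "\<theta> = pi / k"
  have "2 \<le> k" using m_ge_2[OF st False] k by (simp add: numeral_eq_enat)
  then have \<theta>: "0 < \<theta>" "\<theta> < pi" "real k * \<theta> = pi"
    unfolding \<theta>_def by (auto simp: field_simps)
  then have sin: "0 < sin \<theta>" by (simp add: sin_gt_zero)
  define c where "c = 2 * cos \<theta>"
  have cs: "cartan s t = - c" "cartan t s = - c"
    using k m_sym[OF st] by (simp_all add: cartan_def c_def \<theta>_def)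
  define f where "f = pair s v - 2 * v s + c * v t"
  define g where "g = pair t v - 2 * v t + c * v s"
  have det: "4 - c\<^sup>2 \<noteq> 0"
  proof -
    have "4 - c\<^sup>2 = 4 * (sin \<theta>)\<^sup>2"
      unfolding c_def by (simp add: power_mult_distrib sin_squared_eq)
    then show ?thesis using sin by simp
  qed
  define fx where "fx = - (2 * f + c * g) / (4 - c\<^sup>2)"
  define fy where "fy = - (2 * g + c * f) / (4 - c\<^sup>2)"
  have fxy: "fx * (4 - c\<^sup>2) = - (2 * f + c * g)" "fy * (4 - c\<^sup>2) = - (2 * g + c * f)"
    using det by (simp_all add: fx_def fy_def)
  have expand: "(2 * x - c * y + h) * (4 - c\<^sup>2) =
      2 * (x * (4 - c\<^sup>2)) - c * (y * (4 - c\<^sup>2)) + h * (4 - c\<^sup>2)" for x y h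
    by (simp add: algebra_simps)
  have "(2 * fx - c * fy + f) * (4 - c\<^sup>2) = 0" "(2 * fy - c * fx + g) * (4 - c\<^sup>2) = 0"
    unfolding expand fxy by (simp_all add: algebra_simps power2_eq_square)
  then have fixed: "2 * fx - c * fy + f = 0" "2 * fy - c * fx + g = 0"
    using det by simp_all
  define z where "z j = ((v s - fx) * sin (j * \<theta>) - (v t - fy) * sin ((j - 1) * \<theta>)) / sin \<theta>"
    for j :: real
  have z_rec: "z (j + 2) = c * z (j + 1) - z j" for j
  proof -
    have *: "sin ((x + 2) * \<theta>) = c * sin ((x + 1) * \<theta>) - sin (x * \<theta>)" for x
    proof -
      have "sin ((x + 2) * \<theta>) + sin (x * \<theta>) = sin ((x + 1) * \<theta> + \<theta>) + sin ((x + 1) * \<theta> - \<theta>)"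
        by (simp add: algebra_simps)
      also have "\<dots> = c * sin ((x + 1) * \<theta>)"
        unfolding c_def by (simp only: sin_add sin_diff) (simp add: algebra_simps)
      finally show ?thesis by simp
    qed
    have prev: "sin ((j + 1) * \<theta>) = c * sin (j * \<theta>) - sin ((j - 1) * \<theta>)"
      using *[of "j - 1"] by (simp add: add.commute)
    have lin: "(p * (c * x - y) - q * x) / w = c * ((p * x - q * y) / w) - (p * y - q * d) / w"
      if "x = c * y - d" for p q x y d w :: real
      unfolding that by (simp add: diff_divide_distrib add_divide_distrib algebra_simps)
    have idx: "j + 2 - 1 = j + 1" "j + 1 - 1 = j" by simp_all
    show ?thesis
      unfolding z_def idx *[of j] by (rule lin[OF prev])
  qed
  have step: "(srefl s \<circ> srefl t) (v(s := fx + z (j + 1), t := fy + z j)) =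
      v(s := fx + z (j + 1 + 2), t := fy + z (j + 2))" for j
  proof -
    have 1: "pair t (v(s := fx + z (j + 1), t := fy + z j)) = 2 * z j - c * z (j + 1)"
      using st fixed(2) False cs by (simp add: pair_upd g_def algebra_simps)
    have 2: "pair s (v(s := fx + z (j + 1), t := fy + z (j + 2))) = 2 * z (j + 1) - c * z (j + 2)"
      using st fixed(1) False cs by (simp add: pair_upd f_def algebra_simps)
    have "srefl t (v(s := fx + z (j + 1), t := fy + z j)) = v(s := fx + z (j + 1), t := fy + z (j + 2))"
      using False z_rec[of j] unfolding srefl_def 1 by auto
    moreover have "srefl s (v(s := fx + z (j + 1), t := fy + z (j + 2))) =
        v(s := fx + z (j + 1 + 2), t := fy + z (j + 2))"
      using False z_rec[of "j + 1"] unfolding srefl_def 2 by (auto simp: add.commute add.left_commute)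
    ultimately show ?thesis by simp
  qed
  have iter: "((srefl s \<circ> srefl t) ^^ i) v = 
      v(s := fx + z (2 * real i + 1), t := fy + z (2 * real i))" for i
  proof (induction i)
    case 0
    have "z 1 = v s - fx" "z 0 = v t - fy"
      using sin by (simp_all add: z_def)
    then show ?case by simp
  next
    case (Suc i)
    have "((srefl s \<circ> srefl t) ^^ Suc i) v = (srefl s \<circ> srefl t) (((srefl s \<circ> srefl t) ^^ i) v)"
      by simp
    also have "\<dots> = v(s := fx + z (2 * real i + 1 + 2), t := fy + z (2 * real i + 2))"
      unfolding Suc.IH by (rule step)
    also have "2 * real i + 1 + 2 = 2 * real (Suc i) + 1" by simp
    also have "2 * real i + 2 = 2 * real (Suc i)" by simp
    finally show ?case .
  qed
  have period: "z (x + 2 * real k) = z x" for x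
  proof -
    have *: "sin ((y + 2 * real k) * \<theta>) = sin (y * \<theta>)" for y
    proof -
      have "(y + 2 * real k) * \<theta> = y * \<theta> + 2 * pi" using \<theta>(3) by (simp add: algebra_simps)
      then show ?thesis by (simp only: sin_periodic)
    qed
    have "x + 2 * real k - 1 = (x - 1) + 2 * real k" by simp
    then show ?thesis by (simp only: z_def *)
  qed
  have "z (2 * real k) = z 0" "z (2 * real k + 1) = z 1"
    using period[of 0] period[of 1] by (simp_all add: add.commute)
  then show ?thesis
    using iter[of k] iter[of 0] by simp
qed

abbreviation word_act :: "'a list \<Rightarrow> ('a \<Rightarrow> real) \<Rightarrow> 'a \<Rightarrow> real" where
  "word_act u v \<equiv> foldr srefl u v"

lemma word_act_cong:
  assumes "u \<in> lists S" "v \<in> lists S" "val u = val v"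
  shows "word_act u x = word_act v x"
proof -
  let ?act = "foldr (\<lambda>p. srefl (fst p))"
  have step: "?act u x = ?act v x" if "presentation_step S (coxeter_relators S m) u v" for u v x
    using that
  proof induction
    case (relator r u v)
    then obtain s t k where r: "r = concat (replicate k [(s, True), (t, True)])"
      and st: "s \<in> S" "t \<in> S" "m s t = enat k" by (auto simp: coxeter_relators_def)
    have "?act (concat (replicate k [(s, True), (t, True)])) y = ((srefl s \<circ> srefl t) ^^ k) y" for k y
      by (induction k) auto
    then show ?case using srefl_braid[OF st] r by simp
  qed auto
  have "?act u x = ?act v x"
    if "equivclp (presentation_step S (coxeter_relators S m)) u v" for u v x
    using that by (induction rule: equivclp_induct) (metis step)+
  moreover have "equivclp (presentation_step S (coxeter_relators S m))
      (map (\<lambda>s. (s, True)) u) (map (\<lambda>s. (s, True)) v)"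
    using assms by (subst presentation[symmetric]) (auto simp: signed_word_value_positive)
  moreover have "?act (map (\<lambda>s. (s, True)) u) x = word_act u x" for u
    by (induction u) auto
  ultimately show ?thesis by metis
qed

definition act :: "'a \<Rightarrow> ('a \<Rightarrow> real) \<Rightarrow> 'a \<Rightarrow> real" where
  "act w = word_act (SOME u. u \<in> lists S \<and> val u = w)"

lemma act_val:
  assumes "u \<in> lists S"
  shows "act (val u) x = word_act u x"
proof -
  have "(SOME v. v \<in> lists S \<and> val v = val u) \<in> lists S \<and>
      val (SOME v. v \<in> lists S \<and> val v = val u) = val u"
    by (rule someI[of "\<lambda>v. v \<in> lists S \<and> val v = val u" u]) (simp add: assms)
  then show ?thesis
    unfolding act_def using assms by (intro word_act_cong) auto
qed

lemma act_one [simp]: "act \<one> x = x"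
  using act_val[of "[]"] by simp

lemma act_S: "s \<in> S \<Longrightarrow> act s x = srefl s x"
  using act_val[of "[s]"] by (simp add: S_carrier)

lemma act_mult:
  assumes "v \<in> carrier G" "w \<in> carrier G"
  shows "act (v \<otimes> w) x = act v (act w x)"
proof -
  obtain a where a: "a \<in> lists S" "val a = v"
    using assms(1) by (rule obtain_word)
  obtain b where b: "b \<in> lists S" "val b = w"
    using assms(2) by (rule obtain_word)
  show ?thesis
    using act_val[of "a @ b"] act_val[of a] act_val[of b] a b by (auto simp: val_append)
qed

lemma act_inv_act [simp]: "w \<in> carrier G \<Longrightarrow> act (inv w) (act w x) = x"
  by (simp add: act_mult[symmetric])

lemma act_act_inv [simp]: "w \<in> carrier G \<Longrightarrow> act w (act (inv w) x) = x"
  by (simp add: act_mult[symmetric])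

lemma act_linear: "w \<in> carrier G \<Longrightarrow>
    act w (\<lambda>t. a * x t + b * y t) = (\<lambda>t. a * act w x t + b * act w y t)"
proof -
  assume w: "w \<in> carrier G"
  then obtain u where u: "u \<in> lists S" "val u = w" by (rule obtain_word)
  have "word_act u (\<lambda>t. a * x t + b * y t) = (\<lambda>t. a * word_act u x t + b * word_act u y t)"
    by (induction u) (auto simp: srefl_linear)
  then show ?thesis using act_val[of u] u by simp
qed

lemma act_uminus: "w \<in> carrier G \<Longrightarrow> act w (\<lambda>t. - x t) = (\<lambda>t. - act w x t)"
  using act_linear[of w "-1" x 0 x] by simp

lemma act_zero: "w \<in> carrier G \<Longrightarrow> act w (\<lambda>t. 0) = (\<lambda>t. 0)"
  using act_linear[of w 0 "\<lambda>t. 0" 0 "\<lambda>t. 0"] by simp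

lemma act_sum:
  assumes "w \<in> carrier G"
  shows "act w (\<lambda>t. \<Sum>i\<in>I. c i * x i t) = (\<lambda>t. \<Sum>i\<in>I. c i * act w (x i) t)"
proof (induction I rule: infinite_finite_induct)
  case (insert i I)
  then show ?case
    using act_linear[OF assms, of "c i" "x i" 1 "\<lambda>t. \<Sum>i\<in>I. c i * x i t"] by simp
qed (simp_all add: act_zero[OF assms])

section \<open>Roots are positive or negative\<close>

fun alternating :: "'a \<Rightarrow> 'a \<Rightarrow> nat \<Rightarrow> 'a list" where
  "alternating s t 0 = []"
| "alternating s t (Suc j) = alternating t s j @ [t]"

lemma alternating_lists: "s \<in> S \<Longrightarrow> t \<in> S \<Longrightarrow> alternating s t j \<in> lists S"
  by (induction j arbitrary: s t) auto

lemma length_altw: "length (alternating s t j) = j"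
  by (induction j arbitrary: s t) auto

lemma alternating_front: "alternating s t (Suc j) = (if even j then t else s) # alternating s t j"
proof (induction j arbitrary: s t)
  case (Suc j)
  have "alternating s t (Suc (Suc j)) = alternating t s (Suc j) @ [t]" by (simp only: alternating.simps)
  also have "\<dots> = (if even j then s else t) # alternating t s j @ [t]"
    by (simp only: Suc.IH append_Cons)
  finally show ?case by auto
qed auto

lemma val_altw_Suc: "s \<in> S \<Longrightarrow> t \<in> S \<Longrightarrow> val (alternating s t (Suc j)) = val (alternating t s j) \<otimes> t"
  using val_append[of "alternating t s j" "[t]"] by (simp add: alternating_lists S_carrier)

lemma pow_swap: "s \<in> S \<Longrightarrow> t \<in> S \<Longrightarrow> s \<otimes> (t \<otimes> s) [^] (j::nat) \<otimes> t = (s \<otimes> t) [^] Suc j"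
proof (induction j)
  case (Suc j)
  have c: "(t \<otimes> s) [^] j \<in> carrier G" using Suc.prems by (simp add: S_carrier)
  have "s \<otimes> (t \<otimes> s) [^] Suc j \<otimes> t = (s \<otimes> (t \<otimes> s) [^] j \<otimes> t) \<otimes> (s \<otimes> t)"
    using Suc.prems c by (simp add: S_carrier m_assoc)
  also have "\<dots> = (s \<otimes> t) [^] Suc (Suc j)"
    by (simp only: Suc.IH[OF Suc.prems] nat_pow_Suc)
  finally show ?case .
qed (simp add: S_carrier)

lemma alternating_quotient:
  "s \<in> S \<Longrightarrow> t \<in> S \<Longrightarrow> inv (val (alternating t s j)) \<otimes> val (alternating s t j) = (s \<otimes> t) [^] j"
proof (induction j arbitrary: s t)
  case (Suc j)
  have c: "val (alternating s t j) \<in> carrier G" "val (alternating t s j) \<in> carrier G"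
    using Suc.prems by (simp_all add: alternating_lists)
  have "inv (val (alternating t s (Suc j))) \<otimes> val (alternating s t (Suc j)) =
      s \<otimes> (inv (val (alternating s t j)) \<otimes> val (alternating t s j)) \<otimes> t"
    using Suc.prems c
    by (simp del: alternating.simps add: val_altw_Suc inv_mult_group S_inv S_carrier m_assoc)
  also have "\<dots> = (s \<otimes> t) [^] Suc j"
    using Suc by (simp only: pow_swap)
  finally show ?case .
qed simp

lemma alternating_braid:
  assumes "s \<in> S" "t \<in> S" "m s t = enat k"
  shows "val (alternating s t k) = val (alternating t s k)"
proof -
  have "inv (val (alternating t s k)) \<otimes> val (alternating s t k) = \<one>"
    using alternating_quotient[of s t k] braid_relation[OF assms] assms by simp
  then show ?thesis
    using assms by (metis alternating_lists inv_closed inv_equality inv_inv val_carrier)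
qed

text \<open>
  These are the values \<open>sin (j * \<theta>) / sin \<theta>\<close> with \<open>\<theta> = pi / m s t\<close>, and their limits as
  \<open>\<theta>\<close> tends to \<open>0\<close> if \<open>m s t\<close> is infinite.
\<close>

lemma obtain_dihedral_coordinates:
  assumes "s \<in> S" "t \<in> S" "s \<noteq> t"
  obtains U :: "nat \<Rightarrow> real" where "U 0 = 0" "U 1 = 1"
    "\<forall>j. U (Suc (Suc j)) = - cartan s t * U (Suc j) - U j"
    "\<forall>j. enat j \<le> m s t \<longrightarrow> 0 \<le> U j"
proof (cases "m s t")
  case (enat k)
  define \<theta> where "\<theta> = pi / k"
  have "2 \<le> k" using m_ge_2[OF assms] enat by (simp add: numeral_eq_enat)
  then have \<theta>: "0 < \<theta>" "\<theta> < pi" "real k * \<theta> = pi"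
    unfolding \<theta>_def by (auto simp: field_simps)
  then have sin: "0 < sin \<theta>" by (simp add: sin_gt_zero)
  show ?thesis
  proof (rule that[of "\<lambda>j. sin (j * \<theta>) / sin \<theta>"]; (intro allI impI)?)
    fix j :: nat
    have "sin ((j + 2) * \<theta>) + sin (j * \<theta>) = sin ((j + 1) * \<theta> + \<theta>) + sin ((j + 1) * \<theta> - \<theta>)"
      by (simp add: algebra_simps)
    also have "\<dots> = 2 * cos \<theta> * sin ((j + 1) * \<theta>)"
      by (simp only: sin_add sin_diff) (simp add: algebra_simps)
    finally have "sin (Suc (Suc j) * \<theta>) = 2 * cos \<theta> * sin (Suc j * \<theta>) - sin (j * \<theta>)"
      by (simp add: algebra_simps)
    then show "sin (Suc (Suc j) * \<theta>) / sin \<theta> =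
        - cartan s t * (sin (Suc j * \<theta>) / sin \<theta>) - sin (j * \<theta>) / sin \<theta>"
      by (simp add: cartan_def enat \<theta>_def diff_divide_distrib)
  next
    fix j :: nat
    assume "enat j \<le> m s t"
    then have "j * \<theta> \<le> k * \<theta>"
      using \<theta>(1) by (intro mult_right_mono) (simp_all add: enat)
    then have "j * \<theta> \<le> pi" using \<theta>(3) by simp
    then show "0 \<le> sin (j * \<theta>) / sin \<theta>"
      using \<theta> sin by (simp add: sin_ge_zero)
  qed (use sin in auto)
next
  case infinity
  show ?thesis
    by (rule that[of real]) (simp_all add: cartan_def infinity)
qed

text \<open>
  Which of the two coordinates belongs to \<open>s\<close> depends on the parity of \<open>j\<close>; only their signs matter,
  so the set of the two is enough.
\<close>

lemma word_act_alternating: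
  assumes U: "\<And>j. U (Suc (Suc j)) = - cartan s t * U (Suc j) - U j"
    and st: "s \<in> S" "t \<in> S" "s \<noteq> t"
  shows "\<exists>a b. {a, b} = {U (i + j), U (Suc (i + j))} \<and>
    word_act (alternating s t j) (\<lambda>x. U (Suc i) * alpha s x + U i * alpha t x) =
      (\<lambda>x. a * alpha s x + b * alpha t x)"
  using U st
proof (induction j arbitrary: s t i)
  case 0
  show ?case by (intro exI[of _ "U (Suc i)"] exI[of _ "U i"]) auto
next
  case (Suc j)
  have sym: "cartan t s = cartan s t"
    using Suc.prems by (simp add: cartan_sym)
  have "srefl t (\<lambda>x. U (Suc i) * alpha s x + U i * alpha t x) =
      (\<lambda>x. U (Suc (Suc i)) * alpha t x + U (Suc i) * alpha s x)"
  proof -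
    have "pair t (\<lambda>x. U (Suc i) * alpha s x + U i * alpha t x) = U (Suc i) * cartan s t + 2 * U i"
      using Suc.prems sym by (simp add: pair_linear pair_alpha)
    then show ?thesis
      unfolding srefl_def using Suc.prems by (auto simp: alpha_def)
  qed
  moreover have "\<exists>a b. {a, b} = {U (Suc i + j), U (Suc (Suc i + j))} \<and>
    word_act (alternating t s j) (\<lambda>x. U (Suc (Suc i)) * alpha t x + U (Suc i) * alpha s x) =
      (\<lambda>x. a * alpha t x + b * alpha s x)"
    using Suc.prems sym by (intro Suc.IH) auto
  then obtain a b where "{a, b} = {U (Suc i + j), U (Suc (Suc i + j))}"
    "word_act (alternating t s j) (\<lambda>x. U (Suc (Suc i)) * alpha t x + U (Suc i) * alpha s x) =
      (\<lambda>x. a * alpha t x + b * alpha s x)" by blast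
  ultimately show ?case
    by (intro exI[of _ b] exI[of _ a]) (auto simp: add.commute)
qed

definition posv :: "('a \<Rightarrow> real) \<Rightarrow> bool" where "posv v \<longleftrightarrow> (\<forall>t. 0 \<le> v t)"
definition negv :: "('a \<Rightarrow> real) \<Rightarrow> bool" where "negv v \<longleftrightarrow> (\<forall>t. v t \<le> 0)"

lemma posv_alpha [simp]: "posv (alpha s)"
  by (simp add: posv_def alpha_def)

lemma not_negv_alpha [simp]: "\<not> negv (alpha s)"
  by (auto simp: negv_def alpha_def intro!: exI[of _ s])

lemma len_mult_S:
  assumes "s \<in> S" "w \<in> carrier G"
  shows "len (w \<otimes> s) = len (s \<otimes> inv w)"
  using len_inv[of "w \<otimes> s"] assms by (simp add: S_carrier S_inv inv_mult_group)

lemma len_mult_S_cases: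
  assumes "s \<in> S" "w \<in> carrier G"
  shows "len (w \<otimes> s) = Suc (len w) \<or> len w = Suc (len (w \<otimes> s))"
  using len_desc[of s "inv w"] len_not_desc[of s "inv w"] assms len_mult_S[OF assms] by auto

lemma obtain_right_desc:
  assumes "w \<in> carrier G" "w \<noteq> \<one>"
  obtains s where "s \<in> S" "len w = Suc (len (w \<otimes> s))"
proof -
  have "inv w \<noteq> \<one>" using assms by (metis inv_inv inv_one)
  then obtain s where "s \<in> S" "left_desc s (inv w)"
    using obtain_desc assms by (metis inv_closed)
  then show ?thesis
    using that[of s] len_mult_S[of s w] len_desc[of s "inv w"] assms by auto
qed

text \<open>
  Let \<open>t\<close> be a last letter of a reduced word for \<open>w\<close>, and split off from the end of \<open>w\<close> an
  alternating word in \<open>s\<close> and \<open>t\<close>, as long as possible, leaving \<open>v\<close>. By induction \<open>v\<close> keeps both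
  \<open>alpha s\<close> and \<open>alpha t\<close> positive, and the alternating word, being shorter than \<open>m s t\<close>, sends
  \<open>alpha s\<close> to a nonnegative combination of the two.
\<close>

theorem act_alpha_pos:
  assumes "w \<in> carrier G" "s \<in> S" "len w < len (w \<otimes> s)"
  shows "posv (act w (alpha s))"
  using assms
proof (induction "len w" arbitrary: w s rule: less_induct)
  case less
  show ?case
  proof (cases "w = \<one>")
    case False
    then obtain t where t: "t \<in> S" "len w = Suc (len (w \<otimes> t))"
      using obtain_right_desc less.prems by metis
    then have st: "s \<in> S" "t \<in> S" "s \<noteq> t"
      using less.prems by auto
    define P where "P j \<longleftrightarrow> (\<exists>v. v \<in> carrier G \<and> w = v \<otimes> val (alternating s t j) \<and> len w = len v + j)" for j
    have "P 1"
      unfolding P_def using t less.prems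
      by (intro exI[of _ "w \<otimes> t"]) (simp_all add: S_carrier)
    moreover have bound: "\<And>j. P j \<Longrightarrow> j \<le> len w" by (auto simp: P_def)
    ultimately obtain j where j: "P j" and max: "\<And>i. P i \<Longrightarrow> i \<le> j"
      by (metis GreatestI_nat Greatest_le_nat)
    then have j1: "1 \<le> j" using \<open>P 1\<close> by blast
    then obtain i where i: "j = Suc i" by (cases j) auto
    obtain v where v: "v \<in> carrier G" "w = v \<otimes> val (alternating s t j)" "len w = len v + j"
      using j by (auto simp: P_def)
    define p where "p = (if even i then t else s)"
    define q where "q = (if even i then s else t)"
    have pq: "p \<in> S" "q \<in> S" using st by (auto simp: p_def q_def)
    have alt: "alternating s t j \<in> lists S" "alternating s t i \<in> lists S" using st by (simp_all add: alternating_lists)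
    have jp: "alternating s t j = p # alternating s t i" and jq: "alternating s t (Suc j) = q # alternating s t j"
      using alternating_front[of s t i] alternating_front[of s t j] i by (auto simp: p_def q_def)
    have "len (v \<otimes> q) = Suc (len v)"
    proof (rule ccontr)
      assume "\<not> ?thesis"
      then have "len v = Suc (len (v \<otimes> q))"
        using len_mult_S_cases v pq by blast
      moreover have "w = (v \<otimes> q) \<otimes> val (alternating s t (Suc j))"
        unfolding jq using v pq alt by (simp add: m_assoc S_carrier)
      ultimately have "P (Suc j)"
        unfolding P_def using v pq by (intro exI[of _ "v \<otimes> q"]) (simp add: S_carrier)
      then show False using max by fastforce
    qed
    moreover have "len (v \<otimes> p) = Suc (len v)"
    proof (rule ccontr)
      assume "\<not> ?thesis"
      then have "len v = Suc (len (v \<otimes> p))"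
        using len_mult_S_cases v pq by blast
      moreover have "w = (v \<otimes> p) \<otimes> val (alternating s t i)"
        using v(2) unfolding jp using v(1) pq alt by (simp add: m_assoc S_carrier)
      ultimately show False
        using len_mult_le[of "v \<otimes> p" "val (alternating s t i)"] len_le[of "alternating s t i"] v pq alt i
        by (simp add: length_altw S_carrier)
    qed
    moreover have "{s, t} = {p, q}" by (auto simp: p_def q_def)
    ultimately have vst: "len v < len (v \<otimes> s)" "len v < len (v \<otimes> t)"
      by (auto simp: doubleton_eq_iff)
    have "len v < len w" using v j1 by simp
    then have pos: "posv (act v (alpha s))" "posv (act v (alpha t))"
      using less.hyps v st vst by blast+
    \<comment> \<open>Otherwise the braid relation turns a suffix of the alternating word into one that ends in \<open>s\<close>,
      and then \<open>w \<otimes> s\<close> is shorter than \<open>w\<close>.\<close>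
    have "enat (Suc j) \<le> m s t"
    proof (rule ccontr)
      assume "\<not> ?thesis"
      then obtain k where k: "m s t = enat k" "k \<le> j"
        by (cases "m s t") auto
      have "0 < k" using m_ge_2[OF st] k by (auto simp: numeral_eq_enat)
      have split: "alternating s t (k + l) = (if even k then alternating s t l else alternating t s l) @ alternating s t k" for l k s t
        by (induction k arbitrary: s t) auto
      define d where "d = (if even k then alternating s t (j - k) else alternating t s (j - k))"
      have d: "d \<in> lists S" "length d = j - k" using st by (auto simp: d_def alternating_lists length_altw)
      have "alternating s t j = d @ alternating s t k"
        using split[of s t k "j - k"] k by (simp add: d_def)
      then have "val (alternating s t j) = val d \<otimes> val (alternating s t k)"
        using d st by (simp add: val_append alternating_lists)
      also have "\<dots> = val d \<otimes> val (alternating t s k)"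
        using alternating_braid[OF st(1,2) k(1)] by simp
      also have "\<dots> = val d \<otimes> (val (alternating s t (k - 1)) \<otimes> s)"
        using val_altw_Suc[OF st(2,1), of "k - 1"] \<open>0 < k\<close> by simp
      finally have "w \<otimes> s = v \<otimes> val (d @ alternating s t (k - 1))"
        using v d st by (simp add: m_assoc val_append alternating_lists S_carrier S_square)
      then have "len (w \<otimes> s) \<le> len v + length (d @ alternating s t (k - 1))"
        using len_mult_le[of v "val (d @ alternating s t (k - 1))"] len_le[of "d @ alternating s t (k - 1)"] v d st
        by (simp add: alternating_lists)
      then show False
        using v d k \<open>0 < k\<close> less.prems by (simp add: length_altw)
    qed
    moreover obtain U :: "nat \<Rightarrow> real" where U: "U 0 = 0" "U 1 = 1"
      "\<forall>j. U (Suc (Suc j)) = - cartan s t * U (Suc j) - U j"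
      "\<forall>j. enat j \<le> m s t \<longrightarrow> 0 \<le> U j"
      using obtain_dihedral_coordinates[OF st] by blast
    moreover have "enat j \<le> enat (Suc j)" by simp
    ultimately have "0 \<le> U j" "0 \<le> U (Suc j)" using order_trans by blast+
    moreover obtain a b where ab: "{a, b} = {U j, U (Suc j)}"
      "word_act (alternating s t j) (alpha s) = (\<lambda>x. a * alpha s x + b * alpha t x)"
      using word_act_alternating[of U s t 0 j] U(1-3) st by auto
    ultimately have "0 \<le> a" "0 \<le> b" by (auto simp: doubleton_eq_iff)
    moreover have "act w (alpha s) = (\<lambda>x. a * act v (alpha s) x + b * act v (alpha t) x)"
      using v alt ab(2) by (simp add: act_mult act_val act_linear)
    ultimately show ?thesis using pos by (simp add: posv_def)
  qed simp
qed

definition is_root :: "('a \<Rightarrow> real) \<Rightarrow> bool" where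
  "is_root v \<longleftrightarrow> (\<exists>w\<in>carrier G. \<exists>s\<in>S. v = act w (alpha s))"

lemma root_alpha [simp]: "s \<in> S \<Longrightarrow> is_root (alpha s)"
  unfolding is_root_def by (intro bexI[of _ "\<one>"] bexI[of _ s]) auto

lemma root_act: "is_root v \<Longrightarrow> w \<in> carrier G \<Longrightarrow> is_root (act w v)"
  unfolding is_root_def by (metis act_mult m_closed)

lemma root_refl: "is_root v \<Longrightarrow> s \<in> S \<Longrightarrow> is_root (srefl s v)"
  using root_act[of v s] by (simp add: act_S S_carrier)

lemma root_uminus: "is_root v \<Longrightarrow> is_root (\<lambda>t. - v t)"
proof -
  assume "is_root v"
  then obtain w s where w: "w \<in> carrier G" "s \<in> S" "v = act w (alpha s)"
    by (auto simp: is_root_def)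
  then have "act (w \<otimes> s) (alpha s) = (\<lambda>t. - v t)"
    by (simp add: act_mult S_carrier act_S act_uminus)
  then show ?thesis
    unfolding is_root_def using w by (metis S_carrier m_closed)
qed

lemma root_pos_or_neg:
  assumes "is_root v"
  shows "posv v \<or> negv v"
proof -
  obtain w s where w: "w \<in> carrier G" "s \<in> S" "v = act w (alpha s)"
    using assms by (auto simp: is_root_def)
  show ?thesis
  proof (cases "len w < len (w \<otimes> s)")
    case True
    then show ?thesis using act_alpha_pos w by blast
  next
    case False
    then have "len (w \<otimes> s) < len (w \<otimes> s \<otimes> s)"
      using len_mult_S_cases[of s w] w by auto
    then have "posv (act (w \<otimes> s) (alpha s))"
      using act_alpha_pos w by (simp add: S_carrier)
    then show ?thesis
      using w by (simp add: act_mult S_carrier act_S act_uminus posv_def negv_def)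
  qed
qed

lemma root_nonzero:
  assumes "is_root v"
  shows "v \<noteq> (\<lambda>t. 0)"
proof
  assume "v = (\<lambda>t. 0)"
  moreover obtain w s where w: "w \<in> carrier G" "s \<in> S" "v = act w (alpha s)"
    using assms by (auto simp: is_root_def)
  ultimately have "alpha s = (\<lambda>t. 0)"
    by (metis act_inv_act act_zero inv_closed)
  then show False by (auto simp: alpha_def fun_eq_iff split: if_splits)
qed

lemma posv_negv_zero: "posv v \<Longrightarrow> negv v \<Longrightarrow> v = (\<lambda>t. 0)"
  by (auto simp: posv_def negv_def intro!: ext antisym)

lemma root_neg_iff: "is_root v \<Longrightarrow> negv v \<longleftrightarrow> \<not> posv v"
  using root_pos_or_neg root_nonzero posv_negv_zero by blast

lemma root_pos_coordinate: "is_root v \<Longrightarrow> 0 < v t \<Longrightarrow> posv v"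
  using root_pos_or_neg by (auto simp: negv_def not_less[symmetric])

lemma root_neg_coordinate: "is_root v \<Longrightarrow> v t < 0 \<Longrightarrow> negv v"
  using root_pos_or_neg by (auto simp: posv_def not_less[symmetric])

lemma act_outside:
  assumes "w \<in> carrier G" "t \<notin> S"
  shows "act w v t = v t"
proof -
  obtain u where u: "u \<in> lists S" "val u = w"
    using assms(1) by (rule obtain_word)
  have "word_act u v t = v t"
    using u(1) assms(2) by (induction u) (auto simp: srefl_def)
  then show ?thesis using act_val[of u v] u by simp
qed

lemma root_outside: "is_root v \<Longrightarrow> t \<notin> S \<Longrightarrow> v t = 0"
  by (auto simp: is_root_def act_outside alpha_def)


section \<open>The invariant form\<close>

definition form :: "('a \<Rightarrow> real) \<Rightarrow> ('a \<Rightarrow> real) \<Rightarrow> real" where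
  "form x y = (\<Sum>s\<in>S. x s * pair s y)"

lemma form_sym: "form x y = form y x"
proof -
  have "form x y = (\<Sum>s\<in>S. \<Sum>t\<in>S. x s * cartan s t * y t)"
    by (simp add: form_def pair_def sum_distrib_left mult.assoc)
  also have "\<dots> = (\<Sum>t\<in>S. \<Sum>s\<in>S. x s * cartan s t * y t)" by (rule sum.swap)
  also have "\<dots> = form y x"
    by (auto simp: form_def pair_def sum_distrib_left cartan_sym mult_ac intro!: sum.cong)
  finally show ?thesis .
qed

lemma form_alpha: "s \<in> S \<Longrightarrow> form (alpha s) y = pair s y"
  using finite_S by (simp add: form_def alpha_def if_distrib if_distribR cong: if_cong)

lemma form_upd: "s \<in> S \<Longrightarrow> form (x(s := c)) y = form x y + (c - x s) * pair s y"
  using finite_S by (simp add: form_def sum.remove[of S s] algebra_simps)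

lemma form_refl:
  assumes s: "s \<in> S"
  shows "form (srefl s x) (srefl s y) = form x y"
proof -
  have "pair s (srefl s y) = - pair s y"
    using s by (simp add: srefl_def pair_upd)
  then have "form (srefl s x) (srefl s y) = form x (srefl s y) + pair s x * pair s y"
    using s by (simp add: srefl_def[of s x] form_upd)
  also have "form x (srefl s y) = form y x - pair s y * pair s x"
    using s by (subst form_sym) (simp add: srefl_def form_upd)
  finally show ?thesis by (simp add: form_sym)
qed

lemma form_act:
  assumes "w \<in> carrier G"
  shows "form (act w x) (act w y) = form x y"
proof -
  obtain u where u: "u \<in> lists S" "val u = w"
    using assms(1) by (rule obtain_word)
  have "form (word_act u x) (word_act u y) = form x y"
    using u(1) by (induction u) (auto simp: form_refl)
  then show ?thesis using act_val[of u] u by simp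
qed

lemma form_root: "is_root v \<Longrightarrow> form v v = 2"
  by (auto simp: is_root_def form_act form_alpha pair_alpha)

lemma act_reflection:
  assumes "g \<in> carrier G" "s \<in> S" and \<beta>: "\<beta> = act g (alpha s)"
  shows "act (g \<otimes> s \<otimes> inv g) v = (\<lambda>t. v t - form \<beta> v * \<beta> t)"
proof -
  let ?x = "act (inv g) v"
  have "srefl s ?x = (\<lambda>t. 1 * ?x t + (- pair s ?x) * alpha s t)"
    by (auto simp: srefl_def alpha_def)
  then have "act g (srefl s ?x) = (\<lambda>t. v t - pair s ?x * \<beta> t)"
    using assms act_linear[of g 1 ?x "- pair s ?x" "alpha s"] by simp
  moreover have "pair s ?x = form \<beta> v"
    using assms form_act[of "inv g" \<beta> v] by (simp add: form_alpha)
  ultimately show ?thesis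
    using assms by (simp add: act_mult act_S S_carrier)
qed

lemma negv_uminus: "negv (\<lambda>t. - v t) \<longleftrightarrow> posv v" and posv_uminus: "posv (\<lambda>t. - v t) \<longleftrightarrow> negv v"
  by (simp_all add: posv_def negv_def)

lemma faithful:
  assumes "w \<in> carrier G" "\<And>s. s \<in> S \<Longrightarrow> act w (alpha s) = alpha s"
  shows "w = \<one>"
proof (rule ccontr)
  assume "w \<noteq> \<one>"
  then obtain s where s: "s \<in> S" "len w = Suc (len (w \<otimes> s))"
    using obtain_right_desc assms by metis
  then have "posv (act (w \<otimes> s) (alpha s))"
    using act_alpha_pos[of "w \<otimes> s" s] assms by (simp add: S_carrier)
  then have "posv (\<lambda>t. - alpha s t)"
    using s assms by (simp add: act_mult S_carrier act_S act_uminus)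
  then show False by (simp add: posv_uminus)
qed

lemma act_eqI:
  assumes "v \<in> carrier G" "w \<in> carrier G" "\<And>s. s \<in> S \<Longrightarrow> act v (alpha s) = act w (alpha s)"
  shows "v = w"
proof -
  have "inv w \<otimes> v = \<one>"
    using assms by (intro faithful) (simp_all add: act_mult)
  then show ?thesis
    using assms by (metis inv_closed inv_equality inv_inv)
qed

text \<open>
  The reflection in a root does not depend on how the root is written, because the representation is
  faithful.
\<close>

lemma reflection_eqI:
  assumes "g \<in> carrier G" "s \<in> S" "h \<in> carrier G" "t \<in> S" "act g (alpha s) = act h (alpha t)"
  shows "g \<otimes> s \<otimes> inv g = h \<otimes> t \<otimes> inv h"
  using assms by (intro act_eqI) (simp_all add: S_carrier act_reflection[OF _ _ refl])

text \<open>
  A multiple of a simple root that is a root must be that simple root, as all roots have norm \<open>2\<close>.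
\<close>

lemma root_single_coordinate:
  assumes v: "is_root v" "posv v" "\<And>t. t \<noteq> s \<Longrightarrow> v t = 0" and s: "s \<in> S"
  shows "v = alpha s"
proof -
  have eq: "v = (\<lambda>t. v s * alpha s t)" using v(3) by (auto simp: alpha_def)
  have pair: "pair t v = v s * pair t (alpha s)" for t
    by (subst eq) (simp add: pair_def sum_distrib_left algebra_simps)
  then have "form v v = v s * form v (alpha s)"
    by (simp add: form_def sum_distrib_left algebra_simps)
  also have "form v (alpha s) = v s * 2"
    using s pair by (subst form_sym) (simp add: form_alpha pair_alpha)
  finally have "(v s)\<^sup>2 = 1" using form_root[OF v(1)] by (simp add: power2_eq_square)
  moreover have "0 \<le> v s" using v(2) by (simp add: posv_def)
  ultimately have "v s = 1" by (auto simp: power2_eq_1_iff)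
  then show ?thesis using eq by simp
qed

lemma srefl_pos:
  assumes v: "is_root v" "posv v" "v \<noteq> alpha s" and s: "s \<in> S"
  shows "posv (srefl s v)"
proof -
  obtain t where "t \<noteq> s" "v t \<noteq> 0" using root_single_coordinate v s by blast
  then have "0 < v t" using v(2) by (simp add: posv_def less_le)
  then show ?thesis
    using root_pos_coordinate[OF root_refl[OF v(1) s], of t] \<open>t \<noteq> s\<close> by simp
qed

lemma srefl_neg:
  assumes v: "is_root v" "negv v" "v \<noteq> (\<lambda>t. - alpha s t)" and s: "s \<in> S"
  shows "negv (srefl s v)"
proof -
  have "(\<lambda>t. - v t) \<noteq> alpha s"
  proof
    assume eq: "(\<lambda>t. - v t) = alpha s"
    have "v t = - alpha s t" for t using fun_cong[OF eq, of t] by simp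
    then show False using v(3) by blast
  qed
  then have "posv (srefl s (\<lambda>t. - v t))"
    using v s by (intro srefl_pos) (auto simp: posv_uminus root_uminus)
  moreover have "srefl s (\<lambda>t. - v t) = (\<lambda>t. - srefl s v t)"
    using srefl_linear[of s "-1" v 0 v] by simp
  ultimately show ?thesis by (simp add: posv_uminus)
qed


section \<open>Inversions and the weak order\<close>

text \<open>
  Roots are more convenient than reflections: they carry signs and coordinates. Strong exchange shows
  that inclusion of these sets is the weak order (\<open>weak_le_iff\<close>).
\<close>

definition Inv :: "'a \<Rightarrow> ('a \<Rightarrow> real) set" where
  "Inv w = {\<beta>. is_root \<beta> \<and> posv \<beta> \<and> negv (act (inv w) \<beta>)}"

definition le :: "'a \<Rightarrow> 'a \<Rightarrow> bool" where
  "le v w \<longleftrightarrow> Inv v \<subseteq> Inv w"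

lemma le_refl [simp]: "le w w"
  by (simp add: le_def)

lemma le_trans: "le u v \<Longrightarrow> le v w \<Longrightarrow> le u w"
  by (auto simp: le_def)

lemma not_desc_iff:
  assumes "s \<in> S" "w \<in> carrier G"
  shows "\<not> left_desc s w \<longleftrightarrow> posv (act (inv w) (alpha s))"
proof -
  have *: "posv (act (inv w) (alpha s))" if "\<not> left_desc s w" "w \<in> carrier G" for w
    using act_alpha_pos[of "inv w" s] len_mult_S[of s "inv w"] len_not_desc[of s w] assms that
    by simp
  have "\<not> posv (act (inv w) (alpha s))" if "left_desc s w"
  proof -
    have "posv (act (inv (s \<otimes> w)) (alpha s))"
      using * that assms desc_mult by (simp add: S_carrier)
    then have "negv (act (inv w) (alpha s))"
      using assms by (simp add: inv_mult_group S_inv S_carrier act_mult act_S act_uminus posv_uminus)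
    then show ?thesis
      using root_neg_iff[of "act (inv w) (alpha s)"] assms by (simp add: root_act)
  qed
  then show ?thesis using * assms by blast
qed

lemma desc_iff: "s \<in> S \<Longrightarrow> w \<in> carrier G \<Longrightarrow> left_desc s w \<longleftrightarrow> negv (act (inv w) (alpha s))"
  using not_desc_iff root_neg_iff[of "act (inv w) (alpha s)"] by (auto simp add: root_act)

lemma desc_Inv: "s \<in> S \<Longrightarrow> w \<in> carrier G \<Longrightarrow> left_desc s w \<longleftrightarrow> alpha s \<in> Inv w"
  by (simp add: Inv_def desc_iff)

lemma le_desc: "le v w \<Longrightarrow> v \<in> carrier G \<Longrightarrow> w \<in> carrier G \<Longrightarrow> s \<in> S \<Longrightarrow> left_desc s v \<Longrightarrow> left_desc s w"
  by (auto simp: desc_Inv le_def)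

lemma Inv_one [simp]: "Inv \<one> = {}"
  using root_neg_iff by (auto simp: Inv_def)

lemma le_one [simp]: "le \<one> w"
  by (simp add: le_def)

lemma Inv_S_mult_iff:
  assumes s: "s \<in> S" and w: "w \<in> carrier G" and nd: "\<not> left_desc s w"
  shows "\<beta> \<in> Inv (s \<otimes> w) \<longleftrightarrow> \<beta> = alpha s \<or> srefl s \<beta> \<in> Inv w"
proof (cases "\<beta> = alpha s")
  case True
  then show ?thesis
    using desc_Inv[of s "s \<otimes> w"] desc_mult[OF s w] nd s w by (simp add: S_carrier)
next
  case False
  have *: "act (inv (s \<otimes> w)) \<beta> = act (inv w) (srefl s \<beta>)"
    using s w by (simp add: inv_mult_group S_inv S_carrier act_mult act_S)
  have "srefl s \<beta> \<noteq> alpha s" if "srefl s \<beta> \<in> Inv w"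
    using that nd desc_Inv[OF s w] by auto
  then show ?thesis
    using False s srefl_pos[of \<beta> s] srefl_pos[of "srefl s \<beta>" s] root_refl[of \<beta> s] root_refl[of "srefl s \<beta>" s]
    by (auto simp: Inv_def *)
qed

lemma Inv_S_mult:
  assumes "s \<in> S" "w \<in> carrier G" "\<not> left_desc s w"
  shows "Inv (s \<otimes> w) = insert (alpha s) (srefl s ` Inv w)"
proof -
  have "srefl s \<beta> \<in> Inv w \<longleftrightarrow> \<beta> \<in> srefl s ` Inv w" for \<beta>
    using assms(1) by (metis (no_types, lifting) image_iff srefl_invol)
  then show ?thesis using Inv_S_mult_iff[OF assms] by auto
qed

lemma srefl_inj: "s \<in> S \<Longrightarrow> inj_on (srefl s) A"
  by (metis inj_onI srefl_invol)

lemma finite_card_Inv: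
  assumes "w \<in> carrier G"
  shows "finite (Inv w) \<and> card (Inv w) = len w"
  using assms
proof (induction "len w" arbitrary: w)
  case 0
  then show ?case by (simp add: len_0_iff)
next
  case (Suc n)
  then have "w \<noteq> \<one>" by auto
  then obtain s where s: "s \<in> S" "left_desc s w" using obtain_desc Suc.prems by blast
  define v where "v = s \<otimes> w"
  have v: "v \<in> carrier G" "w = s \<otimes> v" "\<not> left_desc s v" "len w = Suc (len v)"
    using s Suc.prems desc_mult[of s w] len_desc[of s w] by (auto simp: v_def S_carrier)
  then have IH: "finite (Inv v)" "card (Inv v) = len v"
    using Suc.hyps by auto
  have "alpha s \<notin> srefl s ` Inv v"
  proof
    assume "alpha s \<in> srefl s ` Inv v"
    then obtain \<beta> where "\<beta> \<in> Inv v" "alpha s = srefl s \<beta>" by blast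
    then have "\<beta> = (\<lambda>t. - alpha s t)" using s by (metis srefl_alpha srefl_invol)
    then show False using \<open>\<beta> \<in> Inv v\<close> by (simp add: Inv_def posv_uminus)
  qed
  then show ?case
    using Inv_S_mult[OF s(1) v(1,3)] v(2,4) IH s(1) by (simp add: card_image srefl_inj)
qed

lemma le_len: "le v w \<Longrightarrow> v \<in> carrier G \<Longrightarrow> w \<in> carrier G \<Longrightarrow> len v \<le> len w"
  using finite_card_Inv[of v] finite_card_Inv[of w] card_mono by (metis le_def)

lemma Inv_mult_S:
  assumes s: "s \<in> S" and w: "w \<in> carrier G" and pos: "posv (act w (alpha s))"
  shows "Inv (w \<otimes> s) = insert (act w (alpha s)) (Inv w)"
proof -
  have *: "act (inv (w \<otimes> s)) \<beta> = srefl s (act (inv w) \<beta>)" for \<beta>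
    using s w by (simp add: inv_mult_group S_inv S_carrier act_mult act_S)
  have "\<beta> \<in> Inv (w \<otimes> s) \<longleftrightarrow> \<beta> = act w (alpha s) \<or> \<beta> \<in> Inv w" for \<beta>
  proof (cases "is_root \<beta> \<and> posv \<beta>")
    case True
    define \<gamma> where "\<gamma> = act (inv w) \<beta>"
    have \<gamma>: "is_root \<gamma>" "\<beta> = act w \<gamma>" using True w by (auto simp: \<gamma>_def root_act)
    have "\<gamma> \<noteq> (\<lambda>t. - alpha s t)"
    proof
      assume "\<gamma> = (\<lambda>t. - alpha s t)"
      then have "negv \<beta>" using pos \<gamma> w by (simp add: act_uminus negv_uminus)
      then show False using True root_neg_iff by blast
    qed
    then have "negv (srefl s \<gamma>) \<longleftrightarrow> \<gamma> = alpha s \<or> negv \<gamma>"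
      using \<gamma>(1) s srefl_neg[of \<gamma> s] srefl_pos[of \<gamma> s] root_neg_iff root_refl[of \<gamma> s]
      by (auto simp: negv_uminus posv_uminus)
    moreover have "\<beta> = act w (alpha s) \<longleftrightarrow> \<gamma> = alpha s"
      using \<gamma> w by (metis act_inv_act)
    ultimately show ?thesis
      using True by (simp add: Inv_def * flip: \<gamma>_def)
  next
    case False
    then show ?thesis using s w pos by (auto simp: Inv_def root_act)
  qed
  then show ?thesis by blast
qed

text \<open>
  If \<open>t\<close> is a left descent of \<open>inv z \<otimes> y\<close>, then \<open>act z (alpha t)\<close> is an inversion of \<open>y\<close>; it is
  positive since otherwise its negative would be an inversion of \<open>z\<close> but not of \<open>y\<close>.
\<close>

lemma le_strict_step:
  assumes z: "z \<in> carrier G" and y: "y \<in> carrier G" and le: "le z y" and neq: "z \<noteq> y"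
  obtains t where "t \<in> S" "posv (act z (alpha t))" "act z (alpha t) \<in> Inv y" "le (z \<otimes> t) y"
proof -
  have "inv z \<otimes> y \<noteq> \<one>" using z y neq by (metis inv_closed inv_equality inv_inv)
  then obtain t where t: "t \<in> S" "left_desc t (inv z \<otimes> y)"
    using obtain_desc z y by (metis inv_closed m_closed)
  define \<beta> where "\<beta> = act z (alpha t)"
  have \<beta>: "is_root \<beta>" using z t by (simp add: \<beta>_def root_act)
  have neg: "negv (act (inv y) \<beta>)"
    using t z y by (simp add: desc_iff inv_mult_group act_mult \<beta>_def)
  have "posv \<beta>"
  proof (rule ccontr)
    assume "\<not> posv \<beta>"
    then have "posv (\<lambda>t. - \<beta> t)" using \<beta> root_pos_or_neg by (auto simp: posv_uminus)
    then have "(\<lambda>t. - \<beta> t) \<in> Inv z"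
      using \<beta> z t by (simp add: Inv_def root_uminus act_uminus negv_uminus \<beta>_def)
    then have "posv (act (inv y) \<beta>)"
      using le y by (auto simp: le_def Inv_def act_uminus negv_uminus)
    then show False using neg \<beta> y root_neg_iff root_act by (meson inv_closed)
  qed
  moreover have "\<beta> \<in> Inv y" using calculation neg \<beta> by (simp add: Inv_def)
  moreover have "le (z \<otimes> t) y"
    using Inv_mult_S[OF t(1) z] calculation le by (simp add: le_def \<beta>_def)
  ultimately show ?thesis using that t by (simp add: \<beta>_def)
qed

lemma le_antisym:
  assumes "z \<in> carrier G" "y \<in> carrier G" "le z y" "le y z"
  shows "z = y"
proof (rule ccontr)
  assume "z \<noteq> y"
  then obtain t where "t \<in> S" "act z (alpha t) \<in> Inv y"
    using le_strict_step assms by metis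
  then have "act z (alpha t) \<in> Inv z" using assms by (auto simp: le_def)
  then show False using assms by (simp add: Inv_def)
qed

lemma le_S_mult_iff:
  assumes "s \<in> S" "v \<in> carrier G" "w \<in> carrier G" "\<not> left_desc s v" "\<not> left_desc s w"
  shows "le (s \<otimes> v) (s \<otimes> w) \<longleftrightarrow> le v w"
proof -
  have *: "srefl s (alpha s) \<notin> Inv v" "srefl s (alpha s) \<notin> Inv w"
    using assms by (auto simp: Inv_def posv_uminus)
  have "le (s \<otimes> v) (s \<otimes> w) \<longleftrightarrow> (\<forall>\<beta>. srefl s \<beta> \<in> Inv v \<longrightarrow> srefl s \<beta> \<in> Inv w)"
    using * Inv_S_mult_iff[OF assms(1,2,4)] Inv_S_mult_iff[OF assms(1,3,5)]
    unfolding le_def subset_iff by metis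
  also have "\<dots> \<longleftrightarrow> le v w"
  proof
    assume *: "\<forall>\<beta>. srefl s \<beta> \<in> Inv v \<longrightarrow> srefl s \<beta> \<in> Inv w"
    have "\<beta> \<in> Inv w" if "\<beta> \<in> Inv v" for \<beta>
      using *[rule_format, of "srefl s \<beta>"] that assms(1) by simp
    then show "le v w" by (auto simp: le_def)
  qed (auto simp: le_def)
  finally show ?thesis .
qed

lemma conj_simple:
  assumes "r \<in> S" "t \<in> S" "z \<in> carrier G" "act z (alpha t) = alpha r"
  shows "r \<otimes> z = z \<otimes> t"
proof -
  have "z \<otimes> t \<otimes> inv z = \<one> \<otimes> r \<otimes> inv \<one>"
    using assms by (intro reflection_eqI) auto
  then have "z \<otimes> t \<otimes> inv z = r" using assms by (simp add: S_carrier)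
  then show ?thesis using assms by (metis S_carrier inv_solve_right m_closed)
qed

lemma le_mult_simple:
  assumes r: "r \<in> S" and z: "z \<in> carrier G" and t: "t \<in> S" and eq: "act (inv z) (alpha r) = alpha t"
  shows "Inv (r \<otimes> z) = insert (alpha r) (Inv z)"
proof -
  have "act z (alpha t) = alpha r" using eq z by (metis act_act_inv)
  then show ?thesis using conj_simple[OF r t z] Inv_mult_S[OF t z] by simp
qed

text \<open>
  In a chain of covers from \<open>z\<close> up to \<open>y\<close>, the simple generator \<open>r\<close> becomes a left descent at one
  definite step, and that step is left multiplication by \<open>r\<close>.
\<close>

lemma obtain_descent_cover:
  assumes "z \<in> carrier G" "y \<in> carrier G" "le z y" "r \<in> S" "\<not> left_desc r z" "left_desc r y"
  obtains x t where "x \<in> carrier G" "le z x" "\<not> left_desc r x" "le (r \<otimes> x) y"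
    "t \<in> S" "act (inv x) (alpha r) = alpha t"
proof -
  have "\<exists>x t. x \<in> carrier G \<and> le z x \<and> \<not> left_desc r x \<and> le (r \<otimes> x) y \<and> t \<in> S \<and>
      act (inv x) (alpha r) = alpha t"
    using assms(1,3,5)
  proof (induction "len y - len z" arbitrary: z rule: less_induct)
    case less
    have "z \<noteq> y" using less.prems assms by auto
    then obtain t where t: "t \<in> S" "posv (act z (alpha t))" "le (z \<otimes> t) y"
      using le_strict_step less.prems assms by metis
    have zt: "z \<otimes> t \<in> carrier G" using less.prems t by (simp add: S_carrier)
    have I: "Inv (z \<otimes> t) = insert (act z (alpha t)) (Inv z)"
      using Inv_mult_S t less.prems by blast
    show ?case
    proof (cases "left_desc r (z \<otimes> t)")
      case True
      then have "act z (alpha t) = alpha r"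
        using I zt less.prems assms by (auto simp: desc_Inv)
      moreover then have "act (inv z) (alpha r) = alpha t" using less.prems by (metis act_inv_act)
      ultimately show ?thesis
        using less.prems t conj_simple[of r t z] assms by (intro exI[of _ z] exI[of _ t]) auto
    next
      case False
      have "act z (alpha t) \<notin> Inv z" using less.prems by (auto simp: Inv_def)
      then have "len (z \<otimes> t) = Suc (len z)"
        using I finite_card_Inv[OF zt] finite_card_Inv[OF less.prems(1)] by simp
      moreover have "len (z \<otimes> t) \<le> len y" using le_len t zt assms by blast
      ultimately have "len y - len (z \<otimes> t) < len y - len z" by linarith
      then obtain x q where "x \<in> carrier G" "le (z \<otimes> t) x" "\<not> left_desc r x" "le (r \<otimes> x) y" "q \<in> S"
        "act (inv x) (alpha r) = alpha q"
        using less.hyps zt t False by blast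
      moreover then have "le z x" using I by (auto simp: le_def)
      ultimately show ?thesis by blast
    qed
  qed
  then show ?thesis using that by blast
qed

text \<open>
  Strong exchange. Either the inversion is the simple root of a left descent, or that descent can be
  taken off first while the reflection is conjugated by it.
\<close>

lemma len_reflection_less:
  assumes "w \<in> carrier G" "g \<in> carrier G" "s \<in> S" "act g (alpha s) \<in> Inv w"
  shows "len (g \<otimes> s \<otimes> inv g \<otimes> w) < len w"
  using assms
proof (induction "len w" arbitrary: w g rule: less_induct)
  case less
  let ?t = "g \<otimes> s \<otimes> inv g"
  have "w \<noteq> \<one>" using less.prems by auto
  then obtain r where r: "r \<in> S" "left_desc r w" using obtain_desc less.prems by blast
  define v where "v = r \<otimes> w"
  have v: "v \<in> carrier G" "w = r \<otimes> v" "\<not> left_desc r v" "len w = Suc (len v)"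
    using r less.prems desc_mult[of r w] len_desc[of r w] by (auto simp: v_def S_carrier)
  show ?case
  proof (cases "act g (alpha s) = alpha r")
    case True
    then have "?t = \<one> \<otimes> r \<otimes> inv \<one>"
      using less.prems r by (intro reflection_eqI) auto
    then have "?t = r" using r by (simp add: S_carrier)
    then show ?thesis using v r by simp
  next
    case False
    then have "srefl r (act g (alpha s)) \<in> Inv v"
      using less.prems Inv_S_mult_iff[OF r(1) v(1,3)] v(2) by simp
    then have "act (r \<otimes> g) (alpha s) \<in> Inv v"
      using r less.prems by (simp add: act_mult S_carrier act_S)
    then have "len (r \<otimes> g \<otimes> s \<otimes> inv (r \<otimes> g) \<otimes> v) < len v"
      using less.prems r v by (intro less.hyps) (auto simp: S_carrier)
    moreover have "?t \<otimes> w = r \<otimes> (r \<otimes> g \<otimes> s \<otimes> inv (r \<otimes> g) \<otimes> v)"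
      using r less.prems v by (simp add: S_carrier inv_mult_group S_inv m_assoc)
    ultimately show ?thesis
      using len_S_mult_le[of r "r \<otimes> g \<otimes> s \<otimes> inv (r \<otimes> g) \<otimes> v"] r less.prems v
      by (simp add: S_carrier)
  qed
qed

lemma len_reflection_iff:
  assumes "w \<in> carrier G" "g \<in> carrier G" "s \<in> S" "posv (act g (alpha s))"
  shows "len (g \<otimes> s \<otimes> inv g \<otimes> w) < len w \<longleftrightarrow> act g (alpha s) \<in> Inv w"
proof
  define t where "t = g \<otimes> s \<otimes> inv g"
  let ?\<beta> = "act g (alpha s)"
  assume less: "len (g \<otimes> s \<otimes> inv g \<otimes> w) < len w"
  have t: "t \<in> carrier G" "inv t = t"
    using assms by (simp_all add: t_def S_carrier inv_mult_group S_inv m_assoc)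
  show "?\<beta> \<in> Inv w"
  proof (rule ccontr)
    assume "?\<beta> \<notin> Inv w"
    then have "posv (act (inv w) ?\<beta>)"
      using assms root_pos_or_neg[of "act (inv w) ?\<beta>"] by (auto simp: Inv_def root_act)
    moreover have "act t ?\<beta> = (\<lambda>t. - ?\<beta> t)"
      unfolding t_def using assms act_reflection[of g s ?\<beta> ?\<beta>] form_root[of ?\<beta>]
      by (simp add: root_act)
    ultimately have "negv (act (inv (t \<otimes> w)) ?\<beta>)"
      using assms t by (simp add: inv_mult_group act_mult act_uminus negv_uminus)
    then have "?\<beta> \<in> Inv (t \<otimes> w)"
      using assms by (simp add: Inv_def root_act)
    then have "len (t \<otimes> (t \<otimes> w)) < len (t \<otimes> w)"
      using assms t len_reflection_less[of "t \<otimes> w" g s] by (simp add: t_def)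
    moreover have "t \<otimes> (t \<otimes> w) = w"
      using assms t by (metis l_inv l_one m_assoc)
    ultimately show False using less by (simp add: t_def)
  qed
qed (use assms len_reflection_less in blast)

lemma weak_le_iff:
  assumes "v \<in> carrier G" "w \<in> carrier G"
  shows "weak_le G S v w \<longleftrightarrow> le v w"
proof -
  have pos: "\<exists>h\<in>carrier G. posv (act h (alpha s)) \<and> g \<otimes> s \<otimes> inv g = h \<otimes> s \<otimes> inv h"
    if "g \<in> carrier G" "s \<in> S" for g s
  proof (cases "posv (act g (alpha s))")
    case False
    then have "posv (act (g \<otimes> s) (alpha s))"
      using that root_pos_or_neg[of "act g (alpha s)"]
      by (simp add: root_act act_mult S_carrier act_S act_uminus posv_uminus)
    then show ?thesis
      using that by (intro bexI[of _ "g \<otimes> s"]) (simp_all add: S_carrier inv_mult_group S_inv m_assoc)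
  qed (use that in blast)
  show ?thesis
  proof
    assume le: "weak_le G S v w"
    show "le v w"
      unfolding le_def
    proof
      fix \<beta> assume \<beta>: "\<beta> \<in> Inv v"
      then obtain g s where g: "g \<in> carrier G" "s \<in> S" "\<beta> = act g (alpha s)" "posv \<beta>"
        by (auto simp: Inv_def is_root_def)
      then have "g \<otimes> s \<otimes> inv g \<in> inversions G S v"
        using assms \<beta> len_reflection_iff[of v g s] by (auto simp: inversions_def reflections_def)
      then have "g \<otimes> s \<otimes> inv g \<in> inversions G S w"
        using le by (auto simp: weak_le_def)
      then show "\<beta> \<in> Inv w"
        using assms g len_reflection_iff[of w g s] by (auto simp: inversions_def)
    qed
  next
    assume le: "le v w"
    show "weak_le G S v w"
      unfolding weak_le_def
    proof
      fix t assume t: "t \<in> inversions G S v"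
      then obtain g s where "g \<in> carrier G" "s \<in> S" "t = g \<otimes> s \<otimes> inv g"
        by (auto simp: inversions_def reflections_def)
      then obtain h where h: "h \<in> carrier G" "s \<in> S" "posv (act h (alpha s))" "t = h \<otimes> s \<otimes> inv h"
        using pos by metis
      then have "act h (alpha s) \<in> Inv v"
        using assms t len_reflection_iff[of v h s] by (auto simp: inversions_def)
      then have "act h (alpha s) \<in> Inv w" using le by (auto simp: le_def)
      then show "t \<in> inversions G S w"
        using assms h t len_reflection_iff[of w h s] by (auto simp: inversions_def)
    qed
  qed
qed

section \<open>Sortable elements by recursion\<close>

text \<open>
  The Coxeter words of standard parabolic subgroups. The letters of such a word vary in the
  inductions below, while \<open>S\<close> and the group stay the same.
\<close>

definition inj_word :: "'a list \<Rightarrow> bool" where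
  "inj_word a \<longleftrightarrow> distinct a \<and> set a \<subseteq> S"

lemma inj_word_Cons:
  "inj_word (r # a) \<longleftrightarrow> r \<in> S \<and> r \<notin> set a \<and> inj_word a"
  by (auto simp: inj_word_def)

lemma inj_word_snoc:
  "inj_word (a @ [r]) \<longleftrightarrow> r \<in> S \<and> r \<notin> set a \<and> inj_word a"
  by (auto simp: inj_word_def)

text \<open>
  In a sorting word of a sortable element, a letter that is skipped once never occurs again; so a
  skipped first letter can be deleted, and one that is used comes back at the end of the word. For
  words that contain all of \<open>S\<close> this is sortability (\<open>sortable_elements_srt\<close>).
\<close>

inductive srt :: "'a list \<Rightarrow> 'a \<Rightarrow> bool" where
  srt_Nil: "srt [] \<one>"
| srt_drop: "srt a u \<Longrightarrow> \<not> left_desc r u \<Longrightarrow> srt (r # a) u"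
| srt_rotate: "srt (a @ [r]) u \<Longrightarrow> \<not> left_desc r u \<Longrightarrow> srt (r # a) (r \<otimes> u)"

function proj :: "'a list \<Rightarrow> 'a \<Rightarrow> 'a" where
  "proj [] x = \<one>"
| "proj (r # a) x = (if left_desc r x then r \<otimes> proj (a @ [r]) (r \<otimes> x) else proj a x)"
  by pat_completeness auto
termination
  by (relation "measures [\<lambda>(a, x). length a, \<lambda>(a, x). len x]") (auto simp: left_desc_def)

lemma rotation_induct [consumes 2, case_names Nil left_desc not_desc]:
  assumes "inj_word a" "x \<in> carrier G"
    and "\<And>x. x \<in> carrier G \<Longrightarrow> P [] x"
    and "\<And>r a x. inj_word (r # a) \<Longrightarrow> r \<in> S \<Longrightarrow> r \<notin> set a \<Longrightarrow> inj_word (a @ [r]) \<Longrightarrow> x \<in> carrier G \<Longrightarrow>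
      r \<otimes> x \<in> carrier G \<Longrightarrow> left_desc r x \<Longrightarrow> \<not> left_desc r (r \<otimes> x) \<Longrightarrow> P (a @ [r]) (r \<otimes> x) \<Longrightarrow> P (r # a) x"
    and "\<And>r a x. inj_word (r # a) \<Longrightarrow> r \<in> S \<Longrightarrow> r \<notin> set a \<Longrightarrow> inj_word a \<Longrightarrow> x \<in> carrier G \<Longrightarrow>
      \<not> left_desc r x \<Longrightarrow> P a x \<Longrightarrow> P (r # a) x"
  shows "P a x"
  using assms(1,2)
proof (induction a x rule: proj.induct)
  case (2 r a x)
  have r: "r \<in> S" "r \<notin> set a" "inj_word a" "inj_word (a @ [r])"
    using 2 by (auto simp: inj_word_Cons inj_word_snoc)
  show ?case
  proof (cases "left_desc r x")
    case True
    then show ?thesis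
      using 2 r by (intro assms(4)) (auto simp: S_carrier desc_mult)
  next
    case False
    then show ?thesis
      using 2 r by (intro assms(5)) auto
  qed
qed (use assms(3) in auto)

lemma srt_carrier: "srt a u \<Longrightarrow> inj_word a \<Longrightarrow> u \<in> carrier G"
  by (induction rule: srt.induct) (auto simp: S_carrier inj_word_Cons inj_word_snoc)

lemma srt_act_outside:
  "srt a u \<Longrightarrow> inj_word a \<Longrightarrow> t \<notin> set a \<Longrightarrow> act (inv u) v t = v t"
proof (induction arbitrary: v rule: srt.induct)
  case (srt_rotate a r u)
  have r: "r \<in> S" "u \<in> carrier G"
    using srt_rotate srt_carrier by (auto simp: inj_word_Cons inj_word_snoc)
  then have "act (inv (r \<otimes> u)) v = act (inv u) (srefl r v)"
    by (simp add: inv_mult_group S_inv S_carrier act_mult act_S)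
  then show ?case
    using srt_rotate by (auto simp: inj_word_Cons inj_word_snoc)
qed (auto simp: inj_word_Cons)

lemma srt_not_desc:
  assumes "srt a u" "inj_word a" "r \<in> S" "r \<notin> set a"
  shows "\<not> left_desc r u"
proof -
  have u: "u \<in> carrier G" using assms srt_carrier by blast
  have "act (inv u) (alpha r) r = 1"
    using srt_act_outside[OF assms(1,2,4)] by (simp add: alpha_def)
  then have "posv (act (inv u) (alpha r))"
    using assms u by (intro root_pos_coordinate[of _ r]) (simp_all add: root_act)
  then show ?thesis using not_desc_iff assms u by blast
qed

definition supported :: "'a set \<Rightarrow> ('a \<Rightarrow> real) \<Rightarrow> bool" where
  "supported A v \<longleftrightarrow> (\<forall>t. t \<notin> A \<longrightarrow> v t = 0)"

lemma supported_alpha: "r \<in> A \<Longrightarrow> supported A (alpha r)"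
  by (auto simp: supported_def alpha_def)

lemma supported_srefl: "r \<in> A \<Longrightarrow> supported A v \<Longrightarrow> supported A (srefl r v)"
  by (auto simp: supported_def srefl_def)

lemma supported_mono: "supported A v \<Longrightarrow> A \<subseteq> B \<Longrightarrow> supported B v"
  by (auto simp: supported_def)

text \<open>
  Since \<open>u\<close> is a product of letters of \<open>a\<close>, its inverse does not change a coordinate outside
  \<open>set a\<close>. An inversion has nonnegative coordinates before and nonpositive ones after, so these
  vanish.
\<close>

lemma srt_Inv_supported:
  assumes "srt a u" "inj_word a" "\<beta> \<in> Inv u"
  shows "supported (set a) \<beta>"
  unfolding supported_def
proof (intro allI impI)
  fix t assume "t \<notin> set a"
  then have "act (inv u) \<beta> t = \<beta> t" using assms srt_act_outside by blast
  moreover have "0 \<le> \<beta> t" "act (inv u) \<beta> t \<le> 0"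
    using assms(3) by (auto simp: Inv_def posv_def negv_def)
  ultimately show "\<beta> t = 0" by simp
qed

text \<open>
  Compare the left descents of \<open>u\<close> one after another with \<open>r\<close>: as long as they commute with \<open>r\<close>,
  they fix \<open>alpha r\<close>, and the first that does not yields \<open>\<delta>\<close>. This starts the induction in
  \<open>wall_simple_or_inversion\<close>.
\<close>

lemma srt_fixes_or_inversion:
  assumes "srt a u" "inj_word a" "r \<in> S" "r \<notin> set a"
  shows "act (inv u) (alpha r) = alpha r \<or> (\<exists>\<delta>\<in>Inv u. pair r \<delta> < 0)"
  using assms
proof (induction rule: srt.induct)
  case (srt_rotate a q u)
  have q: "q \<in> S" "q \<noteq> r" "u \<in> carrier G" "inj_word (a @ [q])" "r \<notin> set (a @ [q])"
    using srt_rotate srt_carrier by (auto simp: inj_word_Cons inj_word_snoc)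
  have I: "Inv (q \<otimes> u) = insert (alpha q) (srefl q ` Inv u)"
    using Inv_S_mult q srt_rotate.hyps by blast
  show ?case
  proof (cases "cartan r q = 0")
    case True
    then have fix_r: "srefl q (alpha r) = alpha r"
      using q srt_rotate.prems by (auto simp: srefl_def pair_alpha cartan_sym)
    then have "act (inv (q \<otimes> u)) (alpha r) = act (inv u) (alpha r)"
      using q by (simp add: inv_mult_group S_inv S_carrier act_mult act_S)
    moreover have "pair r (srefl q \<delta>) = pair r \<delta>" for \<delta>
      using form_refl[of q "alpha r" \<delta>] fix_r q srt_rotate.prems by (simp add: form_alpha)
    ultimately show ?thesis
      using srt_rotate.IH q srt_rotate.prems I by fastforce
  next
    case False
    then have "pair r (alpha q) < 0"
      using cartan_nonpos[of r q] q srt_rotate.prems by (simp add: pair_alpha)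
    then show ?thesis using I by blast
  qed
qed (auto simp: inj_word_Cons)

lemma proj_sortable_le:
  assumes "inj_word a" "x \<in> carrier G"
  shows "srt a (proj a x) \<and> le (proj a x) x"
  using assms
proof (induction rule: rotation_induct)
  case (Nil x)
  then show ?case by (simp add: srt_Nil)
next
  case (left_desc r a x)
  let ?p = "proj (a @ [r]) (r \<otimes> x)"
  have p: "?p \<in> carrier G" "\<not> left_desc r ?p"
    using left_desc srt_carrier le_desc by blast+
  have "le (r \<otimes> ?p) (r \<otimes> (r \<otimes> x))"
    using left_desc p by (subst le_S_mult_iff) auto
  then show ?case using left_desc p by (auto intro: srt_rotate)
next
  case (not_desc r a x)
  then show ?case using srt_not_desc by (auto intro: srt_drop)
qed

lemmas proj_sortable = proj_sortable_le[THEN conjunct1]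
  and proj_le = proj_sortable_le[THEN conjunct2]

lemma proj_carrier: "inj_word a \<Longrightarrow> x \<in> carrier G \<Longrightarrow> proj a x \<in> carrier G"
  using proj_sortable srt_carrier by blast


section \<open>The Euler form of a Coxeter word\<close>

text \<open>
  Writing the invariant form as a matrix, the Euler form keeps the entries below the diagonal, in the
  order of the word \<open>a\<close>, and half of the diagonal.
\<close>

fun euler :: "'a list \<Rightarrow> ('a \<Rightarrow> real) \<Rightarrow> ('a \<Rightarrow> real) \<Rightarrow> real" where
  "euler [] x y = 0"
| "euler (r # a) x y = x r * y r + (\<Sum>t\<in>set a. x t * cartan t r) * y r + euler a x y"

lemma euler_cong:
  "(\<And>t. t \<in> set a \<Longrightarrow> x t = x' t) \<Longrightarrow> (\<And>t. t \<in> set a \<Longrightarrow> y t = y' t) \<Longrightarrow> euler a x y = euler a x' y'"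
  by (induction a) auto

lemma euler_zero_left: "(\<And>t. t \<in> set a \<Longrightarrow> x t = 0) \<Longrightarrow> euler a x y = 0"
  by (induction a) auto

lemma euler_snoc:
  "distinct (a @ [s]) \<Longrightarrow> euler (a @ [s]) x y =
    euler a x y + x s * y s + x s * (\<Sum>t\<in>set a. cartan s t * y t)"
  by (induction a) (auto simp: algebra_simps)

lemma euler_alpha_first:
  assumes "inj_word (r # a)"
  shows "euler (r # a) (alpha r) y = y r"
proof -
  have "alpha r t = 0" if "t \<in> set a" for t
    using assms that by (auto simp: inj_word_Cons alpha_def)
  then show ?thesis by (simp add: euler_zero_left alpha_def[of r r])
qed

lemma pair_supported:
  assumes "inj_word (r # a)" "supported (set (r # a)) y"
  shows "pair r y = 2 * y r + (\<Sum>t\<in>set a. cartan r t * y t)"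
proof -
  have "pair r y = (\<Sum>t\<in>set (r # a). cartan r t * y t)"
    unfolding pair_def using assms finite_S
    by (intro sum.mono_neutral_right) (auto simp: inj_word_def supported_def)
  then show ?thesis using assms by (auto simp: inj_word_Cons)
qed

lemma euler_alpha_last_left:
  assumes "inj_word (a @ [r])" "supported (set (a @ [r])) y"
  shows "euler (a @ [r]) (alpha r) y = pair r y - y r"
proof -
  have ra: "inj_word (r # a)" using assms by (simp add: inj_word_Cons inj_word_snoc)
  have "alpha r t = 0" if "t \<in> set a" for t
    using ra that by (auto simp: inj_word_Cons alpha_def)
  then show ?thesis
    using assms pair_supported[OF ra, of y] euler_snoc[of a r "alpha r" y]
    by (simp add: inj_word_def euler_zero_left alpha_def[of r r])
qed

lemma euler_alpha_last_right:
  assumes "inj_word (a @ [s])"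
  shows "euler (a @ [s]) x (alpha s) = x s"
proof -
  have z: "alpha s t = 0" if "t \<in> set a" for t
    using assms that by (auto simp: inj_word_snoc alpha_def)
  have "euler a x (alpha s) = 0"
    using z by (induction a) auto
  then show ?thesis
    using assms z by (simp add: euler_snoc inj_word_def alpha_def[of s s])
qed

text \<open>
  A letter that moves from the first to the last position trades the entries of its column for
  those of its row; reflecting both arguments in its simple root has the same effect.
\<close>

lemma euler_rotate:
  assumes "inj_word (r # a)" "supported (set (r # a)) x" "supported (set (r # a)) y"
  shows "euler (r # a) (srefl r x) (srefl r y) = euler (a @ [r]) x y"
proof -
  have r: "r \<in> S" "r \<notin> set a" "distinct (a @ [r])" "set a \<subseteq> S"
    using assms by (auto simp: inj_word_def)
  let ?X = "\<Sum>t\<in>set a. cartan r t * x t" and ?Y = "\<Sum>t\<in>set a. cartan r t * y t"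
  have "(\<Sum>t\<in>set a. srefl r x t * cartan t r) = ?X"
    using r by (intro sum.cong) (auto simp: srefl_def cartan_sym)
  moreover have "euler a (srefl r x) (srefl r y) = euler a x y"
    using r by (intro euler_cong) (auto simp: srefl_def)
  moreover have "srefl r x r = - x r - ?X" "srefl r y r = - y r - ?Y"
    using pair_supported[OF assms(1)] assms by (simp_all add: srefl_def)
  ultimately show ?thesis
    using r by (simp add: euler_snoc) (simp add: algebra_simps)
qed

lemma euler_restrict:
  assumes "x r = 0" "\<And>t. t \<in> set a \<Longrightarrow> y t = y' t" and "distinct (a @ [r])"
  shows "euler (a @ [r]) x y = euler a x y'"
  using assms euler_cong[of a x x y y'] by (simp add: euler_snoc)


section \<open>Walls and rays of Cambrian cones\<close>

text \<open>
  The walls bound the cone of all \<open>x\<close> with a given projection, and the rays span it when vectors are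
  identified with linear forms by means of the Euler form. If \<open>r\<close> is deleted from the word, it
  contributes the wall \<open>alpha r\<close>, and the other rays are reflected so that the Euler form pairs them
  to zero with \<open>alpha r\<close>. The value for the empty word, which has no letters, is arbitrary.
\<close>

function wall :: "'a list \<Rightarrow> 'a \<Rightarrow> 'a \<Rightarrow> 'a \<Rightarrow> real" where
  "wall [] x t = alpha t"
| "wall (r # a) x t = (if left_desc r x then srefl r (wall (a @ [r]) (r \<otimes> x) t)
     else if t = r then alpha r else wall a x t)"
  by pat_completeness auto
termination
  by (relation "measures [\<lambda>(a, x, t). length a, \<lambda>(a, x, t). len x]") (auto simp: left_desc_def)

function ray :: "'a list \<Rightarrow> 'a \<Rightarrow> 'a \<Rightarrow> 'a \<Rightarrow> real" where
  "ray [] x t = alpha t"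
| "ray (r # a) x t = (if left_desc r x then srefl r (ray (a @ [r]) (r \<otimes> x) t)
     else if t = r then alpha r else srefl r (ray a x t))"
  by pat_completeness auto
termination
  by (relation "measures [\<lambda>(a, x, t). length a, \<lambda>(a, x, t). len x]") (auto simp: left_desc_def)

lemma wall_root:
  assumes "inj_word a" "x \<in> carrier G"
  shows "t \<in> set a \<Longrightarrow> is_root (wall a x t) \<and> supported (set a) (wall a x t)"
  using assms
proof (induction rule: rotation_induct)
  case (left_desc r a x)
  then have "is_root (wall (a @ [r]) (r \<otimes> x) t)" "supported (set (r # a)) (wall (a @ [r]) (r \<otimes> x) t)"
    by auto
  then show ?case using left_desc by (simp add: root_refl supported_srefl)
next
  case (not_desc r a x)
  then show ?case by (auto simp: supported_alpha intro: supported_mono)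
qed simp

lemma ray_root:
  assumes "inj_word a" "x \<in> carrier G"
  shows "t \<in> set a \<Longrightarrow> is_root (ray a x t) \<and> supported (set a) (ray a x t)"
  using assms
proof (induction rule: rotation_induct)
  case (left_desc r a x)
  then have "is_root (ray (a @ [r]) (r \<otimes> x) t)" "supported (set (r # a)) (ray (a @ [r]) (r \<otimes> x) t)"
    by auto
  then show ?case using left_desc by (simp add: root_refl supported_srefl)
next
  case (not_desc r a x)
  show ?case
  proof (cases "t = r")
    case False
    then have "is_root (ray a x t)" "supported (set (r # a)) (ray a x t)"
      using not_desc by (auto intro: supported_mono)
    then show ?thesis using not_desc False by (simp add: root_refl supported_srefl)
  qed (use not_desc in \<open>simp add: supported_alpha\<close>)
qed simp

lemma wall_positive:
  assumes "inj_word a" "x \<in> carrier G"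
  shows "t \<in> set a \<Longrightarrow> posv (act (inv x) (wall a x t))"
  using assms
proof (induction rule: rotation_induct)
  case (left_desc r a x)
  have "inv x = inv (r \<otimes> x) \<otimes> r"
    using left_desc by (simp add: inv_mult_group S_inv S_carrier)
  then have "act (inv x) (srefl r v) = act (inv (r \<otimes> x)) v" for v
    using left_desc by (simp add: act_mult act_S S_carrier del: inv_mult_group)
  then show ?case using left_desc by auto
next
  case (not_desc r a x)
  then have "posv (act (inv x) (alpha r))" using not_desc_iff by blast
  then show ?case using not_desc by (cases "t = r") auto
qed simp

text \<open>
  Rays and walls are dual bases: the Euler form of \<open>r # a\<close> reads off the coordinate at \<open>r\<close> when its
  left argument is \<open>alpha r\<close>, and it agrees with the Euler form of \<open>a\<close> when its left argument is a
  reflected ray.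
\<close>

lemma wall_expansion:
  assumes "inj_word a" "x \<in> carrier G"
  shows "supported (set a) y \<Longrightarrow> y = (\<lambda>q. \<Sum>t\<in>set a. euler a (ray a x t) y * wall a x t q)"
  using assms
proof (induction arbitrary: y rule: rotation_induct)
  case (Nil x)
  then show ?case by (auto simp: supported_def)
next
  case (left_desc r a x)
  let ?w = "wall (a @ [r]) (r \<otimes> x)" and ?e = "ray (a @ [r]) (r \<otimes> x)"
  let ?y = "srefl r y"
  have y: "supported (set (r # a)) ?y" using left_desc by (simp add: supported_srefl)
  have "euler (a @ [r]) (?e t) ?y = euler (r # a) (ray (r # a) x t) y" if "t \<in> set (r # a)" for t
  proof -
    have "supported (set (r # a)) (?e t)"
      using ray_root[OF left_desc(4,6), of t] that by auto
    then show ?thesis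
      using euler_rotate[OF left_desc(1) _ y, of "?e t"] left_desc by simp
  qed
  note euler = this
  have "?y = (\<lambda>q. \<Sum>t\<in>set (a @ [r]). euler (a @ [r]) (?e t) ?y * ?w t q)"
    using left_desc.IH y by simp
  also have "\<dots> = (\<lambda>q. \<Sum>t\<in>set (r # a). euler (r # a) (ray (r # a) x t) y * ?w t q)"
    using euler by (intro ext sum.cong) auto
  finally have "act r ?y = act r (\<lambda>q. \<Sum>t\<in>set (r # a). euler (r # a) (ray (r # a) x t) y * ?w t q)"
    by simp
  then have "y = (\<lambda>q. \<Sum>t\<in>set (r # a). euler (r # a) (ray (r # a) x t) y * srefl r (?w t) q)"
    using left_desc by (simp only: act_sum[OF S_carrier] act_S) simp
  then show ?case using left_desc by (simp del: euler.simps)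
next
  case (not_desc r a x)
  define z where "z = y(r := 0)"
  have z: "supported (set a) z" "\<And>t. t \<in> set a \<Longrightarrow> z t = y t"
    using not_desc by (auto simp: z_def supported_def)
  have euler: "euler (r # a) (ray (r # a) x t) y = euler a (ray a x t) z" if t: "t \<in> set a" for t
  proof -
    have e: "supported (set a) (ray a x t)" using ray_root[OF not_desc(4,5) t] by simp
    then have er: "ray a x t r = 0" "supported (set (r # a)) (ray a x t)"
      using not_desc by (auto simp: supported_def)
    have y: "supported (set (r # a)) (srefl r y)" using not_desc by (simp add: supported_srefl)
    have "euler (r # a) (ray (r # a) x t) y = euler (r # a) (srefl r (ray a x t)) (srefl r (srefl r y))"
      using not_desc t by auto
    also have "\<dots> = euler (a @ [r]) (ray a x t) (srefl r y)"
      using euler_rotate[OF not_desc(1) er(2) y] .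
    also have "\<dots> = euler a (ray a x t) z"
      using not_desc er z by (intro euler_restrict) (auto simp: srefl_def inj_word_def)
    finally show ?thesis .
  qed
  show ?case
  proof
    fix q
    have "(\<Sum>t\<in>set (r # a). euler (r # a) (ray (r # a) x t) y * wall (r # a) x t q) =
        euler (r # a) (ray (r # a) x r) y * wall (r # a) x r q +
        (\<Sum>t\<in>set a. euler (r # a) (ray (r # a) x t) y * wall (r # a) x t q)"
      using not_desc by (simp del: euler.simps wall.simps ray.simps)
    also have "(\<Sum>t\<in>set a. euler (r # a) (ray (r # a) x t) y * wall (r # a) x t q) =
        (\<Sum>t\<in>set a. euler a (ray a x t) z * wall a x t q)"
      using not_desc by (intro sum.cong) (auto simp: euler simp del: euler.simps ray.simps)
    also have "\<dots> = z q" using not_desc.IH[OF z(1)] by metis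
    also have "euler (r # a) (ray (r # a) x r) y * wall (r # a) x r q = y r * alpha r q"
      using not_desc euler_alpha_first[OF not_desc(1)] by (simp del: euler.simps)
    finally show "y q = (\<Sum>t\<in>set (r # a). euler (r # a) (ray (r # a) x t) y * wall (r # a) x t q)"
      by (auto simp: z_def alpha_def)
  qed
qed

text \<open>
  For \<open>q\<close> in \<open>a\<close> these are the inversions of the Coxeter element that \<open>a\<close> represents. Their negatives
  play the part of the negative simple roots among almost positive roots. The value for the empty
  word is arbitrary.
\<close>

fun rho :: "'a list \<Rightarrow> 'a \<Rightarrow> 'a \<Rightarrow> real" where
  "rho [] q = alpha q"
| "rho (r # a) q = (if q = r then alpha r else srefl r (rho a q))"

definition nrho :: "'a list \<Rightarrow> 'a \<Rightarrow> 'a \<Rightarrow> real" where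
  "nrho a q = (\<lambda>p. - rho a q p)"

lemma rho_root:
  "inj_word a \<Longrightarrow> q \<in> set a \<Longrightarrow> is_root (rho a q) \<and> posv (rho a q) \<and> supported (set a) (rho a q)"
proof (induction a)
  case (Cons r a)
  show ?case
  proof (cases "q = r")
    case False
    then have IH: "is_root (rho a q)" "posv (rho a q)" "supported (set a) (rho a q)"
      using Cons by (auto simp: inj_word_Cons)
    have "rho a q \<noteq> alpha r"
    proof
      assume "rho a q = alpha r"
      then have "rho a q r = 1" by (simp add: alpha_def)
      then show False using IH(3) Cons.prems by (simp add: supported_def inj_word_Cons)
    qed
    then show ?thesis
      using False IH Cons.prems srefl_pos[of "rho a q" r] supported_mono[OF IH(3), of "set (r # a)"]
      by (auto simp: inj_word_Cons root_refl intro!: supported_srefl)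
  qed (use Cons in \<open>auto simp: inj_word_Cons supported_alpha\<close>)
qed simp

lemma rho_snoc: "q \<in> set a \<Longrightarrow> rho (a @ [s]) q = rho a q"
  by (induction a) auto

lemma nrho_not_posv: "inj_word a \<Longrightarrow> q \<in> set a \<Longrightarrow> \<not> posv (nrho a q)"
  using rho_root[of a q] root_neg_iff unfolding nrho_def posv_uminus by blast

lemma nrho_Cons: "q \<noteq> r \<Longrightarrow> nrho (r # a) q = srefl r (nrho a q)"
  using srefl_linear[of r "-1" "rho a q" 0 "rho a q"] by (simp add: nrho_def)

text \<open>
  This is the compatibility of almost positive roots in a cluster: a negative element \<open>nrho a q\<close>
  excludes the letter \<open>q\<close> from the positive ones, and the Euler form is nonnegative between the
  positive ones.
\<close>

definition cluster :: "'a list \<Rightarrow> ('a \<Rightarrow> 'a \<Rightarrow> real) \<Rightarrow> bool" where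
  "cluster a f \<longleftrightarrow>
     (\<forall>t\<in>set a. posv (f t) \<or> (\<exists>q\<in>set a. f t = nrho a q)) \<and>
     (\<forall>t\<in>set a. \<forall>q\<in>set a. f t = nrho a q \<longrightarrow> (\<forall>u\<in>set a. posv (f u) \<longrightarrow> f u q = 0)) \<and>
     (\<forall>t\<in>set a. \<forall>u\<in>set a. posv (f t) \<longrightarrow> posv (f u) \<longrightarrow> 0 \<le> euler a (f t) (f u))"

lemma clusterD:
  assumes "cluster a f"
  shows "t \<in> set a \<Longrightarrow> posv (f t) \<or> (\<exists>q\<in>set a. f t = nrho a q)"
    and "t \<in> set a \<Longrightarrow> q \<in> set a \<Longrightarrow> f t = nrho a q \<Longrightarrow> u \<in> set a \<Longrightarrow> posv (f u) \<Longrightarrow> f u q = 0"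
    and "t \<in> set a \<Longrightarrow> u \<in> set a \<Longrightarrow> posv (f t) \<Longrightarrow> posv (f u) \<Longrightarrow> 0 \<le> euler a (f t) (f u)"
  using assms by (auto simp: cluster_def)

text \<open>
  The Euler form against the last simple root reads off a coordinate, so the expansion of that
  simple root in the walls has the last coordinates of the rays as coefficients.
\<close>

lemma last_alpha_expansion:
  assumes "inj_word (a @ [s])" "x \<in> carrier G"
  shows "act (inv x) (alpha s) p =
    (\<Sum>t\<in>set (a @ [s]). ray (a @ [s]) x t s * act (inv x) (wall (a @ [s]) x t) p)"
proof -
  have "alpha s = (\<lambda>q. \<Sum>t\<in>set (a @ [s]). euler (a @ [s]) (ray (a @ [s]) x t) (alpha s) *
      wall (a @ [s]) x t q)"
    using assms by (intro wall_expansion) (auto simp: supported_alpha)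
  then have "alpha s = (\<lambda>q. \<Sum>t\<in>set (a @ [s]). ray (a @ [s]) x t s * wall (a @ [s]) x t q)"
    unfolding euler_alpha_last_right[OF assms(1)] .
  then have "act (inv x) (alpha s) =
      act (inv x) (\<lambda>q. \<Sum>t\<in>set (a @ [s]). ray (a @ [s]) x t s * wall (a @ [s]) x t q)"
    by (rule arg_cong)
  also have "\<dots> = (\<lambda>q. \<Sum>t\<in>set (a @ [s]). ray (a @ [s]) x t s * act (inv x) (wall (a @ [s]) x t) q)"
    using assms by (intro act_sum) simp
  finally show ?thesis by (rule fun_cong)
qed

text \<open>
  If some ray is \<open>nrho (a @ [s]) s\<close>, then all positive rays have coordinate \<open>0\<close> at \<open>s\<close> by
  compatibility, so no ray has a positive one. Hence \<open>inv x\<close> sends \<open>alpha s\<close> to a nonpositive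
  combination of positive roots.
\<close>

lemma cluster_last_negative:
  assumes a: "inj_word (a @ [s])" and x: "x \<in> carrier G"
    and cl: "cluster (a @ [s]) (ray (a @ [s]) x)"
    and t: "t \<in> set (a @ [s])" "ray (a @ [s]) x t = nrho (a @ [s]) s"
  shows "left_desc s x"
proof (rule ccontr)
  let ?a = "a @ [s]"
  have s: "s \<in> S" using a by (simp add: inj_word_snoc)
  assume "\<not> left_desc s x"
  then have "posv (act (inv x) (alpha s))" using not_desc_iff s x by blast
  moreover have "negv (act (inv x) (alpha s))"
    unfolding negv_def last_alpha_expansion[OF a x]
  proof (intro allI sum_nonpos)
    fix p u assume u: "u \<in> set ?a"
    have "ray ?a x u s \<le> 0"
    proof (cases "posv (ray ?a x u)")
      case True
      then show ?thesis using clusterD(2)[OF cl t(1) _ t(2) u] by simp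
    next
      case False
      then obtain q where q: "q \<in> set ?a" "ray ?a x u = nrho ?a q"
        using clusterD(1)[OF cl u] by blast
      then show ?thesis using rho_root[OF a q(1)] by (simp add: nrho_def posv_def)
    qed
    moreover have "0 \<le> act (inv x) (wall ?a x u) p"
      using wall_positive[OF a x u] by (simp add: posv_def)
    ultimately show "ray ?a x u s * act (inv x) (wall ?a x u) p \<le> 0"
      by (rule mult_nonpos_nonneg)
  qed
  moreover have "is_root (act (inv x) (alpha s))" using s x by (simp add: root_act)
  ultimately show False using root_neg_iff by blast
qed

lemma posv_srefl_iff:
  assumes "is_root v" "s \<in> S" "v \<noteq> alpha s" "v \<noteq> (\<lambda>t. - alpha s t)"
  shows "posv (srefl s v) \<longleftrightarrow> posv v"
  using assms srefl_pos srefl_neg root_neg_iff root_refl by metis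

text \<open>
  Deleting the first letter \<open>r\<close> keeps the positive rays positive, as none of them is \<open>alpha r\<close>, and
  adds \<open>alpha r\<close>, whose products with the others for the Euler form are a coordinate and zero.
  Moving \<open>r\<close> to the end reflects all rays. A positive root stays positive unless it is
  \<open>alpha r\<close>, which becomes \<open>nrho (r # a) r\<close>, and the other negative elements correspond to each other.
  The only negative element for \<open>a @ [r]\<close> without such a counterpart is \<open>nrho (a @ [r]) r\<close>; it does
  not occur by \<open>cluster_last_negative\<close>, since \<open>r\<close> is not a left descent of \<open>r \<otimes> x\<close>.
\<close>

theorem ray_cluster:
  assumes "inj_word a" "x \<in> carrier G"
  shows "cluster a (ray a x)"
  using assms
proof (induction rule: rotation_induct)
  case (Nil x)
  then show ?case by (simp add: cluster_def)
next
  case (left_desc r a x)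
  define e where "e = ray (a @ [r]) (r \<otimes> x)"
  have ray: "ray (r # a) x t = srefl r (e t)" for t using left_desc by (simp add: e_def)
  have cl: "cluster (a @ [r]) e" using left_desc by (simp add: e_def)
  have root: "is_root (e t)" "supported (set (r # a)) (e t)" if "t \<in> set (r # a)" for t
    using ray_root[OF left_desc(4,6), of t] that by (auto simp: e_def)
  have excluded: "e t \<noteq> nrho (a @ [r]) r" if "t \<in> set (r # a)" for t
    using cluster_last_negative[OF left_desc(4,6), of t] left_desc that by (auto simp: e_def)
  have last: "nrho (a @ [r]) q = nrho a q" "nrho (r # a) q = srefl r (nrho a q)" if "q \<in> set a" for q
    using that left_desc rho_snoc[of q a r] nrho_Cons[of q r a] by (auto simp: nrho_def)
  have first: "nrho (r # a) r = srefl r (alpha r)" using left_desc by (simp add: nrho_def)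
  have cases: "posv (e t) \<or> (\<exists>q\<in>set a. e t = nrho a q)" if "t \<in> set (r # a)" for t
    using clusterD(1)[OF cl, of t] excluded[OF that] last that by auto
  have pos: "posv (e t)" if "t \<in> set (r # a)" "posv (srefl r (e t))" for t
  proof (rule ccontr)
    assume "\<not> posv (e t)"
    then obtain q where q: "q \<in> set a" "e t = nrho a q" using cases[OF \<open>t \<in> set (r # a)\<close>] by blast
    then have "srefl r (e t) = nrho (r # a) q" using last by simp
    then show False using nrho_not_posv[OF left_desc(1), of q] q that by simp
  qed
  show ?case
    unfolding cluster_def ray
  proof (intro conjI ballI impI)
    fix t assume t: "t \<in> set (r # a)"
    show "posv (srefl r (e t)) \<or> (\<exists>q\<in>set (r # a). srefl r (e t) = nrho (r # a) q)"
    proof (cases "posv (e t)")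
      case True
      then show ?thesis using srefl_pos[of "e t" r] root[OF t] left_desc first by (cases "e t = alpha r") auto
    next
      case False
      then show ?thesis using cases[OF t] last by auto
    qed
  next
    fix t q u
    assume t: "t \<in> set (r # a)" and q: "q \<in> set (r # a)" and eq: "srefl r (e t) = nrho (r # a) q"
      and u: "u \<in> set (r # a)" "posv (srefl r (e u))"
    have u_pos: "posv (e u)" using pos u by blast
    show "srefl r (e u) q = 0"
    proof (cases "q = r")
      case True
      then have "e t = alpha r"
        using eq first left_desc by (metis srefl_invol)
      then have "0 \<le> euler (a @ [r]) (alpha r) (e u)"
        using clusterD(3)[OF cl, of t u] t u u_pos by auto
      also have "\<dots> = - srefl r (e u) r"
        using euler_alpha_last_left[OF left_desc(4), of "e u"] root[OF u(1)] by (simp add: srefl_def)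
      finally show ?thesis using u(2) True by (auto simp: posv_def intro: antisym)
    next
      case False
      then have "e t = nrho a q"
        using eq q last left_desc by (metis set_ConsD srefl_invol)
      then have "e u q = 0"
        using clusterD(2)[OF cl, of t q u] t u u_pos q False last by auto
      then show ?thesis using False by simp
    qed
  next
    fix t u
    assume t: "t \<in> set (r # a)" "posv (srefl r (e t))" and u: "u \<in> set (r # a)" "posv (srefl r (e u))"
    then have "0 \<le> euler (a @ [r]) (e t) (e u)"
      using clusterD(3)[OF cl, of t u] pos by auto
    then show "0 \<le> euler (r # a) (srefl r (e t)) (srefl r (e u))"
      using euler_rotate[OF left_desc(1) root(2)[OF t(1)] root(2)[OF u(1)]] by simp
  qed
next
  case (not_desc r a x)
  define e where "e = ray a x"
  have ray: "ray (r # a) x r = alpha r" "\<And>t. t \<in> set a \<Longrightarrow> ray (r # a) x t = srefl r (e t)"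
    using not_desc by (auto simp: e_def)
  have cl: "cluster a e" using not_desc by (simp add: e_def)
  have root: "is_root (e t)" "supported (set (r # a)) (e t)" "e t r = 0" if "t \<in> set a" for t
    using ray_root[OF not_desc(4,5) that] supported_mono[of "set a" "e t" "set (r # a)"] not_desc
    by (auto simp: e_def supported_def)
  have pos: "posv (srefl r (e t)) \<longleftrightarrow> posv (e t)" if "t \<in> set a" for t
  proof (rule posv_srefl_iff)
    have "alpha r r \<noteq> e t r" "- alpha r r \<noteq> e t r" using root(3)[OF that] by (auto simp: alpha_def)
    then show "e t \<noteq> alpha r" "e t \<noteq> (\<lambda>t. - alpha r t)" by metis+
  qed (use root that not_desc in auto)
  have nrho: "nrho (r # a) q = srefl r (nrho a q)" if "q \<in> set a" for q
    using that not_desc nrho_Cons[of q r a] by auto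
  have not_first: "srefl r (e t) \<noteq> nrho (r # a) r" if "t \<in> set a" for t
  proof
    assume "srefl r (e t) = nrho (r # a) r"
    then have "srefl r (e t) = srefl r (alpha r)" using not_desc by (simp add: nrho_def)
    then have "e t = alpha r" using not_desc by (metis srefl_invol)
    then show False using root(3)[OF that] by (simp add: alpha_def)
  qed
  have neg: "e t = nrho a q \<and> q \<in> set a"
    if "t \<in> set a" "q \<in> set (r # a)" "srefl r (e t) = nrho (r # a) q" for t q
    using that not_first[of t] nrho[of q] not_desc by (metis set_ConsD srefl_invol)
  show ?case
    unfolding cluster_def
  proof (intro conjI ballI impI)
    fix t assume "t \<in> set (r # a)"
    then show "posv (ray (r # a) x t) \<or> (\<exists>q\<in>set (r # a). ray (r # a) x t = nrho (r # a) q)"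
      using clusterD(1)[OF cl, of t] pos[of t] nrho ray by (cases "t = r") auto
  next
    fix t q u
    assume t: "t \<in> set (r # a)" and q: "q \<in> set (r # a)" and eq: "ray (r # a) x t = nrho (r # a) q"
      and u: "u \<in> set (r # a)" "posv (ray (r # a) x u)"
    have "t \<noteq> r" using eq nrho_not_posv[OF not_desc(1) q] ray(1) posv_alpha by metis
    then have t': "t \<in> set a" using t by simp
    then have q': "e t = nrho a q" "q \<in> set a" using neg[of t q] q eq ray by auto
    then have "q \<noteq> r" using not_desc by auto
    show "ray (r # a) x u q = 0"
    proof (cases "u = r")
      case True
      then show ?thesis using ray \<open>q \<noteq> r\<close> by (simp add: alpha_def)
    next
      case False
      then have "u \<in> set a" using u by simp
      then show ?thesis
        using clusterD(2)[OF cl t' q'(2,1), of u] u pos ray \<open>q \<noteq> r\<close> by simp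
    qed
  next
    fix t u
    assume t: "t \<in> set (r # a)" "posv (ray (r # a) x t)" and u: "u \<in> set (r # a)" "posv (ray (r # a) x u)"
    show "0 \<le> euler (r # a) (ray (r # a) x t) (ray (r # a) x u)"
    proof (cases "t = r")
      case True
      then show ?thesis
        using u euler_alpha_first[OF not_desc(1)] ray by (simp add: posv_def del: euler.simps)
    next
      case False
      then have t': "t \<in> set a" using t by simp
      show ?thesis
      proof (cases "u = r")
        case True
        have "euler (r # a) (srefl r (e t)) (srefl r (srefl r (alpha r))) =
            euler (a @ [r]) (e t) (srefl r (alpha r))"
          using root(2)[OF t'] not_desc(1,2)
          by (intro euler_rotate supported_srefl supported_alpha) auto
        also have "\<dots> = euler a (e t) (\<lambda>t. 0)"
          using root(3)[OF t'] not_desc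
          by (intro euler_restrict) (auto simp: inj_word_def alpha_def)
        also have "\<dots> = 0" by (induction a) auto
        finally show ?thesis
          using True t' ray not_desc by (simp del: euler.simps ray.simps srefl_alpha)
      next
        case False
        then have u': "u \<in> set a" using u by simp
        have "euler (r # a) (srefl r (e t)) (srefl r (e u)) = euler (a @ [r]) (e t) (e u)"
          using euler_rotate[OF not_desc(1) root(2)[OF t'] root(2)[OF u']] .
        also have "\<dots> = euler a (e t) (e u)"
          using root(3)[OF t'] not_desc by (intro euler_restrict) (auto simp: inj_word_def)
        also have "\<dots> \<ge> 0"
          using clusterD(3)[OF cl t' u'] t u t' u' pos ray by simp
        finally show ?thesis using ray t' u' by (simp del: euler.simps)
      qed
    qed
  qed
qed

lemma ray_last_nonneg:
  assumes a: "inj_word (a @ [s])" and x: "x \<in> carrier G" and nd: "\<not> left_desc s x"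
    and t: "t \<in> set (a @ [s])"
  shows "0 \<le> ray (a @ [s]) x t s"
proof (cases "posv (ray (a @ [s]) x t)")
  case False
  note cl = ray_cluster[OF a x]
  obtain q where q: "q \<in> set (a @ [s])" "ray (a @ [s]) x t = nrho (a @ [s]) q"
    using clusterD(1)[OF cl t] False by blast
  then have "q \<in> set a" using cluster_last_negative[OF a x cl t] nd by auto
  then have "rho (a @ [s]) q s = 0"
    using rho_root[of a q] a by (simp add: rho_snoc supported_def inj_word_snoc)
  then show ?thesis using q by (simp add: nrho_def)
qed (simp add: posv_def)

text \<open>
  Both alternatives are preserved when the first letter moves to the end, since its reflection
  preserves the invariant form and carries one Euler form to the other. The wall \<open>alpha r\<close> of a
  deleted letter \<open>r\<close> falls under \<open>srt_fixes_or_inversion\<close>.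
\<close>

lemma wall_simple_or_inversion:
  assumes "inj_word a" "x \<in> carrier G"
  shows "t \<in> set a \<Longrightarrow> (\<exists>q\<in>S. act (inv (proj a x)) (wall a x t) = alpha q) \<or>
    (\<exists>\<delta>\<in>Inv (proj a x). euler a (wall a x t) \<delta> = 0 \<and> form (wall a x t) \<delta> < 0)"
  using assms
proof (induction rule: rotation_induct)
  case (left_desc r a x)
  let ?p = "proj (a @ [r]) (r \<otimes> x)" and ?w = "wall (a @ [r]) (r \<otimes> x) t"
  have p: "?p \<in> carrier G" "srt (a @ [r]) ?p" "\<not> left_desc r ?p"
    using proj_carrier[OF left_desc(4,6)] proj_sortable[OF left_desc(4,6)]
      le_desc[OF proj_le[OF left_desc(4,6)] proj_carrier[OF left_desc(4,6)] left_desc(6,2)] left_desc(8) by blast+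
  have w: "supported (set (r # a)) ?w"
    using wall_root[OF left_desc(4,6), of t] left_desc by auto
  have act: "act (inv (r \<otimes> ?p)) (srefl r ?w) = act (inv ?p) ?w"
    using p left_desc by (simp add: inv_mult_group S_inv S_carrier act_mult act_S)
  have eq: "proj (r # a) x = r \<otimes> ?p" "wall (r # a) x t = srefl r ?w" using left_desc by auto
  consider q where "q \<in> S" "act (inv ?p) ?w = alpha q"
    | \<delta> where "\<delta> \<in> Inv ?p" "euler (a @ [r]) ?w \<delta> = 0" "form ?w \<delta> < 0"
    using left_desc by auto
  then show ?case
  proof cases
    case 1
    then show ?thesis unfolding eq act by blast
  next
    case (2 \<delta>)
    have "supported (set (r # a)) \<delta>"
      using srt_Inv_supported[OF p(2) left_desc(4) 2(1)] by auto
    then have "euler (r # a) (srefl r ?w) (srefl r \<delta>) = 0"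
      using euler_rotate[OF left_desc(1) w] 2 by simp
    moreover have "form (srefl r ?w) (srefl r \<delta>) < 0" using 2 left_desc by (simp add: form_refl)
    moreover have "srefl r \<delta> \<in> Inv (r \<otimes> ?p)" using Inv_S_mult[of r ?p] left_desc p 2 by simp
    ultimately show ?thesis unfolding eq by blast
  qed
next
  case (not_desc r a x)
  let ?p = "proj a x"
  have p: "srt a ?p" using not_desc proj_sortable by blast
  have \<delta>: "\<delta> r = 0" if "\<delta> \<in> Inv ?p" for \<delta>
    using srt_Inv_supported[OF p not_desc(4) that] not_desc by (simp add: supported_def)
  show ?case
  proof (cases "t = r")
    case True
    then show ?thesis
      using srt_fixes_or_inversion[OF p not_desc(4), of r] not_desc(2,3,6) \<delta> euler_alpha_first[OF not_desc(1)]
      by (auto simp: form_alpha simp del: euler.simps)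
  next
    case False
    then have "euler (r # a) (wall a x t) \<delta> = euler a (wall a x t) \<delta>" if "\<delta> \<in> Inv ?p" for \<delta>
      using \<delta>[OF that] by simp
    then show ?thesis
      using not_desc False by (auto simp del: euler.simps)
  qed
qed simp

text \<open>
  Applying \<open>inv x\<close> to the expansion of \<open>alpha r\<close> in the walls writes the simple root \<open>alpha t\<close> as a
  nonnegative combination of positive roots. A simple root is not such a combination of other
  positive roots, so \<open>alpha t\<close> occurs among them, and \<open>alpha r\<close> is a wall.
  An inversion \<open>\<delta>\<close> as in \<open>wall_simple_or_inversion\<close> cannot exist for this wall, because the two forms
  differ on \<open>alpha r\<close> and \<open>\<delta>\<close> by the coordinate of \<open>\<delta>\<close> at \<open>r\<close>.
\<close>

theorem proj_last_cover:
  assumes a: "inj_word (a @ [r])" and x: "x \<in> carrier G" and nd: "\<not> left_desc r x"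
    and t: "t \<in> S" "act (inv x) (alpha r) = alpha t"
  shows "\<exists>q\<in>S. act (inv (proj (a @ [r]) x)) (alpha r) = alpha q"
proof -
  let ?a = "a @ [r]"
  define c where "c u = ray ?a x u r" for u
  define g where "g u = act (inv x) (wall ?a x u)" for u
  have c: "0 \<le> c u" if "u \<in> set ?a" for u
    using ray_last_nonneg[OF a x nd that] by (simp add: c_def)
  have g: "posv (g u)" "is_root (g u)" if "u \<in> set ?a" for u
    using wall_positive[OF a x that] wall_root[OF a x that] x by (auto simp: g_def root_act)
  have sum: "alpha t p = (\<Sum>u\<in>set ?a. c u * g u p)" for p
    using last_alpha_expansion[OF a x, of p] t by (simp add: c_def g_def)
  have nonneg: "0 \<le> c u * g u p" if "u \<in> set ?a" for u p
    using c g that by (simp add: posv_def)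
  have "(\<Sum>u\<in>set ?a. c u * g u t) \<noteq> 0" using sum[of t] by (simp add: alpha_def)
  then obtain u where u: "u \<in> set ?a" "c u * g u t \<noteq> 0"
    by (meson sum.neutral)
  have "g u p = 0" if "p \<noteq> t" for p
  proof -
    have "(\<Sum>u\<in>set ?a. c u * g u p) = 0" using sum[of p] that by (simp add: alpha_def)
    then have "\<forall>u\<in>set ?a. c u * g u p = 0"
      using nonneg by (subst (asm) sum_nonneg_eq_0_iff) auto
    then show ?thesis using u by auto
  qed
  then have "g u = alpha t" using root_single_coordinate g u t by blast
  then have "wall ?a x u = alpha r" using t x unfolding g_def by (metis act_act_inv)
  moreover have "euler ?a (alpha r) \<delta> \<noteq> 0 \<or> \<not> form (alpha r) \<delta> < 0"
    if \<delta>: "\<delta> \<in> Inv (proj ?a x)" for \<delta>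
  proof -
    have "supported (set ?a) \<delta>"
      using srt_Inv_supported[OF proj_sortable[OF a x] a \<delta>] .
    then have "euler ?a (alpha r) \<delta> = form (alpha r) \<delta> - \<delta> r"
      using euler_alpha_last_left[OF a] a by (simp add: form_alpha inj_word_snoc)
    moreover have "0 \<le> \<delta> r" using \<delta> by (simp add: Inv_def posv_def)
    ultimately show ?thesis by linarith
  qed
  ultimately show ?thesis using wall_simple_or_inversion[OF a x u(1)] by metis
qed


section \<open>The projection onto sortable elements\<close>

text \<open>
  The additional letter \<open>p\<close> is deleted again as soon as it comes first, since it is no left descent
  of a product of other letters.
\<close>

lemma srt_insert:
  "srt (a1 @ a2) z \<Longrightarrow> inj_word (a1 @ p # a2) \<Longrightarrow> srt (a1 @ p # a2) z"
proof (induction "a1 @ a2" z arbitrary: a1 a2 rule: srt.induct)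
  case srt_Nil
  then show ?case
    using srt.srt_drop[OF srt.srt_Nil] srt_not_desc[OF srt.srt_Nil] by (auto simp: inj_word_def)
next
  case (srt_drop a u r)
  show ?case
  proof (cases a1)
    case Nil
    then have "srt a2 u" using srt.srt_drop[OF srt_drop.hyps(1,3)] srt_drop.hyps(4) by simp
    then show ?thesis
      using Nil srt_drop.prems srt_not_desc[of a2 u p] by (auto simp: inj_word_Cons intro: srt.srt_drop)
  next
    case (Cons q b)
    then have "q = r" "a = b @ a2" using srt_drop.hyps(4) by auto
    then show ?thesis
      using Cons srt_drop by (auto simp: inj_word_Cons intro!: srt.srt_drop)
  qed
next
  case (srt_rotate a r u)
  show ?case
  proof (cases a1)
    case Nil
    then have "srt a2 (r \<otimes> u)" using srt.srt_rotate[OF srt_rotate.hyps(1,3)] srt_rotate.hyps(4) by simp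
    then show ?thesis
      using Nil srt_rotate.prems srt_not_desc[of a2 "r \<otimes> u" p]
      by (auto simp: inj_word_Cons intro: srt.srt_drop)
  next
    case (Cons q b)
    then have q: "q = r" "a @ [r] = b @ (a2 @ [r])" using srt_rotate.hyps(4) by auto
    have "inj_word (b @ p # (a2 @ [r]))"
      using srt_rotate.prems Cons q by (auto simp: inj_word_def)
    then have "srt (b @ p # (a2 @ [r])) u" using srt_rotate.hyps(2) q by blast
    then show ?thesis
      using Cons q srt_rotate.hyps(3) srt.srt_rotate[of "b @ p # a2" r u] by simp
  qed
qed

lemma srt_snoc: "srt a z \<Longrightarrow> inj_word (a @ [p]) \<Longrightarrow> srt (a @ [p]) z"
  using srt_insert[of a "[]" z p] by simp

text \<open>
  The pair of the length of the word and the length of \<open>y\<close> decreases lexicographically. In the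
  critical case \<open>x < r \<otimes> x\<close> is the cover at which \<open>r\<close> becomes a left descent between \<open>z\<close> and \<open>y\<close>, and
  \<open>z \<le> v \<le> r \<otimes> v\<close> for \<open>v = proj (b @ [r]) x\<close>, where \<open>r \<otimes> v\<close> is sortable, below \<open>y\<close>, and has the left
  descent \<open>r\<close>.
\<close>

theorem proj_greatest:
  assumes "srt a z" "inj_word a" "y \<in> carrier G" "le z y"
  shows "le z (proj a y)"
  using assms
proof (induction "(length a, len y)" arbitrary: a y z
    rule: wf_induct_rule[OF wf_lex_prod[OF wf_less_than wf_less_than]])
  case 1
  have IH: "le z' (proj a' y')"
    if "length a' < length a \<or> length a' = length a \<and> len y' < len y"
      "srt a' z'" "inj_word a'" "y' \<in> carrier G" "le z' y'" for a' y' z'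
    using 1(1)[of a' y' z'] that by auto
  have z: "z \<in> carrier G" using 1(2-) srt_carrier by blast
  from 1(2) show ?case
  proof cases
    case srt_Nil
    then show ?thesis by simp
  next
    case (srt_drop b r)
    have r: "r \<in> S" "inj_word b" "inj_word (b @ [r])"
      using 1(3) srt_drop by (auto simp: inj_word_Cons inj_word_snoc)
    show ?thesis
    proof (cases "left_desc r y")
      case False
      then show ?thesis using IH[of b y z] srt_drop r 1(2-) by simp
    next
      case True
      obtain x t where x: "x \<in> carrier G" "le z x" "\<not> left_desc r x" "le (r \<otimes> x) y"
        "t \<in> S" "act (inv x) (alpha r) = alpha t"
        using obtain_descent_cover[OF z 1(4,5) r(1) srt_drop(3) True] .
      have rx: "r \<otimes> x \<in> carrier G" "r \<otimes> y \<in> carrier G" using r x 1(2-) by (auto simp: S_carrier)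
      have "len x < len y"
        using le_len[OF x(4) rx(1) 1(4)] len_not_desc[OF r(1) x(1,3)] by simp
      then have zv: "le z (proj (b @ [r]) x)"
        using srt_snoc srt_drop r x by (intro IH) auto
      define v where "v = proj (b @ [r]) x"
      have v: "v \<in> carrier G" "srt (b @ [r]) v" "le v x"
        using proj_carrier proj_sortable proj_le r x by (auto simp: v_def)
      then have ndv: "\<not> left_desc r v" using le_desc x r by blast
      obtain q where "q \<in> S" "act (inv v) (alpha r) = alpha q"
        using proj_last_cover[OF r(3) x(1,3,5,6)] by (auto simp: v_def)
      then have vrv: "le v (r \<otimes> v)"
        using le_mult_simple[OF r(1) v(1)] by (auto simp: le_def)
      have "le v (r \<otimes> y)"
      proof -
        have "le (r \<otimes> v) (r \<otimes> x)"
          using le_S_mult_iff[OF r(1) v(1) x(1) ndv x(3)] v(3) by simp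
        then have "le (r \<otimes> v) (r \<otimes> (r \<otimes> y))" using le_trans[OF _ x(4)] 1(4) r by simp
        then show ?thesis
          using le_S_mult_iff[OF r(1) v(1) rx(2) ndv] desc_mult[OF r(1) 1(4)] True by simp
      qed
      then have "le v (proj (b @ [r]) (r \<otimes> y))"
        using v r rx True srt_drop(1) by (intro IH) (auto simp: left_desc_def)
      moreover have "\<not> left_desc r (proj (b @ [r]) (r \<otimes> y))"
        using le_desc[OF proj_le[OF r(3) rx(2)] proj_carrier[OF r(3) rx(2)] rx(2) r(1)]
          desc_mult[OF r(1) 1(4)] True by blast
      ultimately have "le (r \<otimes> v) (r \<otimes> proj (b @ [r]) (r \<otimes> y))"
        using le_S_mult_iff[OF r(1) v(1) proj_carrier[OF r(3) rx(2)] ndv] by simp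
      then have "le z (r \<otimes> proj (b @ [r]) (r \<otimes> y))"
        using zv vrv le_trans unfolding v_def[symmetric] by blast
      then show ?thesis using True srt_drop(1) by simp
    qed
  next
    case (srt_rotate b r u)
    have r: "r \<in> S" "inj_word (b @ [r])"
      using 1(3) srt_rotate by (auto simp: inj_word_Cons inj_word_snoc)
    have u: "u \<in> carrier G" using srt_rotate r srt_carrier by blast
    have ry: "r \<otimes> y \<in> carrier G" using r 1(2-) by (simp add: S_carrier)
    have "left_desc r z" using srt_rotate desc_mult r u by simp
    then have dy: "left_desc r y" using le_desc[OF 1(5) z 1(4) r(1)] by blast
    then have ndy: "\<not> left_desc r (r \<otimes> y)" using desc_mult r 1(2-) by simp
    have "le (r \<otimes> u) (r \<otimes> (r \<otimes> y))" using 1(2-) srt_rotate r by simp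
    then have "le u (r \<otimes> y)" using le_S_mult_iff[OF r(1) u ry srt_rotate(4) ndy] by simp
    then have "le u (proj (b @ [r]) (r \<otimes> y))"
      using srt_rotate r ry dy by (intro IH) (auto simp: left_desc_def)
    moreover have "\<not> left_desc r (proj (b @ [r]) (r \<otimes> y))"
      using le_desc[OF proj_le[OF r(2) ry] proj_carrier[OF r(2) ry] ry r(1)] ndy by blast
    ultimately show ?thesis
      using le_S_mult_iff[OF r(1) u proj_carrier[OF r(2) ry] srt_rotate(4)] dy srt_rotate by simp
  qed
qed

lemma proj_fixes: "srt a u \<Longrightarrow> inj_word a \<Longrightarrow> proj a u = u"
  by (meson le_antisym le_refl proj_carrier proj_greatest proj_le srt_carrier)

lemma proj_mono:
  "inj_word a \<Longrightarrow> x \<in> carrier G \<Longrightarrow> y \<in> carrier G \<Longrightarrow> le x y \<Longrightarrow> le (proj a x) (proj a y)"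
  by (meson le_trans proj_greatest proj_le proj_sortable)

text \<open>
  A sortable element for \<open>a\<close> is sortable for \<open>a @ [p]\<close>, so \<open>proj a x\<close> is below \<open>proj (a @ [p]) x\<close>,
  hence below \<open>y\<close>, and vice versa.
\<close>

lemma proj_eq_drop_last:
  assumes "inj_word (a @ [p])" "x \<in> carrier G" "y \<in> carrier G" "proj (a @ [p]) x = proj (a @ [p]) y"
  shows "proj a x = proj a y"
proof -
  have a: "inj_word a" using assms by (simp add: inj_word_snoc)
  have *: "le (proj a x) (proj a y)"
    if "x \<in> carrier G" "y \<in> carrier G" "proj (a @ [p]) x = proj (a @ [p]) y" for x y
  proof -
    have "srt (a @ [p]) (proj a x)" using srt_snoc proj_sortable a assms that by blast
    then have "le (proj a x) (proj (a @ [p]) x)" using proj_greatest proj_le a assms that by blast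
    then have "le (proj a x) y" using that proj_le[OF assms(1)] le_trans by metis
    then show ?thesis using proj_greatest proj_sortable a that by blast
  qed
  show ?thesis using * assms a proj_carrier le_antisym by metis
qed


section \<open>Multiplication by the longest element\<close>

lemma longest_desc: "longest_element G S w \<Longrightarrow> s \<in> S \<Longrightarrow> left_desc s w"
  using len_S_mult_neq[of s w] S_carrier[of s]
  by (auto simp: longest_element_def left_desc_def less_le)

lemma act_supported_sum:
  assumes "w \<in> carrier G" "is_root v"
  shows "act w v = (\<lambda>t. \<Sum>s\<in>S. v s * act w (alpha s) t)"
proof -
  have "v = (\<lambda>t. \<Sum>s\<in>S. v s * alpha s t)"
    using finite_S root_outside[OF assms(2)] by (auto simp: alpha_def if_distrib cong: if_cong)
  then show ?thesis using act_sum[OF assms(1), where I = S and c = v and x = alpha] by simp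
qed

lemma longest_negates:
  assumes w: "longest_element G S w" and v: "is_root v" "posv v"
  shows "negv (act (inv w) v)"
proof -
  have c: "w \<in> carrier G" using w by (simp add: longest_element_def)
  have "act (inv w) (alpha s) t \<le> 0" if "s \<in> S" for s t
    using longest_desc[OF w that] desc_iff that c by (auto simp: negv_def)
  then show ?thesis
    using v(2) c unfolding act_supported_sum[OF inv_closed[OF c] v(1)] negv_def posv_def
    by (intro allI sum_nonpos mult_nonneg_nonpos) auto
qed

lemma longest_involution:
  assumes w: "longest_element G S w"
  shows "w \<otimes> w = \<one>"
proof -
  have c: "w \<in> carrier G" using w by (simp add: longest_element_def)
  have w': "longest_element G S (inv w)" using w by (auto simp: longest_element_def)
  have "Inv w = Inv (inv w)"
    using longest_negates[OF w] longest_negates[OF w'] by (auto simp: Inv_def)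
  then have "w = inv w" using le_antisym[of w "inv w"] c by (simp add: le_def)
  then show ?thesis using c by (metis l_inv)
qed

lemma Inv_mult_longest:
  assumes w: "longest_element G S w" and x: "x \<in> carrier G" and \<beta>: "is_root \<beta>" "posv \<beta>"
  shows "\<beta> \<in> Inv (x \<otimes> w) \<longleftrightarrow> \<beta> \<notin> Inv x"
proof -
  have c: "w \<in> carrier G" using w by (simp add: longest_element_def)
  let ?\<gamma> = "act (inv x) \<beta>"
  have \<gamma>: "is_root ?\<gamma>" using \<beta> x by (simp add: root_act)
  have neg: "negv (act (inv w) v)" if "is_root v" "posv v" for v
    using longest_negates[OF w that] .
  have "negv (act (inv w) ?\<gamma>) \<longleftrightarrow> posv ?\<gamma>"
  proof
    assume n: "negv (act (inv w) ?\<gamma>)"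
    show "posv ?\<gamma>"
    proof (rule ccontr)
      assume "\<not> posv ?\<gamma>"
      then have "negv (act (inv w) (\<lambda>t. - ?\<gamma> t))"
        using neg[OF root_uminus[OF \<gamma>]] \<gamma> root_neg_iff by (simp add: posv_uminus)
      then have "posv (act (inv w) ?\<gamma>)" using c by (simp add: act_uminus negv_uminus)
      then show False using n root_neg_iff[of "act (inv w) ?\<gamma>"] \<gamma> c root_act by blast
    qed
  qed (use neg \<gamma> in blast)
  then show ?thesis
    using \<beta> x c root_neg_iff[OF \<gamma>] by (simp add: Inv_def inv_mult_group act_mult)
qed

lemma desc_mult_longest:
  assumes "longest_element G S w" "x \<in> carrier G" "s \<in> S"
  shows "left_desc s (x \<otimes> w) \<longleftrightarrow> \<not> left_desc s x"
  using assms Inv_mult_longest[of w x "alpha s"] by (simp add: desc_Inv longest_element_def)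

lemma le_mult_longest:
  assumes "longest_element G S w" "x \<in> carrier G" "y \<in> carrier G" "le x y"
  shows "le (y \<otimes> w) (x \<otimes> w)"
  unfolding le_def
proof
  fix \<beta> assume \<beta>: "\<beta> \<in> Inv (y \<otimes> w)"
  then have "is_root \<beta>" "posv \<beta>" by (auto simp: Inv_def)
  then show "\<beta> \<in> Inv (x \<otimes> w)"
    using \<beta> assms Inv_mult_longest[of w x \<beta>] Inv_mult_longest[of w y \<beta>] by (auto simp: le_def)
qed

lemma srt_single: "inj_word a \<Longrightarrow> p \<in> set a \<Longrightarrow> srt a p"
proof (induction a rule: rev_induct)
  case (snoc q a)
  show ?case
  proof (cases "p = q")
    case True
    have q: "q \<in> S" "inj_word a" "inj_word [q]" using snoc by (auto simp: inj_word_def)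
    have nd: "\<not> left_desc r q" if "r \<in> S" "r \<noteq> q" for r
    proof -
      have "\<not> left_desc q \<one>" using q by (simp add: left_desc_def)
      then have "srt ([] @ [q]) \<one>" by (auto intro: srt.intros)
      then have "srt [q] (q \<otimes> \<one>)" using \<open>\<not> left_desc q \<one>\<close> by (intro srt_rotate) auto
      then show ?thesis using srt_not_desc[of "[q]" q r] q that by (simp add: S_carrier)
    qed
    have "\<not> left_desc q \<one>" using q by (simp add: left_desc_def)
    then have "srt [q] (q \<otimes> \<one>)" by (intro srt_rotate srt_drop) (auto intro: srt.intros)
    then have "srt [q] q" using q by (simp add: S_carrier)
    moreover have "srt (b @ [q]) q" if "set b \<subseteq> set a" "srt [q] q" for b
      using that
    proof (induction b)
      case (Cons r b)
      then have "r \<in> S" "r \<noteq> q" using snoc.prems by (auto simp: inj_word_def)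
      then show ?case using Cons nd by (auto intro: srt_drop)
    qed simp
    ultimately show ?thesis using True by simp
  next
    case False
    then show ?thesis using snoc srt_snoc by (auto simp: inj_word_snoc)
  qed
qed simp

text \<open>
  By induction on the length of \<open>a\<close> and downward on the length of \<open>x\<close>, looking at the last letter
  \<open>p\<close> of \<open>a\<close>, which is the first letter of \<open>rev a\<close>.
\<close>

theorem proj_mult_longest:
  assumes w: "longest_element G S w" and "inj_word a" "x \<in> carrier G" "y \<in> carrier G"
    and "proj a x = proj a y"
  shows "proj (rev a) (x \<otimes> w) = proj (rev a) (y \<otimes> w)"
  using assms(2-)
proof (induction "(length a, len w - len x)" arbitrary: a x y
    rule: wf_induct_rule[OF wf_lex_prod[OF wf_less_than wf_less_than]])
  case 1
  have IH: "proj (rev a') (x' \<otimes> w) = proj (rev a') (y' \<otimes> w)"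
    if "length a' < length a \<or> length a' = length a \<and> len w - len x' < len w - len x"
      "inj_word a'" "x' \<in> carrier G" "y' \<in> carrier G" "proj a' x' = proj a' y'" for a' x' y'
    using 1(1)[of a' x' y'] that by auto
  have wc: "w \<in> carrier G" using w by (simp add: longest_element_def)
  show ?case
  proof (cases a rule: rev_cases)
    case Nil
    then show ?thesis by simp
  next
    case (snoc b p)
    have p: "p \<in> S" "inj_word b" "inj_word (p # b)" "inj_word (b @ [p])"
      using 1(2) snoc by (auto simp: inj_word_Cons inj_word_snoc)
    have mixed: "left_desc p v" if "u \<in> carrier G" "v \<in> carrier G" "proj a u = proj a v" "left_desc p u" for u v
    proof -
      have "Inv p = {alpha p}" using Inv_S_mult[of p "\<one>"] p by (simp add: S_carrier left_desc_def)
      then have "le p u" using that p desc_Inv by (auto simp: le_def)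
      then have "le p (proj a v)"
        using srt_single[OF 1(2), of p] snoc 1(2) that proj_greatest by fastforce
      then have "le p v" using proj_le[OF 1(2)] that le_trans by blast
      then show ?thesis using \<open>Inv p = {alpha p}\<close> p that desc_Inv by (auto simp: le_def)
    qed
    have dxy: "left_desc p x \<longleftrightarrow> left_desc p y"
      using mixed[OF 1(3,4,5)] mixed[OF 1(4,3) 1(5)[symmetric]] by blast
    show ?thesis
    proof (cases "left_desc p x")
      case True
      then have "proj (rev a) (x \<otimes> w) = proj (rev b) (x \<otimes> w)" "proj (rev a) (y \<otimes> w) = proj (rev b) (y \<otimes> w)"
        using snoc desc_mult_longest[OF w] 1(2-) p dxy by auto
      moreover have "proj b x = proj b y" using proj_eq_drop_last[OF p(4)] 1(2-) snoc by blast
      ultimately show ?thesis using IH[of b x y] snoc p 1(2-) by simp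
    next
      case False
      have px: "p \<otimes> x \<in> carrier G" "p \<otimes> y \<in> carrier G" using p 1(2-) by (auto simp: S_carrier)
      have "left_desc p (p \<otimes> x)" "left_desc p (p \<otimes> y)" using desc_mult p 1(2-) False dxy by auto
      then have "proj (p # b) (p \<otimes> x) = p \<otimes> proj a x" "proj (p # b) (p \<otimes> y) = p \<otimes> proj a y"
        using p 1(2-) snoc by auto
      then have "proj (p # b) (p \<otimes> x) = proj (p # b) (p \<otimes> y)" using 1(2-) by simp
      moreover have "len w - len (p \<otimes> x) < len w - len x"
      proof -
        have "len (p \<otimes> x) \<le> len w" using w px by (simp add: longest_element_def)
        then show ?thesis using len_not_desc p 1(2-) False by simp
      qed
      ultimately have "proj (rev b @ [p]) (p \<otimes> x \<otimes> w) = proj (rev b @ [p]) (p \<otimes> y \<otimes> w)"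
        using IH[of "p # b" "p \<otimes> x" "p \<otimes> y"] snoc p px by simp
      moreover have "left_desc p (x \<otimes> w)" "left_desc p (y \<otimes> w)"
        using desc_mult_longest[OF w] 1(2-) p False dxy by auto
      ultimately show ?thesis using snoc p 1(2-) wc by (simp add: m_assoc S_carrier)
    qed
  qed
qed

lemma proj_mult_longest_iff:
  assumes w: "longest_element G S w" and "inj_word a" "x \<in> carrier G" "y \<in> carrier G"
  shows "proj (rev a) (x \<otimes> w) = proj (rev a) (y \<otimes> w) \<longleftrightarrow> proj a x = proj a y"
proof -
  have c: "w \<in> carrier G" using w by (simp add: longest_element_def)
  have "x \<otimes> w \<otimes> w = x" "y \<otimes> w \<otimes> w = y"
    using longest_involution[OF w] c assms by (simp_all add: m_assoc)
  moreover have "inj_word (rev a)" using assms by (simp add: inj_word_def)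
  ultimately show ?thesis
    using proj_mult_longest[OF w, of a x y] proj_mult_longest[OF w, of "rev a" "x \<otimes> w" "y \<otimes> w"]
      assms c by auto
qed

section \<open>Independence of the Coxeter word\<close>

lemma orthogonal_fixed: "r \<in> S \<Longrightarrow> t \<in> S \<Longrightarrow> cartan t r = 0 \<Longrightarrow> srefl t (alpha r) = alpha r"
  by (auto simp: srefl_def pair_alpha)

lemma orthogonal_commute:
  assumes "r \<in> S" "t \<in> S" "cartan t r = 0"
  shows "r \<otimes> t = t \<otimes> r"
  using assms orthogonal_fixed by (intro conj_simple) (auto simp: act_S S_carrier)

lemma orthogonal_desc:
  assumes "r \<in> S" "t \<in> S" "cartan t r = 0" "w \<in> carrier G"
  shows "left_desc r (t \<otimes> w) \<longleftrightarrow> left_desc r w"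
  using assms orthogonal_fixed
  by (simp add: desc_iff S_carrier inv_mult_group S_inv act_mult act_S)

text \<open>
  The condition says that \<open>r\<close> and \<open>t\<close> commute.
\<close>

inductive swap :: "'a list \<Rightarrow> 'a list \<Rightarrow> bool" where
  "cartan r t = 0 \<Longrightarrow> swap (u @ r # t # v) (u @ t # r # v)"

text \<open>
  Once \<open>r\<close> and \<open>t\<close> come first, both are treated before any other letter, and as commuting letters
  they do not influence whether the other one is a left descent. If both are used, they meet again at
  the end of the word, with a shorter element.
\<close>

lemma srt_swap:
  assumes "srt (u @ r # t # v) w" "inj_word (u @ r # t # v)" "cartan r t = 0"
  shows "srt (u @ t # r # v) w"
  using assms(1,2)
proof (induction "(length (u @ r # t # v), len w)" arbitrary: u v w
    rule: wf_induct_rule[OF wf_lex_prod[OF wf_less_than wf_less_than]])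
  case 1
  have IH: "srt (u' @ t # r # v') w'"
    if "length (u' @ v') < length (u @ v) \<or> length (u' @ v') = length (u @ v) \<and> len w' < len w"
      "srt (u' @ r # t # v') w'" "inj_word (u' @ r # t # v')" for u' v' w'
    using 1(1)[of u' v' w'] that by auto
  have rt: "r \<in> S" "t \<in> S" "cartan t r = 0"
    using 1(3) assms(3) by (auto simp: inj_word_def cartan_sym)
  have desc_r: "left_desc r (t \<otimes> w) \<longleftrightarrow> left_desc r w" and desc_t: "left_desc t (r \<otimes> w) \<longleftrightarrow> left_desc t w"
    if "w \<in> carrier G" for w
    using rt assms(3) that orthogonal_desc by blast+
  have len_rise: "len w < len (q \<otimes> w)" if "q \<in> S" "w \<in> carrier G" "\<not> left_desc q w" for q w
    using len_not_desc that by simp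
  show ?case
  proof (cases u)
    case (Cons q u')
    from 1(2) show ?thesis
    proof cases
      case (srt_drop a p)
      then have "srt (u' @ t # r # v) w"
        using Cons 1(3) by (intro IH) (auto simp: inj_word_def)
      then show ?thesis using srt_drop Cons by (auto intro: srt.srt_drop)
    next
      case (srt_rotate a p x)
      then have a: "p = q" "a @ [q] = u' @ r # t # (v @ [q])" using Cons by auto
      have x: "x \<in> carrier G" "q \<in> S" "inj_word (u' @ r # t # (v @ [q]))"
        using srt_rotate srt_carrier[OF srt_rotate(3)] a 1(3) Cons by (auto simp: inj_word_def)
      have "srt (u' @ t # r # (v @ [q])) x"
        using srt_rotate a x Cons len_rise by (intro IH) auto
      then show ?thesis using srt_rotate a Cons srt.srt_rotate[of "u' @ t # r # v" q x] by simp
    qed (use Cons in auto)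
  next
    case Nil
    have inj: "r \<noteq> t" "inj_word (v @ [t])" "inj_word (v @ [r])" "inj_word (t # (v @ [r]))" "inj_word (v @ r # t # [])"
      using 1(3) Nil by (auto simp: inj_word_def)
    from 1(2) Nil consider (drop) "srt (t # v) w" "\<not> left_desc r w"
      | (rot) x where "w = r \<otimes> x" "srt (t # v @ [r]) x" "\<not> left_desc r x"
      by (auto elim: srt.cases)
    then show ?thesis
    proof cases
      case drop
      from drop(1) consider "srt v w" "\<not> left_desc t w"
        | y where "w = t \<otimes> y" "srt (v @ [t]) y" "\<not> left_desc t y"
        by (auto elim: srt.cases)
      then show ?thesis
      proof cases
        case 1
        then show ?thesis using Nil drop by (auto intro!: srt.srt_drop)
      next
        case (2 y)
        then have "\<not> left_desc r y" using drop desc_r srt_carrier inj by blast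
        then have "srt (r # v @ [t]) y" using 2 by (auto intro: srt.srt_drop)
        then show ?thesis using Nil 2 srt.srt_rotate[of "r # v" t y] by simp
      qed
    next
      case (rot x)
      have xc: "x \<in> carrier G" using rot inj srt_carrier by blast
      from rot(2) consider "srt (v @ [r]) x" "\<not> left_desc t x"
        | y where "x = t \<otimes> y" "srt (v @ [r, t]) y" "\<not> left_desc t y"
        by (auto elim: srt.cases)
      then show ?thesis
      proof cases
        case 1
        then show ?thesis using Nil rot desc_t xc by (auto intro!: srt.srt_drop srt.srt_rotate)
      next
        case (2 y)
        have y: "y \<in> carrier G" using 2 inj srt_carrier by simp
        have nd: "\<not> left_desc r y" "\<not> left_desc t (r \<otimes> y)" using 2 rot y desc_r desc_t by auto
        have "len y < len w" using rot 2 y rt xc len_rise by (metis less_trans)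
        then have "srt (v @ t # r # []) y" using 2 inj Nil by (intro IH) auto
        then have "srt (r # v @ [t]) (r \<otimes> y)" using nd srt.srt_rotate[of "v @ [t]" r y] by simp
        then have "srt (t # r # v) (t \<otimes> (r \<otimes> y))" using nd srt.srt_rotate[of "r # v" t "r \<otimes> y"] by simp
        moreover have "w = t \<otimes> (r \<otimes> y)"
          using rot 2 y rt orthogonal_commute[of r t] by (simp add: S_carrier flip: m_assoc)
        ultimately show ?thesis using Nil by simp
      qed
    qed
  qed
qed

lemma swap_inj_word: "swap a b \<Longrightarrow> inj_word a \<Longrightarrow> inj_word b"
  by (auto simp: inj_word_def elim!: swap.cases)

lemma swap_val: "swap a b \<Longrightarrow> inj_word a \<Longrightarrow> val a = val b"
proof (induction rule: swap.induct)
  case (1 r t u v)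
  then have rt: "r \<in> S" "t \<in> S" "u \<in> lists S" "v \<in> lists S"
    by (auto simp: inj_word_def in_lists_conv_set)
  then have "r \<otimes> t = t \<otimes> r" using 1 orthogonal_commute[of t r] by simp
  then show ?case
    using rt by (simp add: val_append S_carrier flip: m_assoc)
qed

lemma swaps_inj_word: "swap\<^sup>*\<^sup>* a b \<Longrightarrow> inj_word a \<Longrightarrow> inj_word b"
  by (induction rule: rtranclp_induct) (auto dest: swap_inj_word)

lemma swaps_srt: "swap\<^sup>*\<^sup>* a b \<Longrightarrow> inj_word a \<Longrightarrow> srt a w \<Longrightarrow> srt b w"
proof (induction rule: rtranclp_induct)
  case (step y z)
  then have "inj_word y" using swaps_inj_word by blast
  then show ?case using step srt_swap by (auto elim!: swap.cases)
qed

lemma swaps_val: "swap\<^sup>*\<^sup>* a b \<Longrightarrow> inj_word a \<Longrightarrow> val a = val b"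
proof (induction rule: rtranclp_induct)
  case (step y z)
  then show ?case using swaps_inj_word swap_val by metis
qed simp

lemma swaps_Cons: "swap\<^sup>*\<^sup>* a b \<Longrightarrow> swap\<^sup>*\<^sup>* (r # a) (r # b)"
proof (induction rule: rtranclp_induct)
  case (step y z)
  from step(2) have "swap (r # y) (r # z)"
    by cases (metis append_Cons swap.intros)
  then show ?case using step by simp
qed simp

lemma swaps_move: "(\<And>t. t \<in> set u \<Longrightarrow> cartan r t = 0) \<Longrightarrow> swap\<^sup>*\<^sup>* (r # u @ v) (u @ r # v)"
proof (induction u)
  case (Cons t u)
  have "swap ([] @ r # t # (u @ v)) ([] @ t # r # (u @ v))"
    using Cons by (intro swap.intros) simp
  moreover have "swap\<^sup>*\<^sup>* (t # (r # u @ v)) (t # (u @ r # v))"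
    using Cons by (intro swaps_Cons) simp
  ultimately show ?case by (simp add: converse_rtranclp_into_rtranclp)
qed simp

lemma word_act_outside: "t \<notin> set u \<Longrightarrow> word_act u v t = v t"
  by (induction u) auto

text \<open>
  If the first letter \<open>r\<close> of \<open>a\<close> is preceded in \<open>b\<close> by a letter \<open>t\<close> that does not commute with
  it, then \<open>b\<close> does not send \<open>alpha r\<close> to a negative root, as the coordinate at \<open>t\<close> shows, while
  \<open>a\<close> does.
\<close>

theorem equal_value_swaps:
  assumes "inj_word a" "inj_word b" "set a = set b" "val a = val b"
  shows "swap\<^sup>*\<^sup>* a b"
  using assms
proof (induction a arbitrary: b)
  case (Cons r a)
  then have r: "r \<in> S" "r \<notin> set a" "inj_word a" by (auto simp: inj_word_Cons)
  obtain u v where b: "b = u @ r # v" using Cons.prems by (metis list.set_intros(1) split_list)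
  have lists: "r # a \<in> lists S" "rev (r # a) \<in> lists S" "b \<in> lists S" "rev b \<in> lists S"
    using Cons.prems by (auto simp: inj_word_def in_lists_conv_set)
  have "act (inv (val (r # a))) (alpha r) = word_act (rev (r # a)) (alpha r)"
    using act_val[of "rev (r # a)"] val_rev lists by metis
  then have "act (inv (val b)) (alpha r) r = - 1"
    using r Cons.prems word_act_outside[of r "rev a"] by (simp add: alpha_def)
  moreover have "is_root (act (inv (val b)) (alpha r))"
    using lists r by (simp add: root_act)
  ultimately have neg: "negv (act (inv (val b)) (alpha r))"
    by (intro root_neg_coordinate[of _ r]) auto
  have comm: "cartan r t = 0" if "t \<in> set u" for t
  proof (rule ccontr)
    assume "cartan r t \<noteq> 0"
    then have "\<exists>t\<in>set u. cartan r t \<noteq> 0" using that by blast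
    then obtain u1 t u2 where u: "u = u1 @ t # u2" "cartan r t \<noteq> 0" "\<forall>q\<in>set u1. cartan r q = 0"
      using split_list_first_prop[of u "\<lambda>t. cartan r t \<noteq> 0"] by blast
    have t: "t \<in> S" "t \<noteq> r" "t \<notin> set u2" "t \<notin> set v" "set u1 \<subseteq> S"
      using Cons.prems b u by (auto simp: inj_word_def)
    have "word_act (rev u1) (alpha r) = alpha r"
      using u(3) t(5)
    proof (induction u1 rule: rev_induct)
      case (snoc q u1)
      then have "srefl q (word_act (rev u1) (alpha r)) = alpha r"
        using orthogonal_fixed[of r q] r cartan_sym by auto
      then show ?case by simp
    qed simp
    then have "act (inv (val b)) (alpha r) t = srefl t (alpha r) t"
      using act_val[OF lists(4)] val_rev[OF lists(3)] t b u
      by (simp add: word_act_outside)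
    also have "\<dots> = - cartan t r"
      using t r by (simp add: srefl_def pair_alpha) (simp add: alpha_def)
    also have "\<dots> > 0"
      using cartan_nonpos[of t r] t r u(2) cartan_sym[of t r] by simp
    finally show False using neg by (auto simp: negv_def not_less[symmetric])
  qed
  then have move: "swap\<^sup>*\<^sup>* (r # u @ v) b" using b swaps_move by blast
  have uv: "inj_word (r # u @ v)" using Cons.prems b by (auto simp: inj_word_def)
  then have "val (r # u @ v) = val b" using move swaps_val by blast
  then have "r \<otimes> val (u @ v) = r \<otimes> val a" using Cons.prems by simp
  moreover have "val (u @ v) \<in> carrier G" "val a \<in> carrier G"
    using uv r by (auto simp: inj_word_def in_lists_conv_set intro!: val_carrier)
  ultimately have "val a = val (u @ v)" using r by (simp add: S_carrier)
  moreover have "set a = set (u @ v)" "inj_word (u @ v)"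
    using Cons.prems b r uv by (auto simp: inj_word_def)
  ultimately have "swap\<^sup>*\<^sup>* a (u @ v)" using Cons.IH r by blast
  then show ?case using move swaps_Cons rtranclp_trans by metis
qed simp

lemma srt_value_cong:
  assumes "inj_word a" "inj_word b" "set a = set b" "val a = val b"
  shows "srt a w \<longleftrightarrow> srt b w"
  using equal_value_swaps[of a b] equal_value_swaps[of b a] swaps_srt assms by metis


section \<open>Sorting words are greedy\<close>

definition full_word :: "'a list \<Rightarrow> bool" where
  "full_word a \<longleftrightarrow> distinct a \<and> set a = S"

lemma full_inj_word: "full_word a \<Longrightarrow> inj_word a"
  by (simp add: full_word_def inj_word_def)

lemma full_word_rotate: "full_word (r # a) \<Longrightarrow> full_word (a @ [r])"
  by (auto simp: full_word_def)

text \<open>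
  Here skipped letters stay in the word, as they do in the half-infinite word. The recursion ends
  because some letter is a left descent of \<open>w\<close> unless \<open>w\<close> is trivial.
\<close>

lemma greedy_induct [consumes 2, case_names one left_desc not_desc]:
  assumes "full_word a" "w \<in> carrier G"
    and "\<And>a. full_word a \<Longrightarrow> P a \<one>"
    and "\<And>r a w. full_word (r # a) \<Longrightarrow> r \<in> S \<Longrightarrow> full_word (a @ [r]) \<Longrightarrow> w \<in> carrier G \<Longrightarrow>
      r \<otimes> w \<in> carrier G \<Longrightarrow> left_desc r w \<Longrightarrow> P (a @ [r]) (r \<otimes> w) \<Longrightarrow> P (r # a) w"
    and "\<And>r a w. full_word (r # a) \<Longrightarrow> r \<in> S \<Longrightarrow> full_word (a @ [r]) \<Longrightarrow> w \<in> carrier G \<Longrightarrow>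
      \<not> left_desc r w \<Longrightarrow> P (a @ [r]) w \<Longrightarrow> P (r # a) w"
  shows "P a w"
  using assms(1,2)
proof (induction "len w" arbitrary: a w rule: less_induct)
  case less
  show ?case
  proof (cases "w = \<one>")
    case False
    then obtain s where "s \<in> S" "left_desc s w" using obtain_desc less.prems by blast
    then obtain k where "k < length a" "left_desc (a ! k) w"
      using less.prems by (metis full_word_def in_set_conv_nth)
    then show ?thesis
      using less.prems(1)
    proof (induction k arbitrary: a)
      case 0
      then obtain r b where a: "a = r # b" by (cases a) auto
      then have r: "r \<in> S" "left_desc r w" using 0 by (auto simp: full_word_def)
      then have "r \<otimes> w \<in> carrier G" using less.prems by (simp add: S_carrier)
      moreover then have "P (b @ [r]) (r \<otimes> w)"
        using less.hyps[of "r \<otimes> w" "b @ [r]"] a 0 r full_word_rotate by (simp add: left_desc_def)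
      ultimately show ?case using assms(4) a 0 r full_word_rotate less.prems(2) by blast
    next
      case (Suc k)
      then obtain r b where a: "a = r # b" by (cases a) auto
      then have r: "r \<in> S" "full_word (b @ [r])" "full_word (r # b)"
        using Suc full_word_rotate by (auto simp: full_word_def)
      have "r \<otimes> w \<in> carrier G" using r less.prems by (simp add: S_carrier)
      show ?case
      proof (cases "left_desc r w")
        case True
        then have "P (b @ [r]) (r \<otimes> w)"
          using less.hyps[of "r \<otimes> w" "b @ [r]"] r \<open>r \<otimes> w \<in> carrier G\<close> by (simp add: left_desc_def)
        then show ?thesis
          using assms(4) a r True less.prems(2) \<open>r \<otimes> w \<in> carrier G\<close> by blast
      next
        case False
        have "P (b @ [r]) w"
          using Suc a r by (intro Suc.IH) (auto simp: nth_append)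
        then show ?thesis using assms(5) a r False less.prems(2) by blast
      qed
    qed
  qed (use assms(3) less.prems in blast)
qed

lemma letter_at_0 [simp]: "letter_at (r # a) 0 = r"
  by (simp add: letter_at_def)

lemma letter_at_Suc: "letter_at (r # a) (Suc p) = letter_at (a @ [r]) p"
proof -
  have "p mod Suc (length a) < Suc (length a)" by simp
  then consider "p mod Suc (length a) = length a" | "p mod Suc (length a) < length a" by linarith
  then show ?thesis
    by cases (simp_all add: letter_at_def mod_Suc nth_append)
qed

lemma reduced_subword_Suc:
  "reduced_subword G S (r # a) w (map Suc qs) \<longleftrightarrow> reduced_subword G S (a @ [r]) w qs"
  by (simp add: reduced_subword_def sorted_wrt_map letter_at_Suc o_def)

lemma reduced_word_Cons:
  assumes "r \<in> S" "w \<in> carrier G"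
  shows "reduced_word G S w (r # u) \<longleftrightarrow> left_desc r w \<and> reduced_word G S (r \<otimes> w) u"
proof
  assume red: "reduced_word G S w (r # u)"
  then have u: "u \<in> lists S" "w = r \<otimes> val u" "Suc (length u) = len w"
    by (auto simp: reduced_word_def)
  then have "len (val u) \<le> length u" using len_le by blast
  then have "left_desc r w" using u assms by (simp add: left_desc_def)
  moreover then have "len w = Suc (len (r \<otimes> w))" using len_desc assms by blast
  ultimately show "left_desc r w \<and> reduced_word G S (r \<otimes> w) u"
    using u assms by (simp add: reduced_word_def)
next
  assume red: "left_desc r w \<and> reduced_word G S (r \<otimes> w) u"
  then have u: "u \<in> lists S" "val u = r \<otimes> w" "length u = len (r \<otimes> w)" "len w = Suc (len (r \<otimes> w))"
    using len_desc assms by (auto simp: reduced_word_def)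
  then show "reduced_word G S w (r # u)"
    using assms by (simp add: reduced_word_def)
qed

lemma reduced_subword_0:
  assumes "r \<in> S" "w \<in> carrier G"
  shows "reduced_subword G S (r # a) w (0 # map Suc qs) \<longleftrightarrow>
    left_desc r w \<and> reduced_subword G S (a @ [r]) (r \<otimes> w) qs"
proof -
  have letters: "map (letter_at (r # a)) (0 # map Suc qs) = r # map (letter_at (a @ [r])) qs"
    by (simp add: letter_at_Suc)
  have sorted: "sorted_wrt (<) (0 # map Suc qs) \<longleftrightarrow> sorted_wrt (<) qs"
    by (auto simp: sorted_wrt_map)
  show ?thesis
    unfolding reduced_subword_def letters sorted reduced_word_Cons[OF assms] by blast
qed

lemma sorted_positions_cases:
  fixes ps :: "nat list"
  assumes "sorted_wrt (<) ps"
  obtains qs where "ps = map Suc qs" | qs where "ps = 0 # map Suc qs"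
proof -
  have *: "\<exists>qs. ps = map Suc qs" if "\<forall>p\<in>set ps. 0 < p" for ps
    by (rule exI[of _ "map (\<lambda>p. p - 1) ps"]) (use that in \<open>auto simp: map_idI\<close>)
  show ?thesis
  proof (cases "0 \<in> set ps")
    case True
    then obtain p rs where ps: "ps = p # rs" by (cases ps) auto
    then have "p = 0" using assms True by auto
    moreover have "\<forall>p\<in>set rs. 0 < p" using assms ps by auto
    ultimately show ?thesis using * that ps by blast
  next
    case False
    then show ?thesis using * that by (metis gr0I)
  qed
qed

lemma lexord_map_Suc:
  "(map Suc ps, map Suc qs) \<in> lexord less_than \<longleftrightarrow> (ps, qs) \<in> lexord less_than"
proof (induction ps arbitrary: qs)
  case Nil
  then show ?case by (cases qs) auto
next
  case (Cons p ps)
  then show ?case by (cases qs) auto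
qed

definition first_subword :: "'a list \<Rightarrow> 'a \<Rightarrow> nat list \<Rightarrow> bool" where
  "first_subword a w ps \<longleftrightarrow> reduced_subword G S a w ps \<and>
     (\<forall>qs. reduced_subword G S a w qs \<longrightarrow> qs = ps \<or> (ps, qs) \<in> lexord less_than)"

lemma first_subword_sorting_word:
  assumes "first_subword a w ps"
  shows "sorting_word G S a w = ps"
proof -
  have "qs = ps" if "first_subword a w qs" for qs
  proof (rule ccontr)
    assume "qs \<noteq> ps"
    then have "(ps, qs) \<in> lexord less_than" "(qs, ps) \<in> lexord less_than"
      using that assms by (auto simp: first_subword_def)
    then show False
      using lexord_asym[of less_than] by (metis asymD asym_less_than)
  qed
  then show ?thesis
    using assms unfolding sorting_word_def first_subword_def[symmetric] by (intro the_equality)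
qed

lemma first_subword_one: "first_subword a \<one> []"
  by (auto simp: first_subword_def reduced_subword_def reduced_word_def)

text \<open>
  A reduced word may start with any left descent, and using position \<open>0\<close> is lexicographically best.
\<close>

lemma first_subword_desc:
  assumes "r \<in> S" "w \<in> carrier G" "left_desc r w" "first_subword (a @ [r]) (r \<otimes> w) ps"
  shows "first_subword (r # a) w (0 # map Suc ps)"
  unfolding first_subword_def
proof (intro conjI allI impI)
  show "reduced_subword G S (r # a) w (0 # map Suc ps)"
    using assms reduced_subword_0 by (simp add: first_subword_def)
  fix qs assume qs: "reduced_subword G S (r # a) w qs"
  then have "sorted_wrt (<) qs" by (simp add: reduced_subword_def)
  then show "qs = 0 # map Suc ps \<or> (0 # map Suc ps, qs) \<in> lexord less_than"
  proof (cases rule: sorted_positions_cases)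
    case (1 rs)
    have "length qs = len w" using qs by (simp add: reduced_subword_def reduced_word_def)
    then have "rs \<noteq> []" using len_desc assms 1 by fastforce
    then show ?thesis using 1 by (cases rs) auto
  next
    case (2 rs)
    then have "reduced_subword G S (a @ [r]) (r \<otimes> w) rs"
      using qs reduced_subword_0 assms by simp
    then show ?thesis
      using assms(4) 2 lexord_map_Suc by (auto simp: first_subword_def)
  qed
qed

lemma first_subword_not_desc:
  assumes "r \<in> S" "w \<in> carrier G" "\<not> left_desc r w" "first_subword (a @ [r]) w ps"
  shows "first_subword (r # a) w (map Suc ps)"
  unfolding first_subword_def
proof (intro conjI allI impI)
  show "reduced_subword G S (r # a) w (map Suc ps)"
    using assms reduced_subword_Suc by (simp add: first_subword_def)
  fix qs assume qs: "reduced_subword G S (r # a) w qs"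
  then have "sorted_wrt (<) qs" by (simp add: reduced_subword_def)
  then show "qs = map Suc ps \<or> (map Suc ps, qs) \<in> lexord less_than"
  proof (cases rule: sorted_positions_cases)
    case (1 rs)
    then show ?thesis
      using assms(4) qs lexord_map_Suc reduced_subword_Suc by (auto simp: first_subword_def)
  next
    case (2 rs)
    then show ?thesis using qs reduced_subword_0 assms by simp
  qed
qed

lemma first_subword_exists:
  assumes "full_word a" "w \<in> carrier G"
  shows "\<exists>ps. first_subword a w ps"
  using assms
proof (induction rule: greedy_induct)
  case (left_desc r a w)
  then show ?case using first_subword_desc by blast
next
  case (not_desc r a w)
  then show ?case using first_subword_not_desc by blast
qed (use first_subword_one in blast)

definition positions :: "'a list \<Rightarrow> 'a \<Rightarrow> nat set" where
  "positions a w = set (sorting_word G S a w)"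

lemma positions_one: "positions a \<one> = {}"
  using first_subword_sorting_word[OF first_subword_one] by (simp add: positions_def)

lemma positions_desc:
  assumes "full_word (a @ [r])" "r \<in> S" "w \<in> carrier G" "left_desc r w"
  shows "positions (r # a) w = insert 0 (Suc ` positions (a @ [r]) (r \<otimes> w))"
proof -
  have "r \<otimes> w \<in> carrier G" using assms by (simp add: S_carrier)
  then obtain ps where ps: "first_subword (a @ [r]) (r \<otimes> w) ps"
    using first_subword_exists assms by blast
  show ?thesis
    using first_subword_sorting_word[OF ps] first_subword_sorting_word[OF first_subword_desc[OF assms(2-4) ps]]
    by (simp add: positions_def)
qed

lemma positions_not_desc:
  assumes "full_word (a @ [r])" "r \<in> S" "w \<in> carrier G" "\<not> left_desc r w"
  shows "positions (r # a) w = Suc ` positions (a @ [r]) w"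
proof -
  obtain ps where ps: "first_subword (a @ [r]) w ps"
    using first_subword_exists assms by blast
  show ?thesis
    using first_subword_sorting_word[OF ps] first_subword_sorting_word[OF first_subword_not_desc[OF assms(2-4) ps]]
    by (simp add: positions_def)
qed

lemma srt_Cons_desc:
  assumes "left_desc r w" "inj_word (r # a)" "w \<in> carrier G"
  shows "srt (r # a) w \<longleftrightarrow> srt (a @ [r]) (r \<otimes> w)"
proof
  assume "srt (r # a) w"
  then show "srt (a @ [r]) (r \<otimes> w)"
  proof cases
    case (srt_rotate u)
    then have "u \<in> carrier G" using assms srt_carrier[of "a @ [r]" u] by (simp add: inj_word_Cons inj_word_snoc)
    then show ?thesis using srt_rotate assms by (simp add: inj_word_Cons)
  qed (use assms in auto)
next
  assume "srt (a @ [r]) (r \<otimes> w)"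
  moreover have "\<not> left_desc r (r \<otimes> w)" using assms desc_mult by (simp add: inj_word_Cons)
  ultimately have "srt (r # a) (r \<otimes> (r \<otimes> w))" by (rule srt_rotate)
  then show "srt (r # a) w" using assms by (simp add: inj_word_Cons)
qed

lemma srt_Cons_not_desc:
  assumes "\<not> left_desc r w" "inj_word (r # a)" "w \<in> carrier G"
  shows "srt (r # a) w \<longleftrightarrow> srt a w"
proof
  assume "srt (r # a) w"
  then show "srt a w"
  proof cases
    case (srt_rotate u)
    then have "u \<in> carrier G" using assms srt_carrier[of "a @ [r]" u] by (simp add: inj_word_Cons inj_word_snoc)
    then show ?thesis using srt_rotate assms desc_mult by (simp add: inj_word_Cons)
  qed
qed (use assms srt_drop in auto)

lemma srt_one: "srt a \<one>"
  by (induction a) (auto intro: srt_Nil srt_drop simp: left_desc_def)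

lemma letter_at_inj:
  assumes "distinct a" "a \<noteq> []" "letter_at a p = letter_at a q"
  shows "p mod length a = q mod length a"
  using assms by (simp add: letter_at_def nth_eq_iff_index_eq)

text \<open>
  Letters in \<open>K\<close> are those that the sorting word has already skipped; sortability means that they
  do not occur afterwards, so that they may be deleted from the Coxeter word.
\<close>

lemma positions_srt:
  assumes "full_word a" "w \<in> carrier G"
  shows "(\<forall>p. p + length a \<in> positions a w \<longrightarrow> p \<in> positions a w) \<and>
    (\<forall>p\<in>positions a w. letter_at a p \<notin> K) \<longleftrightarrow> srt (filter (\<lambda>x. x \<notin> K) a) w"
  using assms
proof (induction arbitrary: K rule: greedy_induct)
  case (one a)
  then show ?case by (simp add: positions_one srt_one)
next
  case (left_desc r a w)
  note pos = positions_desc[OF left_desc(3,2,4,6)]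
  have inj: "inj_word (r # filter (\<lambda>x. x \<notin> K) a)"
    using left_desc by (auto simp: full_word_def inj_word_def)
  show ?case
  proof (cases "r \<in> K")
    case True
    then have "\<not> srt (filter (\<lambda>x. x \<notin> K) (r # a)) w"
      using srt_not_desc[of "filter (\<lambda>x. x \<notin> K) a" w r] inj left_desc by (auto simp: inj_word_Cons)
    moreover have "0 \<in> positions (r # a) w" using pos by simp
    ultimately show ?thesis using True by (metis letter_at_0)
  next
    case False
    let ?P = "positions (a @ [r]) (r \<otimes> w)" and ?n = "length (a @ [r])"
    have "(\<forall>p. p + length (r # a) \<in> positions (r # a) w \<longrightarrow> p \<in> positions (r # a) w) \<longleftrightarrow>
        (\<forall>p. p + ?n \<in> ?P \<longrightarrow> p \<in> ?P)"
    proof -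
      have "(p + length (r # a) \<in> positions (r # a) w \<longrightarrow> p \<in> positions (r # a) w) \<longleftrightarrow>
          (case p of 0 \<Rightarrow> True | Suc q \<Rightarrow> q + ?n \<in> ?P \<longrightarrow> q \<in> ?P)" for p
        unfolding pos by (auto split: nat.split)
      then show ?thesis by (auto split: nat.split)
    qed
    moreover have "(\<forall>p\<in>positions (r # a) w. letter_at (r # a) p \<notin> K) \<longleftrightarrow>
        (\<forall>p\<in>?P. letter_at (a @ [r]) p \<notin> K)"
      unfolding pos using False by (auto simp: letter_at_Suc)
    moreover have "srt (filter (\<lambda>x. x \<notin> K) (r # a)) w \<longleftrightarrow>
        srt (filter (\<lambda>x. x \<notin> K) (a @ [r])) (r \<otimes> w)"
      using False srt_Cons_desc[OF left_desc(6) inj left_desc(4)] by simp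
    ultimately show ?thesis using left_desc.IH[of K] by simp
  qed
next
  case (not_desc r a w)
  note pos = positions_not_desc[OF not_desc(3,2,4,5)]
  let ?P = "positions (a @ [r]) w" and ?n = "length (a @ [r])"
  have inj: "inj_word (r # filter (\<lambda>x. x \<notin> K) a)" and r: "r \<notin> set a"
    using not_desc by (auto simp: full_word_def inj_word_def)
  have last: "letter_at (a @ [r]) (length a) = r" by (simp add: letter_at_def)
  have closed: "(\<forall>p. p + length (r # a) \<in> positions (r # a) w \<longrightarrow> p \<in> positions (r # a) w) \<longleftrightarrow>
      (\<forall>p. p + ?n \<in> ?P \<longrightarrow> p \<in> ?P) \<and> length a \<notin> ?P"
  proof -
    have "(p + length (r # a) \<in> positions (r # a) w \<longrightarrow> p \<in> positions (r # a) w) \<longleftrightarrow>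
        (case p of 0 \<Rightarrow> length a \<notin> ?P | Suc q \<Rightarrow> q + ?n \<in> ?P \<longrightarrow> q \<in> ?P)" for p
      unfolding pos by (auto split: nat.split)
    then show ?thesis by (auto split: nat.split)
  qed
  have letters: "(\<forall>p\<in>positions (r # a) w. letter_at (r # a) p \<notin> K) \<longleftrightarrow>
      (\<forall>p\<in>?P. letter_at (a @ [r]) p \<notin> K)"
    unfolding pos by (auto simp: letter_at_Suc)
  show ?case
  proof (cases "r \<in> K")
    case True
    then show ?thesis
      unfolding closed letters using not_desc.IH[of K] last by auto
  next
    case False
    have skipped: "letter_at (a @ [r]) p \<noteq> r"
      if closed: "\<forall>p. p + ?n \<in> ?P \<longrightarrow> p \<in> ?P" "length a \<notin> ?P" and "p \<in> ?P" for p
    proof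
      assume "letter_at (a @ [r]) p = r"
      then have "p mod ?n = length a"
        using letter_at_inj[of "a @ [r]" p "length a"] last not_desc(3) by (simp add: full_word_def)
      then have p: "p = length a + p div ?n * ?n"
        by (metis add.commute div_mult_mod_eq)
      have "length a + k * ?n \<in> ?P \<Longrightarrow> length a \<in> ?P" for k
      proof (induction k)
        case (Suc k)
        have "length a + Suc k * ?n = (length a + k * ?n) + ?n" by simp
        then show ?case using Suc closed(1) by metis
      qed simp
      then show False using p that by metis
    qed
    have "filter (\<lambda>x. x \<notin> insert r K) (a @ [r]) = filter (\<lambda>x. x \<notin> K) a"
      using r by (auto intro: filter_cong)
    then have "srt (filter (\<lambda>x. x \<notin> K) (r # a)) w \<longleftrightarrow>
        srt (filter (\<lambda>x. x \<notin> insert r K) (a @ [r])) w"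
      using False srt_Cons_not_desc[OF not_desc(5) inj not_desc(4)] by simp
    then show ?thesis
      unfolding closed letters using not_desc.IH[of "insert r K"] last skipped by auto
  qed
qed

theorem sortable_elements_srt:
  assumes a: "full_word a"
  shows "sortable_elements G S a = {w \<in> carrier G. srt a w}"
proof -
  have "(\<forall>k. sorting_block G S a w (Suc k) \<subseteq> sorting_block G S a w k) \<longleftrightarrow> srt a w"
    if w: "w \<in> carrier G" for w
  proof -
    let ?n = "length a"
    have block: "sorting_block G S a w k = letter_at a ` {p \<in> positions a w. p div ?n = k}" for k
      by (simp add: sorting_block_def positions_def)
    have "(\<forall>k. sorting_block G S a w (Suc k) \<subseteq> sorting_block G S a w k) \<longleftrightarrow>
        (\<forall>p. p + ?n \<in> positions a w \<longrightarrow> p \<in> positions a w)"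
    proof (cases "a = []")
      case False
      show ?thesis
      proof (intro iffI allI impI)
        fix p assume dec: "\<forall>k. sorting_block G S a w (Suc k) \<subseteq> sorting_block G S a w k"
          and p: "p + ?n \<in> positions a w"
        have "letter_at a (p + ?n) \<in> sorting_block G S a w (Suc (p div ?n))"
          unfolding block using p False by auto
        then have "letter_at a (p + ?n) \<in> sorting_block G S a w (p div ?n)" using dec by blast
        then obtain q where q: "q \<in> positions a w" "q div ?n = p div ?n" "letter_at a q = letter_at a p"
          unfolding block by (auto simp: letter_at_def)
        then have "q mod ?n = p mod ?n" using letter_at_inj a False by (metis full_word_def)
        then have "q = p" using q by (metis div_mult_mod_eq)
        then show "p \<in> positions a w" using q by simp
      next
        fix k assume cl: "\<forall>p. p + ?n \<in> positions a w \<longrightarrow> p \<in> positions a w"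
        show "sorting_block G S a w (Suc k) \<subseteq> sorting_block G S a w k"
        proof
          fix s assume "s \<in> sorting_block G S a w (Suc k)"
          then obtain p where p: "p \<in> positions a w" "p div ?n = Suc k" "s = letter_at a p"
            unfolding block by auto
          then have "?n \<le> p" by (metis div_less not_less old.nat.distinct(2))
          then obtain q where q: "p = q + ?n" by (metis add.commute le_Suc_ex)
          then have "q \<in> positions a w" "q div ?n = k" "s = letter_at a q"
            using p cl False by (auto simp: letter_at_def)
          then show "s \<in> sorting_block G S a w k" unfolding block by blast
        qed
      qed
    qed (auto simp: sorting_block_def)
    also have "\<dots> \<longleftrightarrow> srt a w"
      using positions_srt[OF a w, of "{}"] by simp
    finally show ?thesis .
  qed
  then show ?thesis by (auto simp: sortable_elements_def)
qed

section \<open>The Cambrian congruence\<close>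

lemma pi_down_proj:
  assumes a: "full_word a" and w: "w \<in> carrier G"
  shows "pi_down G S a w = proj a w"
proof -
  have inj: "inj_word a" using a full_inj_word by blast
  have *: "v \<in> sortable_elements G S a \<longleftrightarrow> v \<in> carrier G \<and> srt a v" for v
    using sortable_elements_srt[OF a] by auto
  have p: "proj a w \<in> carrier G" "srt a (proj a w)" "le (proj a w) w"
    using proj_carrier proj_sortable proj_le inj w by blast+
  show ?thesis
    unfolding pi_down_def
  proof (rule the_equality)
    show "maximal_sortable_below G S a w (proj a w)"
      unfolding maximal_sortable_below_def *
    proof (intro conjI ballI impI)
      show "weak_le G S (proj a w) w" using p w weak_le_iff by blast
      fix u assume "u \<in> sortable_elements G S a" and le: "weak_le G S u w \<and> weak_le G S (proj a w) u"
      then have u: "u \<in> carrier G" "srt a u" using * by auto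
      then have "le u w" "le (proj a w) u" using le p w weak_le_iff by auto
      then show "u = proj a w" using proj_greatest[OF u(2) inj w] le_antisym u(1) p(1) by blast
    qed (use p in auto)
  next
    fix v assume v: "maximal_sortable_below G S a w v"
    then have "v \<in> carrier G" "srt a v" "le v w"
      using weak_le_iff w by (auto simp: maximal_sortable_below_def *)
    then have "le v (proj a w)" using proj_greatest inj w by blast
    then show "v = proj a w"
      using v p w \<open>v \<in> carrier G\<close> * weak_le_iff by (auto simp: maximal_sortable_below_def)
  qed
qed

lemma coxeter_word_full: "coxeter_word G S c a \<Longrightarrow> full_word a"
  by (simp add: coxeter_word_def full_word_def card_distinct)

text \<open>
  The words \<open>b\<close> and \<open>rev a\<close> may be different, but both represent \<open>inv c\<close>.
\<close>

lemma sortable_elements_inverse: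
  assumes a: "coxeter_word G S c a" and b: "coxeter_word G S (inv c) b"
  shows "sortable_elements G S b = sortable_elements G S (rev a)"
proof -
  have full: "full_word a" "full_word (rev a)" "full_word b"
    using coxeter_word_full[OF a] coxeter_word_full[OF b] by (auto simp: full_word_def)
  have "a \<in> lists S" using full by (auto simp: full_word_def)
  then have "val (rev a) = val b" using a b by (simp add: val_rev coxeter_word_def)
  then have "srt b w \<longleftrightarrow> srt (rev a) w" for w
    using full full_inj_word by (intro srt_value_cong) (auto simp: full_word_def)
  then show ?thesis using sortable_elements_srt full by auto
qed

end

theorem proposition1p3:
  fixes G :: "('a, 'b) monoid_scheme" (structure)
    and S :: "'a set" and m :: "'a \<Rightarrow> 'a \<Rightarrow> enat" and w\<^sub>0 c :: 'a and a b :: "'a list"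
  assumes "coxeter_system G S m"
    and "finite (carrier G)"
    and "longest_element G S w\<^sub>0"
    and "coxeter_word G S c a"
    and "coxeter_word G S (inv c) b"
  shows "(\<forall>x\<in>carrier G. \<forall>y\<in>carrier G.
            (x, y) \<in> cambrian_congruence G S a \<longleftrightarrow>
            (x \<otimes> w\<^sub>0, y \<otimes> w\<^sub>0) \<in> cambrian_congruence G S b) \<and>
         anti_isomorphic (sortable_elements G S a) (weak_le G S)
                         (sortable_elements G S b) (weak_le G S)"
proof -
  interpret coxeter_group G S m
    using assms(1) by (rule coxeter_group.intro)
  let ?b = "rev a"
  note w = assms(3)
  have w0: "w\<^sub>0 \<in> carrier G" "w\<^sub>0 \<otimes> w\<^sub>0 = \<one>"
    using w longest_involution by (auto simp: longest_element_def)
  have full: "full_word a" "full_word ?b" "full_word b"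
    using coxeter_word_full[OF assms(4)] coxeter_word_full[OF assms(5)] by (auto simp: full_word_def)
  have inj: "inj_word a" "inj_word ?b" using full full_inj_word by auto
  have sort_b: "sortable_elements G S b = sortable_elements G S ?b"
    using sortable_elements_inverse assms(4,5) by blast
  then have pi_b: "pi_down G S b = pi_down G S ?b"
    by (simp add: pi_down_def maximal_sortable_below_def fun_eq_iff)
  have iff: "proj ?b (x \<otimes> w\<^sub>0) = proj ?b (y \<otimes> w\<^sub>0) \<longleftrightarrow> proj a x = proj a y"
    if "x \<in> carrier G" "y \<in> carrier G" for x y
    using proj_mult_longest_iff[OF w inj(1) that] .
  have part1: "(x, y) \<in> cambrian_congruence G S a \<longleftrightarrow>
      (x \<otimes> w\<^sub>0, y \<otimes> w\<^sub>0) \<in> cambrian_congruence G S b"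
    if "x \<in> carrier G" "y \<in> carrier G" for x y
    using iff that w0 full by (simp add: cambrian_congruence_def pi_b pi_down_proj)
  let ?A = "sortable_elements G S a" and ?B = "sortable_elements G S ?b"
  have A: "u \<in> ?A \<longleftrightarrow> u \<in> carrier G \<and> srt a u" and B: "u \<in> ?B \<longleftrightarrow> u \<in> carrier G \<and> srt ?b u" for u
    using sortable_elements_srt full by auto
  define f where "f u = proj ?b (u \<otimes> w\<^sub>0)" for u
  define g where "g u = proj a (u \<otimes> w\<^sub>0)" for u
  have ww: "u \<otimes> w\<^sub>0 \<otimes> w\<^sub>0 = u" if "u \<in> carrier G" for u using that w0 by (simp add: m_assoc)
  have fB: "f u \<in> ?B" if "u \<in> carrier G" for u
    using that w0(1) proj_carrier[OF inj(2)] proj_sortable[OF inj(2)] unfolding f_def B by simp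
  have gA: "g u \<in> ?A" if "u \<in> carrier G" for u
    using that w0(1) proj_carrier[OF inj(1)] proj_sortable[OF inj(1)] unfolding g_def A by simp
  have gf: "g (f u) = u" if "u \<in> ?A" for u
  proof -
    have u: "u \<in> carrier G" "srt a u" "f u \<in> carrier G" using that fB A B by auto
    have "proj ?b (f u \<otimes> w\<^sub>0 \<otimes> w\<^sub>0) = proj ?b (u \<otimes> w\<^sub>0)"
      using ww[OF u(3)] proj_fixes[of ?b "f u"] inj fB[OF u(1)] B by (simp add: f_def)
    then have "proj a (f u \<otimes> w\<^sub>0) = proj a u" using iff u w0 by simp
    then show ?thesis using proj_fixes u inj by (simp add: g_def)
  qed
  have fg: "f (g u) = u" if "u \<in> ?B" for u
  proof -
    have u: "u \<in> carrier G" "srt ?b u" "g u \<in> carrier G" using that gA A B by auto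
    have "proj a (g u) = proj a (u \<otimes> w\<^sub>0)"
      using proj_fixes[of a "g u"] inj gA[OF u(1)] A by (simp add: g_def)
    then have "proj ?b (g u \<otimes> w\<^sub>0) = proj ?b (u \<otimes> w\<^sub>0 \<otimes> w\<^sub>0)" using iff u w0 by simp
    then show ?thesis using proj_fixes u inj ww by (simp add: f_def)
  qed
  have "bij_betw f ?A ?B"
    using fB gA gf fg A B by (intro bij_betw_byWitness[where f' = g]) auto
  moreover have "weak_le G S u v \<longleftrightarrow> weak_le G S (f v) (f u)" if "u \<in> ?A" "v \<in> ?A" for u v
  proof -
    have uv: "u \<in> carrier G" "v \<in> carrier G" "f u \<in> carrier G" "f v \<in> carrier G"
      using that fB A B by auto
    have "le (f v) (f u)" if "le u v"
      using le_mult_longest[OF w uv(1,2) that] proj_mono inj uv w0 by (simp add: f_def)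
    moreover have "le (g (f u)) (g (f v))" if "le (f v) (f u)"
      using le_mult_longest[OF w uv(4,3) that] proj_mono inj uv w0 by (simp add: g_def)
    ultimately show ?thesis using gf that uv weak_le_iff by metis
  qed
  ultimately have "anti_isomorphic ?A (weak_le G S) ?B (weak_le G S)"
    unfolding anti_isomorphic_def by blast
  then show ?thesis using part1 sort_b by simp
qed

end
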